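(* Let $X$ be a complex Hermitian vector space with $\dim_{\mathbf C} X = 8$ (so $X\cong \mathbf R^{16}$ as a real Euclidean space), with Kähler form $\omega$ and a holomorphic volume form $\Omega$. Let $X = X_1\oplus X_2$ be an orthogonal decomposition into complex subspaces with $\dim_{\mathbf C} X_1=\dim_{\mathbf C}X_2 = 4$, equipped with holomorphic volume forms $\Omega_1$ and $\Omega_2$, respectively. Then the form \[ \Phi := \operatorname{Re}\Omega + \tfrac{1}{4!}\omega^4 + \operatorname{Re}(\Omega_1+\Omega_2)\wedge \tfrac12\omega^2 \in \bigwedge\nolimits^{8} X \] is a self-dual calibration. Specifically, for all $\xi\in\mathbf G(X,8)$, \[ |\Phi(\xi)| \le |\Omega(\xi)| + \tfrac1{4!}|\omega^4(\xi)| + |(\Omega_1\wedge\tfrac12\omega^2)(\xi)| + |(\Omega_2\wedge\tfrac12\omega^2)(\xi)| \le 1 . \] Moreover, $\Phi^2 = \Phi\wedge\Phi = 294\,\mathrm{vol}$, where $\mathrm{vol} = \tfrac1{8!}\omega^8$ is the volume form on $X$.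
   Context: For a real Euclidean vector space $X$, $\bigwedge^m X$ denotes the space of alternating real $m$-linear forms on $X$, identified with the dual of the space $\bigwedge_m X$ of $m$-vectors; complex-valued alternating forms are evaluated on $m$-vectors in the same way. $\bigwedge_m X$ and $\bigwedge^m X$ carry the Euclidean inner products determined by $\langle x_1\wedge\dots\wedge x_m,y_1\wedge\dots\wedge y_m\rangle=\det(\langle x_i,y_j\rangle)$. $\mathbf G(X,m)$ is the set of simple $m$-vectors $\xi=x_1\wedge\dots\wedge x_m$ with $|\xi|=1$ (oriented $m$-planes). The comass of $\alpha\in\bigwedge^mX$ is $\|\alpha\|=\sup\{\alpha(\xi):\xi\in\mathbf G(X,m)\}$, and $\alpha$ is called a calibration if $\|\alpha\|\le 1$. The wedge product is normalized by $\alpha\wedge\beta=\frac{(k+l)!}{k!\,l!}\operatorname{Alt}(\alpha\otimes\beta)$ for $\alpha$ of degree $k$ and $\beta$ of degree $l$, where $\operatorname{Alt}(T)(x_1,\dots,x_m)=\frac1{m!}\sum_{\sigma\in S_m}\operatorname{sgn}(\sigma)T(x_{\sigma(1)},\dots,x_{\sigma(m)})$; powers are wedge powers. For a complex Hermitian space with Hermitian product $H$, conjugate linear in the first argument, write $H=\langle\cdot,\cdot\rangle+\mathbf i\,\omega$; $\langle\cdot,\cdot\rangle$ is the real Euclidean inner product and $\omega$ is the Kähler form. A holomorphic volume form on a complex $d$-dimensional Hermitian space is $Z_1\wedge\dots\wedge Z_d$, where $Z_1,\dots,Z_d$ are the ($\mathbf C$-linear) coordinate functions of a unitary basis. Forms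 on $X_i$ are regarded as forms on $X$ via the orthogonal projection $X\to X_i$. The orientation of $X$ is given by $\mathrm{vol}=\frac1{8!}\omega^8$; the Hodge star is defined by $\alpha\wedge\ast\mu=\langle\alpha,\mu\rangle\,\mathrm{vol}$ and $\mu\in\bigwedge^8X$ is self-dual if $\ast\mu=\mu$. *)

theory Defs
  imports "HOL-Analysis.Analysis" "HOL-Combinatorics.Permutations"
begin

text \<open>
  An m-form is a function of a sequence x of vectors that looks only at the entries
  x 0, ..., x (m - 1).  The degree is passed explicitly to every operation.
\<close>

type_synonym ('a, 'b) form = "(nat \<Rightarrow> 'a) \<Rightarrow> 'b"

definition alt_forms :: "nat \<Rightarrow> ('a::real_vector, 'b::real_vector) form set" where
  "alt_forms m = {\<alpha>.
     (\<forall>x y. (\<forall>i<m. x i = y i) \<longrightarrow> \<alpha> x = \<alpha> y) \<and>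
     (\<forall>i<m. \<forall>x. linear (\<lambda>v. \<alpha> (x(i := v)))) \<and>
     (\<forall>x. \<forall>i<m. \<forall>j<m. i \<noteq> j \<and> x i = x j \<longrightarrow> \<alpha> x = 0)}"

definition Alt :: "nat \<Rightarrow> ('a, 'b::field_char_0) form \<Rightarrow> ('a, 'b) form" where
  "Alt m T = (\<lambda>x. 1 / fact m * (\<Sum>\<sigma> | \<sigma> permutes {..<m}. of_int (sign \<sigma>) * T (x \<circ> \<sigma>)))"

definition tensor :: "nat \<Rightarrow> ('a, 'b::field_char_0) form \<Rightarrow> ('a, 'b) form \<Rightarrow> ('a, 'b) form" where
  "tensor k \<alpha> \<beta> = (\<lambda>x. \<alpha> x * \<beta> (\<lambda>i. x (k + i)))"

definition wedge :: "nat \<Rightarrow> nat \<Rightarrow> ('a, 'b::field_char_0) form \<Rightarrow> ('a, 'b) form \<Rightarrow> ('a, 'b) form" where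
  "wedge k l \<alpha> \<beta> = (\<lambda>x. fact (k + l) / (fact k * fact l) * Alt (k + l) (tensor k \<alpha> \<beta>) x)"

text \<open>The n-th wedge power of a k-form.\<close>

primrec wedge_power :: "nat \<Rightarrow> ('a, 'b::field_char_0) form \<Rightarrow> nat \<Rightarrow> ('a, 'b) form" where
  "wedge_power k \<alpha> 0 = (\<lambda>x. 1)"
| "wedge_power k \<alpha> (Suc n) = wedge (k * n) k (wedge_power k \<alpha> n) \<alpha>"

text \<open>The wedge product of the covectors Z 0, ..., Z (n - 1).\<close>

primrec wedge_covectors :: "(nat \<Rightarrow> 'a \<Rightarrow> 'b::field_char_0) \<Rightarrow> nat \<Rightarrow> ('a, 'b) form" where
  "wedge_covectors Z 0 = (\<lambda>x. 1)"
| "wedge_covectors Z (Suc n) = wedge n 1 (wedge_covectors Z n) (\<lambda>x. Z n (x 0))"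

definition pullback :: "('a \<Rightarrow> 'c) \<Rightarrow> ('c, 'b) form \<Rightarrow> ('a, 'b) form" where
  "pullback p \<alpha> = (\<lambda>x. \<alpha> (p \<circ> x))"

text \<open>
  The space of m-vectors is the dual of the space of alternating real m-forms; the simple
  m-vector given by x is evaluation at x.
\<close>

type_synonym 'a mvector = "('a, real) form \<Rightarrow> real"

definition simple_mvector :: "nat \<Rightarrow> (nat \<Rightarrow> 'a::real_vector) \<Rightarrow> 'a mvector" where
  "simple_mvector m x = restrict (\<lambda>\<alpha>. \<alpha> x) (alt_forms m)"

definition ceval :: "('a, complex) form \<Rightarrow> 'a mvector \<Rightarrow> complex" where
  "ceval \<alpha> \<xi> = Complex (\<xi> (\<lambda>x. Re (\<alpha> x))) (\<xi> (\<lambda>x. Im (\<alpha> x)))"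

text \<open>
  The Leibniz formula for the determinant of the matrix of inner products of x i and y j
  (i, j < m), i.e. the inner product of the simple m-vectors given by x and y.
\<close>

definition gram_det :: "nat \<Rightarrow> (nat \<Rightarrow> 'a::real_inner) \<Rightarrow> (nat \<Rightarrow> 'a) \<Rightarrow> real" where
  "gram_det m x y = (\<Sum>\<sigma> | \<sigma> permutes {..<m}. of_int (sign \<sigma>) * (\<Prod>i<m. x i \<bullet> y (\<sigma> i)))"

text \<open>The oriented m-planes: simple m-vectors of norm 1.\<close>

definition oriented_planes :: "nat \<Rightarrow> ('a::real_inner) mvector set" where
  "oriented_planes m = {simple_mvector m x | x. sqrt (gram_det m x x) = 1}"

definition comass :: "nat \<Rightarrow> ('a::real_inner, real) form \<Rightarrow> real" where
  "comass m \<alpha> = (SUP \<xi>\<in>oriented_planes m. \<xi> \<alpha>)"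

definition calibration :: "nat \<Rightarrow> ('a::real_inner, real) form \<Rightarrow> bool" where
  "calibration m \<alpha> \<longleftrightarrow> \<alpha> \<in> alt_forms m \<and> comass m \<alpha> \<le> 1"

text \<open>
  Euclidean inner product of alternating m-forms.  Every set of m distinct basis vectors is
  met by exactly m! of the tuples in the sum, all with the same contribution, and the other
  tuples contribute 0; so this is the sum of the products of the coefficients with respect to
  an orthonormal basis of the space of m-vectors.  The lemma \<open>form_inner_covectors\<close> below shows
  that it is given on simple forms by the determinant of the inner products of the covectors.
\<close>

definition form_inner :: "nat \<Rightarrow> ('a::euclidean_space, real) form \<Rightarrow> ('a, real) form \<Rightarrow> real" where
  "form_inner m \<alpha> \<beta> = 1 / fact m * (\<Sum>e \<in> {..<m} \<rightarrow>\<^sub>E Basis. \<alpha> e * \<beta> e)"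

lemma wedge_covectors_eq:
  fixes Z :: "nat \<Rightarrow> 'a \<Rightarrow> 'b::field_char_0"
  shows "wedge_covectors Z n x =
     (\<Sum>\<sigma> | \<sigma> permutes {..<n}. of_int (sign \<sigma>) * (\<Prod>i<n. Z i (x (\<sigma> i))))"
proof (induction n arbitrary: x)
  case 0
  have "{\<sigma>. \<sigma> permutes ({}::nat set)} = {id}" by auto
  then show ?case by simp
next
  case (Suc n)
  let ?P = "\<lambda>n. {\<sigma>. \<sigma> permutes {..<n::nat}}"
  let ?F = "\<lambda>\<rho>. of_int (sign \<rho>) * (\<Prod>i<Suc n. Z i (x (\<rho> i)))"
  have fact_cancel: "fact (n + 1) / (fact n * fact 1) * (1 / fact (n + 1) * s) = s / fact n" for s :: 'b
    using fact_nonzero[of "n + 1", where 'a='b] by (simp del: fact_Suc)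
  have step: "of_int (sign \<rho>) * (wedge_covectors Z n (x \<circ> \<rho>) * Z n ((x \<circ> \<rho>) (n + 0)))
      = (\<Sum>\<sigma>\<in>?P n. ?F (\<rho> \<circ> \<sigma>))" if \<rho>: "\<rho> \<in> ?P (Suc n)" for \<rho>
  proof -
    have "of_int (sign \<rho>) * (of_int (sign \<sigma>) * (\<Prod>i<n. Z i ((x \<circ> \<rho>) (\<sigma> i))) * Z n ((x \<circ> \<rho>) (n + 0)))
        = ?F (\<rho> \<circ> \<sigma>)" if \<sigma>: "\<sigma> \<in> ?P n" for \<sigma>
    proof -
      have "\<sigma> n = n" using \<sigma> by (simp add: permutes_def)
      moreover have "sign (\<rho> \<circ> \<sigma>) = sign \<rho> * sign \<sigma>"
        using \<rho> \<sigma> by (intro sign_compose) (auto intro: permutes_imp_permutation[OF finite_lessThan])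
      ultimately show ?thesis by (simp add: mult.assoc)
    qed
    then show ?thesis
      unfolding Suc.IH sum_distrib_left sum_distrib_right by (intro sum.cong) auto
  qed
  have "wedge_covectors Z (Suc n) x = (\<Sum>\<rho>\<in>?P (Suc n). \<Sum>\<sigma>\<in>?P n. ?F (\<rho> \<circ> \<sigma>)) / fact n"
    unfolding wedge_covectors.simps wedge_def Alt_def tensor_def fact_cancel
    using step by simp
  also have "(\<Sum>\<rho>\<in>?P (Suc n). \<Sum>\<sigma>\<in>?P n. ?F (\<rho> \<circ> \<sigma>)) = (\<Sum>\<sigma>\<in>?P n. \<Sum>\<rho>\<in>?P (Suc n). ?F (\<rho> \<circ> \<sigma>))"
    by (rule sum.swap)
  also have "\<dots> = (\<Sum>\<sigma>\<in>?P n. \<Sum>\<rho>\<in>?P (Suc n). ?F \<rho>)"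
  proof (rule sum.cong[OF refl])
    fix \<sigma> assume "\<sigma> \<in> ?P n"
    then have "\<sigma> permutes {..<Suc n}" by (auto intro: permutes_subset)
    from sum_permutations_compose_right[OF this, of ?F]
    show "(\<Sum>\<rho>\<in>?P (Suc n). ?F (\<rho> \<circ> \<sigma>)) = (\<Sum>\<rho>\<in>?P (Suc n). ?F \<rho>)" by simp
  qed
  also have "\<dots> = fact n * (\<Sum>\<rho>\<in>?P (Suc n). ?F \<rho>)"
    by (simp add: card_permutations[OF refl])
  finally show ?case by simp
qed

lemma form_inner_covectors:
  fixes x y :: "nat \<Rightarrow> 'a::euclidean_space"
  shows "form_inner m (wedge_covectors (\<lambda>i v. x i \<bullet> v) m) (wedge_covectors (\<lambda>i v. y i \<bullet> v) m) = gram_det m x y"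
proof -
  let ?P = "{\<sigma>. \<sigma> permutes {..<m}}"
  let ?E = "{..<m} \<rightarrow>\<^sub>E (Basis :: 'a set)"
  let ?s = "\<lambda>\<sigma>. real_of_int (sign \<sigma>)"
  let ?G = "\<lambda>\<sigma>. ?s \<sigma> * (\<Prod>i<m. x i \<bullet> y (\<sigma> i))"
  have re: "(\<Prod>i<m. f i (e (\<sigma> i))) = (\<Prod>j<m. f (inv \<sigma> j) (e j))" if "\<sigma> \<in> ?P"
    for \<sigma> and f :: "nat \<Rightarrow> 'a \<Rightarrow> real" and e
    using that by (intro prod.reindex_bij_witness[of _ "inv \<sigma>" \<sigma>])
      (auto simp: permutes_inverses permutes_in_image[of \<sigma> "{..<m}", simplified]
        permutes_in_image[OF permutes_inv, of \<sigma> "{..<m}", simplified])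
  have sum_e: "(\<Sum>e\<in>?E. (?s \<sigma> * (\<Prod>i<m. x i \<bullet> e (\<sigma> i))) * (?s \<tau> * (\<Prod>i<m. y i \<bullet> e (\<tau> i))))
      = ?G (inv \<tau> \<circ> \<sigma>)" if "\<sigma> \<in> ?P" "\<tau> \<in> ?P" for \<sigma> \<tau>
  proof -
    have p: "\<sigma> permutes {..<m}" "\<tau> permutes {..<m}" using that by auto
    have "(\<Sum>e\<in>?E. (?s \<sigma> * (\<Prod>i<m. x i \<bullet> e (\<sigma> i))) * (?s \<tau> * (\<Prod>i<m. y i \<bullet> e (\<tau> i))))
        = ?s \<sigma> * ?s \<tau> * (\<Sum>e\<in>?E. \<Prod>j<m. (x (inv \<sigma> j) \<bullet> e j) * (y (inv \<tau> j) \<bullet> e j))"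
      unfolding re[OF that(1), of "\<lambda>i v. x i \<bullet> v"] re[OF that(2), of "\<lambda>i v. y i \<bullet> v"]
      by (simp add: prod.distrib sum_distrib_left mult_ac)
    also have "(\<Sum>e\<in>?E. \<Prod>j<m. (x (inv \<sigma> j) \<bullet> e j) * (y (inv \<tau> j) \<bullet> e j))
        = (\<Prod>j<m. \<Sum>b\<in>Basis. (x (inv \<sigma> j) \<bullet> b) * (y (inv \<tau> j) \<bullet> b))"
      by (rule prod_sum_PiE[symmetric]) auto
    also have "\<dots> = (\<Prod>j<m. x (inv \<sigma> j) \<bullet> y (inv \<tau> j))"
      by (simp add: euclidean_inner[symmetric])
    also have "\<dots> = (\<Prod>i<m. x i \<bullet> y ((inv \<tau> \<circ> \<sigma>) i))"
      using p by (intro prod.reindex_bij_witness[of _ \<sigma> "inv \<sigma>"])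
        (auto simp: permutes_inverses permutes_in_image[of \<sigma> "{..<m}", simplified]
          permutes_in_image[OF permutes_inv, of \<sigma> "{..<m}", simplified])
    also have "?s \<sigma> * ?s \<tau> = ?s (inv \<tau> \<circ> \<sigma>)"
    proof -
      have "permutation \<sigma>" "permutation \<tau>"
        using p permutes_imp_permutation[OF finite_lessThan] by blast+
      then show ?thesis
        by (simp add: sign_compose permutation_inverse sign_inverse)
    qed
    finally show ?thesis .
  qed
  have "(\<Sum>e\<in>?E. wedge_covectors (\<lambda>i v. x i \<bullet> v) m e * wedge_covectors (\<lambda>i v. y i \<bullet> v) m e)
      = (\<Sum>e\<in>?E. \<Sum>\<sigma>\<in>?P. \<Sum>\<tau>\<in>?P. (?s \<sigma> * (\<Prod>i<m. x i \<bullet> e (\<sigma> i))) * (?s \<tau> * (\<Prod>i<m. y i \<bullet> e (\<tau> i))))"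
    by (simp only: wedge_covectors_eq sum_product)
  also have "\<dots> = (\<Sum>\<sigma>\<in>?P. \<Sum>e\<in>?E. \<Sum>\<tau>\<in>?P. (?s \<sigma> * (\<Prod>i<m. x i \<bullet> e (\<sigma> i))) * (?s \<tau> * (\<Prod>i<m. y i \<bullet> e (\<tau> i))))"
    by (rule sum.swap)
  also have "\<dots> = (\<Sum>\<sigma>\<in>?P. \<Sum>\<tau>\<in>?P. \<Sum>e\<in>?E. (?s \<sigma> * (\<Prod>i<m. x i \<bullet> e (\<sigma> i))) * (?s \<tau> * (\<Prod>i<m. y i \<bullet> e (\<tau> i))))"
    by (intro sum.cong refl sum.swap)
  also have "\<dots> = (\<Sum>\<sigma>\<in>?P. \<Sum>\<tau>\<in>?P. ?G (inv \<tau> \<circ> \<sigma>))"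
    using sum_e by simp
  also have "\<dots> = (\<Sum>\<sigma>\<in>?P. \<Sum>\<tau>\<in>?P. ?G \<tau>)"
  proof (rule sum.cong[OF refl])
    fix \<sigma> assume "\<sigma> \<in> ?P"
    then have "\<sigma> permutes {..<m}" by simp
    from sum_permutations_inverse[of "\<lambda>\<tau>. ?G (\<tau> \<circ> \<sigma>)" "{..<m}"]
      sum_permutations_compose_right[OF this, of ?G]
    show "(\<Sum>\<tau>\<in>?P. ?G (inv \<tau> \<circ> \<sigma>)) = (\<Sum>\<tau>\<in>?P. ?G \<tau>)" by simp
  qed
  also have "\<dots> = fact m * gram_det m x y"
    by (simp add: card_permutations[OF refl] gram_det_def)
  finally show ?thesis by (simp add: form_inner_def)
qed

definition hodge_star ::
    "('a::euclidean_space, real) form \<Rightarrow> nat \<Rightarrow> ('a, real) form \<Rightarrow> ('a, real) form" where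
  "hodge_star vol m \<mu> = (THE \<nu>. \<nu> \<in> alt_forms (DIM('a) - m) \<and>
     (\<forall>\<alpha>\<in>alt_forms m. wedge m (DIM('a) - m) \<alpha> \<nu> = (\<lambda>x. form_inner m \<alpha> \<mu> * vol x)))"

text \<open>
  A finite-dimensional Hermitian space, the real part of whose Hermitian product is the
  Euclidean structure of the type.  Positive definiteness follows from \<open>Re_H\<close>.
\<close>

locale hermitian_space = vector_space scaleC
  for scaleC :: "complex \<Rightarrow> 'a::euclidean_space \<Rightarrow> 'a" +
  fixes H :: "'a \<Rightarrow> 'a \<Rightarrow> complex"
  assumes scaleC_of_real: "scaleC (complex_of_real r) x = r *\<^sub>R x"
    and H_add_right: "H x (y + z) = H x y + H x z"
    and H_scale_right: "H x (scaleC c y) = c * H x y"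
    and H_cnj: "H y x = cnj (H x y)"
    and Re_H: "Re (H x y) = x \<bullet> y"

definition kahler_form :: "('a \<Rightarrow> 'a \<Rightarrow> complex) \<Rightarrow> ('a, real) form" where
  "kahler_form H = (\<lambda>x. Im (H (x 0) (x 1)))"

definition unitary_basis ::
    "(complex \<Rightarrow> 'a::ab_group_add \<Rightarrow> 'a) \<Rightarrow> ('a \<Rightarrow> 'a \<Rightarrow> complex) \<Rightarrow> 'a set \<Rightarrow> nat \<Rightarrow> (nat \<Rightarrow> 'a) \<Rightarrow> bool"
  where
  "unitary_basis scaleC H Y d e \<longleftrightarrow>
     (\<forall>i<d. \<forall>j<d. H (e i) (e j) = (if i = j then 1 else 0)) \<and>
     module.span scaleC (e ` {..<d}) = Y"

text \<open>
  Holomorphic volume forms on a complex d-dimensional subspace Y.  Since \<open>representation\<close> is 0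
  outside the span, only the values on vectors of Y are meaningful; use \<open>pullback\<close> along
  \<open>orth_proj Y\<close> to obtain a form on the whole space.
\<close>

definition holomorphic_volume_form ::
    "(complex \<Rightarrow> 'a::ab_group_add \<Rightarrow> 'a) \<Rightarrow> ('a \<Rightarrow> 'a \<Rightarrow> complex) \<Rightarrow> 'a set \<Rightarrow> nat \<Rightarrow> ('a, complex) form \<Rightarrow> bool"
  where
  "holomorphic_volume_form scaleC H Y d \<Omega> \<longleftrightarrow>
     (\<exists>e. unitary_basis scaleC H Y d e \<and>
          \<Omega> = wedge_covectors (\<lambda>i v. module.representation scaleC (e ` {..<d}) v (e i)) d)"

definition orth_proj :: "'a::real_inner set \<Rightarrow> 'a \<Rightarrow> 'a" where
  "orth_proj Y v = (THE y. y \<in> Y \<and> (\<forall>w\<in>Y. orthogonal w (v - y)))"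

end

theory Submission
  imports Defs "Jordan_Normal_Form.Determinant"
begin

hide_const (open) Determinants.det Matrix.orthogonal
no_notation scalar_prod (infix \<open>\<bullet>\<close> 70)

text \<open>
  Restricted to an oriented 8-plane, the Kaehler form has a skew normal form: the plane has an
  orthonormal basis u_2k, u_2k+1 = i c_k f_2k + s_k f_2k+1 (k < 4) with f a unitary frame and
  c_k^2 + s_k^2 = 1.  On it the four terms have absolute values s_0 s_1 s_2 s_3, c_0 c_1 c_2 c_3 and
  at most the sum over k < l of c_i c_j s_k s_l a_kl, with {i, j} the complement of {k, l} and a_kl the
  modulus of the minor of f_2k, f_2k+1, f_2l, f_2l+1 on X_1 (respectively X_2).  Complementary minors
  of a unitary matrix have the same modulus, so a_kl for X_2 is a_ij for X_1; and the a_kl for X_1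
  add up to at most 1.  The bound then follows from (c_i c_j + s_i s_j) (c_k c_l + s_k s_l) \<le> 1.

  For the self-duality, let a_0, ..., a_7 be vectors.  It suffices that the wedge of their dual
  covectors with the form is the value of the form on a times the volume.  Modulo dz_j, the covector
  of a is the sum of z_j(a) times half the conjugate of dz_j, which gives this for the wedge of all
  dz_j; the other summands mix this with the analogous fact for dx_j \<and> dy_j.
\<close>

section \<open>Wedge products of lists of covectors\<close>

text \<open>The step with real content is that the six numbers a_kl add up to at most 1. Projecting
  the frame to X_1 gives eight vectors of total squared length 4 in a 4-dimensional space. Row
  operations of determinant 1 make each pair f_2k, f_2k+1 orthogonal and of common squared length
  d_k, with the d_k adding up to at most 2; all minors are unchanged. Hadamard's inequality a_kl
  \<le> d_k d_l then yields only 3/2. The excess is removed because eight vectors in dimension 4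
  cannot be mutually orthogonal: Cauchy-Schwarz for the trace of their frame operator bounds the sum
  of their squared inner products from below, and these inner products lower the Gram determinants
  of the minors. A second obstacle is that \<Omega> is not assumed to be \<Omega>_1 \<and>
  \<Omega>_2: two unrelated unitary bases are in play, whose volume forms differ by a phase.
  Self-duality is additive and is shown for each summand in its own basis; the bound contains only
  the modulus of \<Omega>; in the square the phase enters only through its squared modulus.\<close>

lemma sum_lessThan_add: "sum f {..<m + n} = sum f {..<m} + (\<Sum>i<n. f (m + i))"
  for f :: "nat \<Rightarrow> 'a::comm_monoid_add"
  by (induction n) (auto simp: ac_simps)

lemma prod_lessThan_add: "prod f {..<m + n} = prod f {..<m} * (\<Prod>i<n. f (m + i))"
  for f :: "nat \<Rightarrow> 'a::comm_monoid_mult"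
  by (induction n) (auto simp: ac_simps)

text \<open>The deleted column of the Laplace expansion is written as an index shift, so that
  determinants of numeral size unfold by simplification alone.\<close>

lemma det_mat_Suc:
  fixes M :: "nat \<Rightarrow> nat \<Rightarrow> 'a::comm_ring_1"
  shows "det (mat (Suc n) (Suc n) (\<lambda>(i, j). M i j)) = (\<Sum>j<Suc n. M 0 j *
    ((- 1) ^ j * det (mat n n (\<lambda>(i, k). M (Suc i) (if k < j then k else Suc k)))))"
proof -
  have "mat_delete (mat (Suc n) (Suc n) (\<lambda>(i, j). M i j)) 0 j =
      mat n n (\<lambda>(i, k). M (Suc i) (if k < j then k else Suc k))" for j
    by (rule eq_matI) (auto simp: mat_delete_def)
  then show ?thesis
    by (subst laplace_expansion_row[where n = "Suc n" and i = 0])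
      (simp_all add: cofactor_def del: sum.lessThan_Suc)
qed

lemma det_mat_2:
  "det (mat 2 2 (\<lambda>(i, j). M i j)) = M 0 0 * M 1 1 - M 0 1 * M 1 (0 :: nat)"
  for M :: "nat \<Rightarrow> nat \<Rightarrow> 'a::comm_ring_1"
  by (simp add: numeral_2_eq_2 det_mat_Suc)

text \<open>Turns identities between wedge products of covectors into identities between
  determinants, where row operations and block matrices are available.\<close>

lemma wedge_covectors_det:
  "wedge_covectors f n x = det (mat n n (\<lambda>(i, j). f i (x j)))"
proof -
  have "det (mat n n (\<lambda>(i, j). f i (x j))) =
      (\<Sum>p | p permutes {0..<n}. of_int (sign p) * (\<Prod>i = 0..<n. f i (x (p i))))"
    unfolding det_def'[OF mat_carrier]
  proof (rule sum.cong[OF refl])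
    fix p assume "p \<in> {p. p permutes {0..<n}}"
    then have "p i < n" if "i < n" for i
      using that permutes_in_image[of p "{0..<n}" i] by auto
    then show "of_int (sign p) * (\<Prod>i = 0..<n. mat n n (\<lambda>(i, j). f i (x j)) $$ (i, p i)) =
        of_int (sign p) * (\<Prod>i = 0..<n. f i (x (p i)))" by simp
  qed
  then show ?thesis by (simp add: wedge_covectors_eq atLeast0LessThan)
qed

lemma wedge_covectors_cong:
  assumes "\<And>i j. i < n \<Longrightarrow> j < n \<Longrightarrow> f i (x j) = g i (y j)"
  shows "wedge_covectors f n x = wedge_covectors g n y"
  unfolding wedge_covectors_det using assms by (intro arg_cong[where f = det]) (auto intro: eq_matI)

text \<open>A pair of permutations of the two blocks is a permutation of all k + l indices, so it
  can be absorbed into \<sigma> by reindexing. All k! l! pairs then contribute the same sum, which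
  cancels the normalizing factor of the wedge product.\<close>

lemma wedge_wedge_covectors:
  fixes f g :: "nat \<Rightarrow> 'a \<Rightarrow> 'b::field_char_0"
  shows "wedge k l (wedge_covectors f k) (wedge_covectors g l) =
    wedge_covectors (\<lambda>i. if i < k then f i else g (i - k)) (k + l)"
proof
  fix x :: "nat \<Rightarrow> 'a"
  let ?P = "\<lambda>n. {\<sigma>. \<sigma> permutes {..<n::nat}}"
  let ?h = "\<lambda>i. if i < k then f i else g (i - k)"
  let ?F = "\<lambda>\<sigma>. of_int (sign \<sigma>) * (\<Prod>i<k + l. ?h i (x (\<sigma> i)))"
  let ?r = "map_permutation {..<l} (\<lambda>i. k + i)"
  have shift_permutes: "?r \<rho> permutes {k..<k + l}" if "\<rho> permutes {..<l}" for \<rho>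
  proof (rule map_permutation_permutes)
    show "bij_betw (\<lambda>i. k + i) {..<l} {k..<k + l}"
      by (rule bij_betw_byWitness[where f' = "\<lambda>i. i - k"]) auto
  qed (rule that)
  have step: "of_int (sign \<sigma>) * ((of_int (sign \<tau>) * (\<Prod>i<k. f i ((x \<circ> \<sigma>) (\<tau> i)))) *
       (of_int (sign \<rho>) * (\<Prod>i<l. g i ((x \<circ> \<sigma>) (k + \<rho> i))))) =
       ?F (\<sigma> \<circ> (\<tau> \<circ> ?r \<rho>))"
    if \<sigma>: "\<sigma> \<in> ?P (k + l)" and \<tau>: "\<tau> \<in> ?P k" and \<rho>: "\<rho> \<in> ?P l" for \<sigma> \<tau> \<rho>
  proof -
    have \<rho>': "?r \<rho> permutes {k..<k + l}" using shift_permutes \<rho> by simp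
    have app: "?r \<rho> (k + i) = k + \<rho> i" if "i < l" for i
      by (rule map_permutation_apply) (use that in auto)
    have fixl: "?r \<rho> i = i" if "i < k" for i
      using \<rho>' that by (auto simp: permutes_def)
    have fix\<tau>: "\<tau> i = i" if "i \<ge> k" for i
      using \<tau> that by (auto simp: permutes_def)
    have "sign (?r \<rho>) = sign \<rho>"
      by (rule sign_map_permutation) (use \<rho> in auto)
    moreover have "permutation \<sigma>" "permutation \<tau>" "permutation (?r \<rho>)"
      using \<sigma> \<tau> \<rho>' permutes_imp_permutation[OF finite_lessThan]
        permutes_imp_permutation[OF finite_atLeastLessThan] by blast+
    ultimately have s: "sign (\<sigma> \<circ> (\<tau> \<circ> ?r \<rho>)) = sign \<sigma> * (sign \<tau> * sign \<rho>)"
      by (simp add: sign_compose permutation_compose)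
    have "(\<Prod>i<k + l. ?h i (x ((\<sigma> \<circ> (\<tau> \<circ> ?r \<rho>)) i))) =
        (\<Prod>i<k. f i (x (\<sigma> (\<tau> i)))) * (\<Prod>i<l. g i (x (\<sigma> (k + \<rho> i))))"
      by (simp add: prod_lessThan_add fixl app fix\<tau>)
    then show ?thesis by (simp add: s mult_ac)
  qed
  have "wedge k l (wedge_covectors f k) (wedge_covectors g l) x =
      (\<Sum>\<sigma>\<in>?P (k + l). \<Sum>\<tau>\<in>?P k. \<Sum>\<rho>\<in>?P l. ?F (\<sigma> \<circ> (\<tau> \<circ> ?r \<rho>)))
      / (fact k * fact l)"
  proof -
    have "of_int (sign \<sigma>) * (wedge_covectors f k (x \<circ> \<sigma>) * wedge_covectors g l (\<lambda>i. (x \<circ> \<sigma>) (k + i))) =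
        (\<Sum>\<tau>\<in>?P k. \<Sum>\<rho>\<in>?P l. ?F (\<sigma> \<circ> (\<tau> \<circ> ?r \<rho>)))"
      if "\<sigma> \<in> ?P (k + l)" for \<sigma>
      unfolding wedge_covectors_eq
      unfolding sum_product
      unfolding sum_distrib_left
      using step[OF that] by (intro sum.cong refl) blast
    then have "(\<Sum>\<sigma>\<in>?P (k + l). of_int (sign \<sigma>) *
        (wedge_covectors f k (x \<circ> \<sigma>) * wedge_covectors g l (\<lambda>i. (x \<circ> \<sigma>) (k + i)))) =
      (\<Sum>\<sigma>\<in>?P (k + l). \<Sum>\<tau>\<in>?P k. \<Sum>\<rho>\<in>?P l. ?F (\<sigma> \<circ> (\<tau> \<circ> ?r \<rho>)))"
      by (rule sum.cong[OF refl])
    then show ?thesis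
      unfolding wedge_def Alt_def tensor_def
      using fact_nonzero[of "k + l", where 'a='b] by (simp del: fact_Suc o_apply)
  qed
  also have "(\<Sum>\<sigma>\<in>?P (k + l). \<Sum>\<tau>\<in>?P k. \<Sum>\<rho>\<in>?P l. ?F (\<sigma> \<circ> (\<tau> \<circ> ?r \<rho>)))
      = (\<Sum>\<tau>\<in>?P k. \<Sum>\<sigma>\<in>?P (k + l). \<Sum>\<rho>\<in>?P l. ?F (\<sigma> \<circ> (\<tau> \<circ> ?r \<rho>)))"
    by (rule sum.swap)
  also have "\<dots> = (\<Sum>\<tau>\<in>?P k. \<Sum>\<rho>\<in>?P l. \<Sum>\<sigma>\<in>?P (k + l). ?F (\<sigma> \<circ> (\<tau> \<circ> ?r \<rho>)))"
    by (intro sum.cong refl sum.swap)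
  also have "\<dots> = (\<Sum>\<tau>\<in>?P k. \<Sum>\<rho>\<in>?P l. \<Sum>\<sigma>\<in>?P (k + l). ?F \<sigma>)"
  proof (rule sum.cong[OF refl], rule sum.cong[OF refl])
    fix \<tau> \<rho> assume \<tau>: "\<tau> \<in> ?P k" and \<rho>: "\<rho> \<in> ?P l"
    have "?r \<rho> permutes {k..<k + l}" using shift_permutes \<rho> by simp
    then have "?r \<rho> permutes {..<k + l}"
      by (rule permutes_subset) auto
    moreover have "\<tau> permutes {..<k + l}"
      using \<tau> by (auto intro: permutes_subset)
    ultimately have "\<tau> \<circ> ?r \<rho> permutes {..<k + l}"
      by (intro permutes_compose)
    from sum_permutations_compose_right[OF this, of ?F]
    show "(\<Sum>\<sigma>\<in>?P (k + l). ?F (\<sigma> \<circ> (\<tau> \<circ> ?r \<rho>))) = (\<Sum>\<sigma>\<in>?P (k + l). ?F \<sigma>)"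
      by simp
  qed
  also have "\<dots> = fact k * (fact l * wedge_covectors ?h (k + l) x)"
    by (simp add: card_permutations[OF refl] wedge_covectors_eq)
  finally show "wedge k l (wedge_covectors f k) (wedge_covectors g l) x = wedge_covectors ?h (k + l) x"
    by simp
qed

text \<open>Lists make the wedge product a concatenation, carry the degree as their length, and let
  reorderings be tracked up to sign by the multiset of rows.\<close>

definition wedge_list :: "('a \<Rightarrow> 'b::field_char_0) list \<Rightarrow> ('a, 'b) form" where
  "wedge_list fs = wedge_covectors (\<lambda>i. fs ! i) (length fs)"

lemma wedge_covectors_eq_list: "wedge_covectors f n = wedge_list (map f [0..<n])"
  unfolding wedge_list_def by (auto intro!: ext wedge_covectors_cong)

lemma wedge_wedge_list:
  assumes "k = length fs" "l = length gs"
  shows "wedge k l (wedge_list fs) (wedge_list gs) = wedge_list (fs @ gs)"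
  unfolding wedge_list_def assms wedge_wedge_covectors
  by (auto intro!: ext wedge_covectors_cong simp: nth_append)

lemma wedge_list_cong:
  assumes "length fs = length gs"
    "\<And>i j. i < length fs \<Longrightarrow> j < length fs \<Longrightarrow> (fs ! i) (x j) = (gs ! i) (y j)"
  shows "wedge_list fs x = wedge_list gs y"
  unfolding wedge_list_def assms(1)[symmetric] using assms(2) by (rule wedge_covectors_cong)

lemma wedge_list_swap: "wedge_list (fs @ f # g # gs) x = - wedge_list (fs @ g # f # gs) x"
proof -
  let ?m = "length fs" and ?n = "length (fs @ f # g # gs)"
  let ?M = "\<lambda>hs. mat ?n ?n (\<lambda>(i, j). (hs ! i) (x j))"
  let ?p = "Transposition.transpose ?m (Suc ?m)"
  have "?p permutes {0..<?n}" by (rule permutes_swap_id) auto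
  from det_permute_rows[OF mat_carrier this, of "\<lambda>(i, j). ((fs @ f # g # gs) ! i) (x j)"]
  have "det (mat ?n ?n (\<lambda>(i, j). ?M (fs @ f # g # gs) $$ (?p i, j))) = - det (?M (fs @ f # g # gs))"
    by (simp add: sign_swap_id)
  moreover have "mat ?n ?n (\<lambda>(i, j). ?M (fs @ f # g # gs) $$ (?p i, j)) = ?M (fs @ g # f # gs)"
    by (rule eq_matI) (auto simp: Transposition.transpose_def nth_append nth_Cons split: nat.split)
  ultimately show ?thesis unfolding wedge_list_def wedge_covectors_det by simp
qed

lemma wedge_list_swap_block:
  "wedge_list (as @ fs @ g # gs) x = (- 1) ^ length fs * wedge_list (as @ g # fs @ gs) x"
proof (induction fs arbitrary: as)
  case (Cons f fs)
  have "wedge_list (as @ (f # fs) @ g # gs) x = wedge_list ((as @ [f]) @ fs @ g # gs) x" by simp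
  also have "\<dots> = (- 1) ^ length fs * wedge_list (as @ f # g # fs @ gs) x"
    using Cons.IH[of "as @ [f]"] by simp
  finally show ?case by (simp add: wedge_list_swap[of as f g])
qed simp

text \<open>Moving one row to the front costs a sign. The sign is left open, since the lemma serves
  only to show that forms vanish or to compare moduli.\<close>

lemma wedge_list_mset:
  assumes "mset fs = mset gs"
  shows "wedge_list fs x = wedge_list gs x \<or> wedge_list fs x = - wedge_list gs x"
proof -
  have "wedge_list (as @ fs) x = wedge_list (as @ gs) x \<or> wedge_list (as @ fs) x = - wedge_list (as @ gs) x"
    for as using assms
  proof (induction fs arbitrary: as gs)
    case (Cons f fs)
    from Cons.prems have "f \<in> set gs" by (metis list.set_intros(1) set_mset_mset)
    then obtain us vs where gs: "gs = us @ f # vs" by (meson split_list)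
    then have "mset fs = mset (us @ vs)" using Cons.prems by simp
    from Cons.IH[OF this, of "as @ [f]"] wedge_list_swap_block[of as us f vs x]
      minus_one_power_iff[of "length us", where 'a='b]
    show ?case by (auto simp: gs split: if_splits)
  qed simp
  from this[of "[]"] show ?thesis by simp
qed

text \<open>The matrix of the rows factors through a block triangular matrix with diagonal blocks C
  and 1, so contributions D of rows already present in gs are invisible. The expansion is required
  only at the vectors x j on which the form is evaluated, which admits expansions that hold nowhere
  else.\<close>

lemma wedge_list_change:
  fixes fs gs hs :: "('a \<Rightarrow> 'b::field_char_0) list"
  assumes l: "length fs = m" "length hs = m" "length gs = n"
    and e: "\<And>i j. i < m \<Longrightarrow> j < m + n \<Longrightarrow> (fs ! i) (x j) =
       (\<Sum>b<m. C i b * (hs ! b) (x j)) + (\<Sum>b<n. D i b * (gs ! b) (x j))"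
  shows "wedge_list (fs @ gs) x = det (mat m m (\<lambda>(i, j). C i j)) * wedge_list (hs @ gs) x"
proof -
  let ?C = "mat m m (\<lambda>(i, j). C i j)" and ?D = "mat m n (\<lambda>(i, j). D i j)"
  let ?B = "four_block_mat ?C ?D (0\<^sub>m n m) (1\<^sub>m n)"
  let ?M = "\<lambda>hs. mat (m + n) (m + n) (\<lambda>(i, j). (hs ! i) (x j))"
  have "?M (fs @ gs) = ?B * ?M (hs @ gs)"
  proof (rule eq_matI)
    fix i j assume "i < dim_row (?B * ?M (hs @ gs))" "j < dim_col (?B * ?M (hs @ gs))"
    then have i: "i < m + n" and j: "j < m + n" by auto
    have "(?B * ?M (hs @ gs)) $$ (i, j) = (\<Sum>k = 0..<m + n. ?B $$ (i, k) * ((hs @ gs) ! k) (x j))"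
      using i j by (simp add: scalar_prod_def)
    also have "\<dots> = (\<Sum>k<m. ?B $$ (i, k) * (hs ! k) (x j)) + (\<Sum>k<n. ?B $$ (i, m + k) * (gs ! k) (x j))"
      using l by (simp add: atLeast0LessThan sum_lessThan_add nth_append)
    also have "\<dots> = ((fs @ gs) ! i) (x j)"
    proof (cases "i < m")
      case True
      then show ?thesis using e[OF True j] l by (simp add: nth_append)
    next
      case False
      have "(\<Sum>k<n. ?B $$ (i, m + k) * (gs ! k) (x j)) = (\<Sum>k<n. if k = i - m then (gs ! k) (x j) else 0)"
        using i False by (intro sum.cong) (auto simp: one_mat_def)
      then show ?thesis using False i l by (simp add: nth_append)
    qed
    finally show "?M (fs @ gs) $$ (i, j) = (?B * ?M (hs @ gs)) $$ (i, j)" using i j by simp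
  qed auto
  then have "det (?M (fs @ gs)) = det ?B * det (?M (hs @ gs))"
    using det_mult[of ?B "m + n" "?M (hs @ gs)"] by (simp add: four_block_carrier_mat)
  also have "det ?B = det ?C"
    by (subst det_four_block_mat_lower_left_zero[of _ m _ n]) auto
  finally show ?thesis using l by (simp add: wedge_list_def wedge_covectors_det)
qed

text \<open>Once moved to the front, f lies in the span of the other rows, so
  \<open>wedge_list_change\<close> applies with the zero 1 by 1 coefficient matrix. The intended
  case is dz, dx, dy of one coordinate.\<close>

lemma wedge_list_dependent:
  assumes "{#f, g, h#} \<subseteq># mset fs" "\<And>v. f v = c * g v + d * h v"
  shows "wedge_list fs x = 0"
proof -
  from assms(1) obtain M where "mset fs = {#f, g, h#} + M" by (metis mset_subset_eq_exists_conv)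
  moreover obtain gs where "M = mset gs" by (metis ex_mset)
  ultimately have m: "mset fs = mset ([f] @ g # h # gs)" by simp
  have "wedge_list ([f] @ g # h # gs) x = det (mat 1 1 (\<lambda>(i, j). 0)) * wedge_list ([f] @ g # h # gs) x"
  proof (rule wedge_list_change[where n = "Suc (Suc (length gs))" and D = "\<lambda>i b. if b = 0 then c else if b = 1 then d else 0"])
    show "([f] ! i) (x j) = (\<Sum>b<1. 0 * ([f] ! b) (x j)) + (\<Sum>b<Suc (Suc (length gs)).
        (if b = 0 then c else if b = 1 then d else 0) * ((g # h # gs) ! b) (x j))" if "i < 1" for i j
      using that by (simp add: sum.lessThan_Suc_shift assms(2) del: sum.lessThan_Suc)
  qed auto
  also have "det (mat 1 1 (\<lambda>(i, j). 0)) = (0 :: 'b)" by (subst det_single) auto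
  finally have "wedge_list ([f] @ g # h # gs) x = 0" by simp
  then show ?thesis using wedge_list_mset[OF m, of x] by auto
qed

lemma wedge_list_repeated:
  assumes "{#f, f#} \<subseteq># mset fs"
  shows "wedge_list fs x = 0"
proof -
  from assms obtain M where "mset fs = {#f, f#} + M" by (metis mset_subset_eq_exists_conv)
  moreover obtain gs where "M = mset gs" by (metis ex_mset)
  ultimately have m: "mset fs = mset ([] @ f # f # gs)" by simp
  have "wedge_list ([] @ f # f # gs) x = 0" using wedge_list_swap[of "[]" f f gs x] by simp
  then show ?thesis using wedge_list_mset[OF m, of x] by auto
qed

lemma wedge_sum_left:
  fixes \<alpha> :: "'i \<Rightarrow> ('a, 'b::field_char_0) form"
  shows "wedge k l (\<lambda>x. \<Sum>i\<in>I. a i * \<alpha> i x) \<beta> = (\<lambda>x. \<Sum>i\<in>I. a i * wedge k l (\<alpha> i) \<beta> x)"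
  unfolding wedge_def Alt_def tensor_def sum_distrib_left sum_distrib_right
  by (rule ext, subst sum.swap) (simp add: mult_ac)

lemma wedge_sum_right:
  fixes \<beta> :: "'i \<Rightarrow> ('a, 'b::field_char_0) form"
  shows "wedge k l \<alpha> (\<lambda>x. \<Sum>i\<in>I. b i * \<beta> i x) = (\<lambda>x. \<Sum>i\<in>I. b i * wedge k l \<alpha> (\<beta> i) x)"
  unfolding wedge_def Alt_def tensor_def sum_distrib_left sum_distrib_right
  by (rule ext, subst sum.swap) (simp add: mult_ac)

section \<open>Pairs of covectors and powers of sums of 2-forms\<close>

definition pair_rows :: "(nat \<Rightarrow> 'v) \<Rightarrow> (nat \<Rightarrow> 'v) \<Rightarrow> nat list \<Rightarrow> 'v list" where
  "pair_rows f g js = concat (map (\<lambda>j. [f j, g j]) js)"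

lemma pair_rows_simps [simp]:
  "pair_rows f g [] = []" "pair_rows f g (j # js) = f j # g j # pair_rows f g js"
  "pair_rows f g (js @ ks) = pair_rows f g js @ pair_rows f g ks"
  by (simp_all add: pair_rows_def)

lemma length_pair_rows [simp]: "length (pair_rows f g js) = 2 * length js"
  by (induction js) auto

lemma mset_pair_rows: "mset (pair_rows f g js) = image_mset f (mset js) + image_mset g (mset js)"
  by (induction js) auto

text \<open>Both f and g pass all of bs, so the two signs cancel: 2-forms commute with
  everything.\<close>

lemma wedge_list_pair_front:
  "wedge_list (as @ bs @ f # g # cs) x = wedge_list (as @ f # g # bs @ cs) x"
proof -
  have "wedge_list (as @ bs @ f # g # cs) x = (- 1) ^ length bs * wedge_list ((as @ [f]) @ bs @ g # cs) x"
    by (simp add: wedge_list_swap_block)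
  also have "\<dots> = (- 1) ^ length bs * ((- 1) ^ length bs * wedge_list ((as @ [f]) @ g # bs @ cs) x)"
    unfolding wedge_list_swap_block[of "as @ [f]"] ..
  finally show ?thesis by (simp flip: power_add mult.assoc)
qed

lemma wedge_list_pair_rows_mset:
  assumes "mset js = mset ks"
  shows "wedge_list (as @ pair_rows f g js @ cs) x = wedge_list (as @ pair_rows f g ks @ cs) x"
  using assms
proof (induction js arbitrary: as ks)
  case (Cons j js)
  from Cons.prems have "j \<in> set ks" by (metis list.set_intros(1) set_mset_mset)
  then obtain us vs where ks: "ks = us @ j # vs" by (meson split_list)
  then have "mset js = mset (us @ vs)" using Cons.prems by simp
  from Cons.IH[OF this, of "as @ [f j, g j]"] show ?case
    by (simp add: ks wedge_list_pair_front)
qed simp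

lemma wedge_list_pair_rows_front:
  "wedge_list (as @ bs @ pair_rows f g js @ cs) x = wedge_list (as @ pair_rows f g js @ bs @ cs) x"
proof (induction js arbitrary: as)
  case (Cons j js)
  show ?case using Cons.IH[of "as @ [f j, g j]"] by (simp add: wedge_list_pair_front)
qed simp

text \<open>Each g j passes the rows f of all later indices; these numbers of transpositions add up
  to the binomial coefficient.\<close>

lemma wedge_list_interleave:
  "wedge_list (as @ map f js @ map g js @ cs) x =
    (- 1) ^ (length js choose 2) * wedge_list (as @ pair_rows f g js @ cs) x"
proof (induction js arbitrary: as)
  case (Cons j js)
  have "wedge_list (as @ map f (j # js) @ map g (j # js) @ cs) x =
      (- 1) ^ length js * wedge_list ((as @ [f j, g j]) @ map f js @ map g js @ cs) x"
    using wedge_list_swap_block[of "as @ [f j]" "map f js" "g j" "map g js @ cs" x] by simp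
  also have "\<dots> = (- 1) ^ (length js + (length js choose 2)) *
      wedge_list (as @ pair_rows f g (j # js) @ cs) x"
    using Cons.IH[of "as @ [f j, g j]"] by (simp add: power_add)
  also have "length js + (length js choose 2) = length (j # js) choose 2"
    by (simp add: numeral_2_eq_2)
  finally show ?case .
qed (simp add: numeral_2_eq_2)

lemma wedge_list_pair_change:
  assumes "\<And>v. f v = a * h v + b * k v" "\<And>v. g v = c * h v + d * k v"
  shows "wedge_list (as @ f # g # cs) x = (a * d - b * c) * wedge_list (as @ h # k # cs) x"
proof -
  have *: "wedge_list (as @ f # g # cs) x = wedge_list ([f, g] @ as @ cs) x" for f g :: "'a \<Rightarrow> 'b"
    using wedge_list_pair_front[of "[]" as f g cs x] by simp
  have "wedge_list ([f, g] @ as @ cs) x = det (mat 2 2 (\<lambda>(i, j).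
      if i = 0 then if j = 0 then a else b else if j = 0 then c else d)) *
      wedge_list ([h, k] @ as @ cs) x"
    by (rule wedge_list_change[where D = "\<lambda>_ _. 0"])
      (auto simp: assms numeral_2_eq_2 less_Suc_eq)
  then show ?thesis unfolding * by (simp add: det_mat_2)
qed

lemma wedge_list_pair_rows_change:
  assumes "\<And>j v. j \<in> set js \<Longrightarrow> f j v = a * h j v + b * k j v"
    "\<And>j v. j \<in> set js \<Longrightarrow> g j v = c * h j v + d * k j v"
  shows "wedge_list (as @ pair_rows f g js @ cs) x =
    (a * d - b * c) ^ length js * wedge_list (as @ pair_rows h k js @ cs) x"
  using assms
proof (induction js arbitrary: as)
  case (Cons j js)
  have "wedge_list (as @ pair_rows f g (j # js) @ cs) x =
      (a * d - b * c) ^ length js * wedge_list (as @ f j # g j # pair_rows h k js @ cs) x"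
    using Cons.IH[of "as @ [f j, g j]"] Cons.prems by simp
  also have "wedge_list (as @ f j # g j # pair_rows h k js @ cs) x =
      (a * d - b * c) * wedge_list (as @ h j # k j # pair_rows h k js @ cs) x"
    by (rule wedge_list_pair_change) (use Cons.prems in auto)
  finally show ?case by simp
qed simp

lemma wedge_list_pair_rows_set:
  assumes "distinct js" "set js = S"
  shows "wedge_list (as @ pair_rows f g (sorted_list_of_set S) @ cs) x = wedge_list (as @ pair_rows f g js @ cs) x"
proof -
  have "mset (sorted_list_of_set S) = mset js"
    using assms by (metis List.finite_set distinct_sorted_list_of_set set_eq_iff_mset_eq_distinct set_sorted_list_of_set)
  then show ?thesis by (rule wedge_list_pair_rows_mset)
qed

text \<open>A multinomial theorem for commuting 2-forms of square zero: repeated indices drop out,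
  and every set of m indices arises from m! orders.\<close>

lemma wedge_power_pairs:
  fixes f g :: "nat \<Rightarrow> 'a \<Rightarrow> 'b::field_char_0"
  assumes \<omega>: "\<omega> = (\<lambda>x. \<Sum>j\<in>J. c j * wedge_list [f j, g j] x)" and fin: "finite J"
  shows "wedge_power 2 \<omega> m = (\<lambda>x. fact m *
    (\<Sum>S | S \<subseteq> J \<and> card S = m. prod c S * wedge_list (pair_rows f g (sorted_list_of_set S)) x))"
proof (induction m)
  case 0
  have "{S. S \<subseteq> J \<and> card S = 0} = {{}}"
    using fin by (auto dest: finite_subset)
  then show ?case by (simp add: wedge_list_def)
next
  case (Suc m)
  let ?F = "\<lambda>m. {S. S \<subseteq> J \<and> card S = m}"
  let ?W = "\<lambda>S. wedge_list (pair_rows f g (sorted_list_of_set S))"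
  have finS: "finite S" if "S \<in> ?F k" for S k using that fin by (auto intro: finite_subset)
  have finF: "finite (?F k)" for k
    using fin by (auto intro: finite_subset[of _ "Pow J"])
  have step: "prod c S * (c j * wedge_list (pair_rows f g (sorted_list_of_set S) @ [f j, g j]) x) =
     (if j \<in> S then 0 else prod c (insert j S) * ?W (insert j S) x)" if S: "S \<in> ?F m" for S j x
  proof (cases "j \<in> S")
    case True
    have "{#f j, f j#} \<subseteq># mset (pair_rows f g (sorted_list_of_set S) @ [f j, g j])"
    proof -
      have "f j \<in># image_mset f (mset (sorted_list_of_set S))"
        using True finS[OF S] by auto
      then have "{#f j#} \<subseteq># image_mset f (mset (sorted_list_of_set S))" by simp
      then have "{#f j#} + {#f j#} \<subseteq># image_mset f (mset (sorted_list_of_set S)) +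
         (image_mset g (mset (sorted_list_of_set S)) + {#f j, g j#})"
        by (intro subset_mset.add_mono) auto
      then show ?thesis by (simp add: mset_pair_rows ac_simps)
    qed
    from wedge_list_repeated[OF this] show ?thesis using True by simp
  next
    case False
    have "?W (insert j S) x = wedge_list (pair_rows f g (sorted_list_of_set S) @ [f j, g j]) x"
      using wedge_list_pair_rows_set[of "sorted_list_of_set S @ [j]" "insert j S" "[]" f g "[]" x]
        False finS[OF S] by simp
    then show ?thesis using False finS[OF S] by simp
  qed
  have "wedge_power 2 \<omega> (Suc m) = wedge (2 * m) 2
      (\<lambda>x. \<Sum>S\<in>?F m. (fact m * prod c S) * ?W S x) (\<lambda>x. \<Sum>j\<in>J. c j * wedge_list [f j, g j] x)"
    unfolding wedge_power.simps Suc.IH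
    by (rule arg_cong2[where f = "wedge (2 * m) 2"]) (simp_all add: \<omega> sum_distrib_left mult.assoc)
  also have "\<dots> = (\<lambda>x. \<Sum>S\<in>?F m. \<Sum>j\<in>J. fact m * prod c S *
      (c j * wedge_list (pair_rows f g (sorted_list_of_set S) @ [f j, g j]) x))"
    unfolding wedge_sum_left unfolding wedge_sum_right sum_distrib_left
    by (intro ext sum.cong refl) (subst wedge_wedge_list, auto dest: finS)
  also have "\<dots> = (\<lambda>x. \<Sum>S\<in>?F m. \<Sum>j\<in>J - S. fact m * (prod c (insert j S) * ?W (insert j S) x))"
  proof (rule ext, rule sum.cong[OF refl])
    fix x S assume S: "S \<in> ?F m"
    have "(\<Sum>j\<in>J. fact m * prod c S * (c j * wedge_list (pair_rows f g (sorted_list_of_set S) @ [f j, g j]) x))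
        = (\<Sum>j\<in>J. if j \<in> S then 0 else fact m * (prod c (insert j S) * ?W (insert j S) x))"
      using step[OF S] by (intro sum.cong refl) (simp add: mult.assoc)
    also have "\<dots> = (\<Sum>j\<in>J - S. fact m * (prod c (insert j S) * ?W (insert j S) x))"
      by (rule sum.mono_neutral_cong_right) (use fin in auto)
    finally show "(\<Sum>j\<in>J. fact m * prod c S * (c j * wedge_list (pair_rows f g (sorted_list_of_set S) @ [f j, g j]) x))
        = (\<Sum>j\<in>J - S. fact m * (prod c (insert j S) * ?W (insert j S) x))" .
  qed
  also have "\<dots> = (\<lambda>x. \<Sum>S\<in>?F (Suc m). \<Sum>j\<in>S. fact m * (prod c S * ?W S x))"
  proof
    fix x
    have "(\<Sum>S\<in>?F m. \<Sum>j\<in>J - S. fact m * (prod c (insert j S) * ?W (insert j S) x)) =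
      (\<Sum>(S, j)\<in>Sigma (?F m) (\<lambda>S. J - S). fact m * (prod c (insert j S) * ?W (insert j S) x))"
      by (rule sum.Sigma[OF finF]) (simp add: fin)
    \<comment> \<open>A set of m + 1 indices arises once for each choice of its last element j. The
      inner sum, now constant in j, will supply the factor m + 1.\<close>
    also have "\<dots> = (\<Sum>(S, j)\<in>Sigma (?F (Suc m)) (\<lambda>S. S). fact m * (prod c S * ?W S x))"
    proof (rule sum.reindex_bij_witness[where i = "\<lambda>(S, j). (S - {j}, j)" and j = "\<lambda>(S, j). (insert j S, j)"])
      fix a assume "a \<in> Sigma (?F m) (\<lambda>S. J - S)"
      then obtain S j where a: "a = (S, j)" "S \<subseteq> J" "card S = m" "j \<in> J" "j \<notin> S" by blast
      have "finite S" using a(2) fin by (rule finite_subset)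
      then show "(case case a of (S, j) \<Rightarrow> (insert j S, j) of (S, j) \<Rightarrow> (S - {j}, j)) = a"
        "(case a of (S, j) \<Rightarrow> (insert j S, j)) \<in> Sigma (?F (Suc m)) (\<lambda>S. S)"
        "(case case a of (S, j) \<Rightarrow> (insert j S, j) of (S, j) \<Rightarrow> fact m * (prod c S * ?W S x)) =
          (case a of (S, j) \<Rightarrow> fact m * (prod c (insert j S) * ?W (insert j S) x))"
        using a by simp_all
    next
      fix b assume "b \<in> Sigma (?F (Suc m)) (\<lambda>S. S)"
      then obtain S j where b: "b = (S, j)" "S \<subseteq> J" "card S = Suc m" "j \<in> S" by blast
      have "finite S" using b(2) fin by (rule finite_subset)
      then show "(case case b of (S, j) \<Rightarrow> (S - {j}, j) of (S, j) \<Rightarrow> (insert j S, j)) = b"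
        "(case b of (S, j) \<Rightarrow> (S - {j}, j)) \<in> Sigma (?F m) (\<lambda>S. J - S)"
        using b by (auto simp: insert_absorb)
    qed
    also have "\<dots> = (\<Sum>S\<in>?F (Suc m). \<Sum>j\<in>S. fact m * (prod c S * ?W S x))"
      by (rule sum.Sigma[OF finF, symmetric]) (intro ballI finS)
    finally show "(\<Sum>S\<in>?F m. \<Sum>j\<in>J - S. fact m * (prod c (insert j S) * ?W (insert j S) x)) =
      (\<Sum>S\<in>?F (Suc m). \<Sum>j\<in>S. fact m * (prod c S * ?W S x))" .
  qed
  also have "\<dots> = (\<lambda>x. fact (Suc m) * (\<Sum>S\<in>?F (Suc m). prod c S * ?W S x))"
    by (rule ext, subst sum_distrib_left, rule sum.cong) (auto simp: mult.assoc)
  finally show ?case .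
qed

section \<open>Alternating forms\<close>

lemma alt_formsD:
  assumes "\<alpha> \<in> alt_forms m"
  shows "(\<And>i. i < m \<Longrightarrow> x i = y i) \<Longrightarrow> \<alpha> x = \<alpha> y"
    and "i < m \<Longrightarrow> linear (\<lambda>v. \<alpha> (x(i := v)))"
    and "i < m \<Longrightarrow> j < m \<Longrightarrow> i \<noteq> j \<Longrightarrow> x i = x j \<Longrightarrow> \<alpha> x = 0"
  using assms unfolding alt_forms_def by blast+

lemma alt_forms_zero: "(\<lambda>x. 0) \<in> alt_forms m"
  by (simp add: alt_forms_def linear_iff)

lemma alt_forms_add:
  assumes "\<alpha> \<in> alt_forms m" "\<beta> \<in> alt_forms m"
  shows "(\<lambda>x. \<alpha> x + \<beta> x) \<in> alt_forms m"
  unfolding alt_forms_def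
proof (intro CollectI conjI allI impI)
  show "\<alpha> x + \<beta> x = \<alpha> y + \<beta> y" if "\<forall>i<m. x i = y i" for x y
    using alt_formsD(1)[OF assms(1), of x y] alt_formsD(1)[OF assms(2), of x y] that by simp
  show "linear (\<lambda>v. \<alpha> (x(i := v)) + \<beta> (x(i := v)))" if "i < m" for i x
    by (rule linear_compose_add[OF alt_formsD(2)[OF assms(1) that] alt_formsD(2)[OF assms(2) that]])
  show "\<alpha> x + \<beta> x = 0" if "i < m" "j < m" "i \<noteq> j \<and> x i = x j" for x i j
    using alt_formsD(3)[OF assms(1), of i j x] alt_formsD(3)[OF assms(2), of i j x] that by simp
qed

lemma alt_forms_linear:
  assumes "linear f" "\<alpha> \<in> alt_forms m"
  shows "(\<lambda>x. f (\<alpha> x)) \<in> alt_forms m"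
  unfolding alt_forms_def
proof (intro CollectI conjI allI impI)
  show "f (\<alpha> x) = f (\<alpha> y)" if "\<forall>i<m. x i = y i" for x y
    using alt_formsD(1)[OF assms(2), of x y] that by simp
  show "linear (\<lambda>v. f (\<alpha> (x(i := v))))" if "i < m" for i x
    using linear_compose[OF alt_formsD(2)[OF assms(2) that] assms(1)] by (simp add: o_def)
  show "f (\<alpha> x) = 0" if "i < m" "j < m" "i \<noteq> j \<and> x i = x j" for x i j
    using alt_formsD(3)[OF assms(2), of i j x] that linear_0[OF assms(1)] by simp
qed

lemma alt_forms_sum: "(\<And>i. i \<in> I \<Longrightarrow> \<alpha> i \<in> alt_forms m) \<Longrightarrow> (\<lambda>x. \<Sum>i\<in>I. \<alpha> i x) \<in> alt_forms m"
  by (induction I rule: infinite_finite_induct) (simp_all add: alt_forms_zero alt_forms_add)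

lemma alt_forms_mult:
  "\<alpha> \<in> alt_forms m \<Longrightarrow> (\<lambda>x. c * \<alpha> x) \<in> alt_forms m" for c :: "'b::real_algebra"
  by (rule alt_forms_linear[of "\<lambda>y. c * y"]) (simp_all add: linear_iff algebra_simps)

lemma wedge_covectors_alt_forms:
  fixes Z :: "nat \<Rightarrow> 'a::real_vector \<Rightarrow> 'b::{field_char_0, real_algebra_1}"
  assumes lin: "\<And>i. i < n \<Longrightarrow> linear (Z i)"
  shows "wedge_covectors Z n \<in> alt_forms n"
  unfolding alt_forms_def
proof (intro CollectI conjI allI impI)
  show "wedge_covectors Z n x = wedge_covectors Z n y" if "\<forall>i<n. x i = y i" for x y
    using that by (auto intro: wedge_covectors_cong)
next
  fix i and x :: "nat \<Rightarrow> 'a" assume i: "i < n"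
  have "linear (\<lambda>v. of_int (sign \<sigma>) * (\<Prod>k<n. Z k ((x(i := v)) (\<sigma> k))))"
    if \<sigma>: "\<sigma> permutes {..<n}" for \<sigma>
  proof -
    let ?k = "Hilbert_Choice.inv \<sigma> i"
    have k: "?k < n" "\<sigma> ?k = i"
      using i \<sigma> permutes_in_image[OF permutes_inv[OF \<sigma>], of i] by (auto simp: permutes_inverses)
    have "(\<Prod>k<n. Z k ((x(i := v)) (\<sigma> k))) = Z ?k v * (\<Prod>k\<in>{..<n} - {?k}. Z k (x (\<sigma> k)))" for v
    proof -
      have "\<sigma> k \<noteq> i" if "k \<noteq> ?k" for k using that \<sigma> by (metis permutes_inverses(2))
      then show ?thesis
        using k by (subst prod.remove[of _ ?k]) (auto intro!: prod.cong)
    qed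
    moreover have "linear (\<lambda>v. of_int (sign \<sigma>) * (Z ?k v * c))" for c
      using lin[OF k(1)] by (simp add: linear_iff algebra_simps)
    ultimately show ?thesis by simp
  qed
  then show "linear (\<lambda>v. wedge_covectors Z n (x(i := v)))"
    unfolding wedge_covectors_eq by (intro linear_compose_sum) auto
next
  fix i j and x :: "nat \<Rightarrow> 'a" assume ij: "i < n" "j < n" "i \<noteq> j \<and> x i = x j"
  show "wedge_covectors Z n x = 0"
    unfolding wedge_covectors_det
    by (rule det_identical_columns[of _ n i j]) (use ij in \<open>auto intro!: eq_vecI\<close>)
qed

lemma wedge_list_alt_forms:
  fixes fs :: "('a::real_vector \<Rightarrow> 'b::{field_char_0, real_algebra_1}) list"
  assumes "\<And>f. f \<in> set fs \<Longrightarrow> linear f" "length fs = n"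
  shows "wedge_list fs \<in> alt_forms n"
  unfolding wedge_list_def assms(2) by (rule wedge_covectors_alt_forms) (use assms in auto)

lemma alt_forms_expand:
  assumes \<alpha>: "\<alpha> \<in> alt_forms m" and J: "finite J"
    and x: "\<And>i. i < m \<Longrightarrow> x i = (\<Sum>j\<in>J. T i j *\<^sub>R y j)"
  shows "\<alpha> x = (\<Sum>f\<in>{..<m} \<rightarrow>\<^sub>E J. (\<Prod>i<m. T i (f i)) *\<^sub>R \<alpha> (\<lambda>i. y (f i)))"
proof -
  have "\<alpha> x = (\<Sum>f\<in>{..<k} \<rightarrow>\<^sub>E J. (\<Prod>i<k. T i (f i)) *\<^sub>R \<alpha> (\<lambda>i. if i < k then y (f i) else x i))"
    if "k \<le> m" for k
    using that
  proof (induction k)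
    case (Suc k)
    then have k: "k < m" by simp
    let ?z = "\<lambda>f i. if i < k then y (f i) else x i"
    have step: "\<alpha> (?z f) = (\<Sum>j\<in>J. T k j *\<^sub>R \<alpha> (\<lambda>i. if i < Suc k then y ((f(k := j)) i) else x i))" for f
    proof -
      have lin: "linear (\<lambda>v. \<alpha> ((?z f)(k := v)))" by (rule alt_formsD(2)[OF \<alpha> k])
      have "?z f = (?z f)(k := \<Sum>j\<in>J. T k j *\<^sub>R y j)" using x[OF k] by (auto simp: fun_eq_iff)
      then have "\<alpha> (?z f) = \<alpha> ((?z f)(k := \<Sum>j\<in>J. T k j *\<^sub>R y j))" by (rule arg_cong)
      also have "\<dots> = (\<Sum>j\<in>J. T k j *\<^sub>R \<alpha> ((?z f)(k := y j)))"
        using linear_sum[OF lin, of "\<lambda>j. T k j *\<^sub>R y j" J] linear_cmul[OF lin] by simp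
      moreover have "(?z f)(k := y j) = (\<lambda>i. if i < Suc k then y ((f(k := j)) i) else x i)" for j
        by (auto simp: fun_eq_iff)
      ultimately show ?thesis by simp
    qed
    have "\<alpha> x = (\<Sum>f\<in>{..<k} \<rightarrow>\<^sub>E J. (\<Prod>i<k. T i (f i)) *\<^sub>R \<alpha> (?z f))"
      using Suc by simp
    also have "\<dots> = (\<Sum>f\<in>{..<k} \<rightarrow>\<^sub>E J. \<Sum>j\<in>J. ((\<Prod>i<k. T i (f i)) * T k j) *\<^sub>R
        \<alpha> (\<lambda>i. if i < Suc k then y ((f(k := j)) i) else x i))"
      by (subst step) (simp add: scaleR_sum_right)
    also have "\<dots> = (\<Sum>(f, j)\<in>({..<k} \<rightarrow>\<^sub>E J) \<times> J. ((\<Prod>i<k. T i (f i)) * T k j) *\<^sub>R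
        \<alpha> (\<lambda>i. if i < Suc k then y ((f(k := j)) i) else x i))"
      by (rule sum.cartesian_product)
    also have "\<dots> = (\<Sum>f\<in>{..<Suc k} \<rightarrow>\<^sub>E J. (\<Prod>i<Suc k. T i (f i)) *\<^sub>R
        \<alpha> (\<lambda>i. if i < Suc k then y (f i) else x i))"
    \<comment> \<open>Members of \<open>{..<k} \<rightarrow>\<^sub>E J\<close> are
      \<open>undefined\<close> from k on, a value which the inverse map has to restore at k.\<close>
    proof (rule sum.reindex_bij_witness[where i = "\<lambda>f. (f(k := undefined), f k)" and j = "\<lambda>(f, j). f(k := j)"])
      fix a assume "a \<in> ({..<k} \<rightarrow>\<^sub>E J) \<times> J"
      then obtain f j where a: "a = (f, j)" "f \<in> {..<k} \<rightarrow>\<^sub>E J" "j \<in> J" by blast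
      have "f k = undefined" using a(2) by (auto simp: PiE_iff extensional_def)
      then show "((case a of (f, j) \<Rightarrow> f(k := j))(k := undefined), (case a of (f, j) \<Rightarrow> f(k := j)) k) = a"
        by (auto simp: a fun_eq_iff)
      show "(case a of (f, j) \<Rightarrow> f(k := j)) \<in> {..<Suc k} \<rightarrow>\<^sub>E J"
        using a by (auto simp: PiE_iff extensional_def less_Suc_eq)
      have "(\<Prod>i<k. T i ((f(k := j)) i)) = (\<Prod>i<k. T i (f i))" by (rule prod.cong) auto
      then show "(\<Prod>i<Suc k. T i ((case a of (f, j) \<Rightarrow> f(k := j)) i)) *\<^sub>R
          \<alpha> (\<lambda>i. if i < Suc k then y ((case a of (f, j) \<Rightarrow> f(k := j)) i) else x i) =
        (case a of (f, j) \<Rightarrow> ((\<Prod>i<k. T i (f i)) * T k j) *\<^sub>R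
          \<alpha> (\<lambda>i. if i < Suc k then y ((f(k := j)) i) else x i))"
        unfolding a prod.case by simp
    next
      fix f assume f: "f \<in> {..<Suc k} \<rightarrow>\<^sub>E J"
      show "(case (f(k := undefined), f k) of (f, j) \<Rightarrow> f(k := j)) = f" by simp
      have "f(k := undefined) \<in> {..<k} \<rightarrow>\<^sub>E J"
        using f by (auto simp: PiE_iff extensional_def)
      moreover have "f k \<in> J" using f by auto
      ultimately show "(f(k := undefined), f k) \<in> ({..<k} \<rightarrow>\<^sub>E J) \<times> J" by blast
    qed
    finally show ?case .
  qed simp
  from this[of m] have "\<alpha> x = (\<Sum>f\<in>{..<m} \<rightarrow>\<^sub>E J. (\<Prod>i<m. T i (f i)) *\<^sub>R \<alpha> (\<lambda>i. if i < m then y (f i) else x i))"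
    by simp
  also have "\<dots> = (\<Sum>f\<in>{..<m} \<rightarrow>\<^sub>E J. (\<Prod>i<m. T i (f i)) *\<^sub>R \<alpha> (\<lambda>i. y (f i)))"
    by (intro sum.cong refl arg_cong2[where f = scaleR] alt_formsD(1)[OF \<alpha>]) auto
  finally show ?thesis .
qed

lemma alt_forms_permute:
  assumes \<alpha>: "\<alpha> \<in> alt_forms m" and p: "p permutes {..<m}"
  shows "\<alpha> (\<lambda>i. x (p i)) = of_int (sign p) *\<^sub>R \<alpha> x"
  using p finite_lessThan
proof (induction p arbitrary: x rule: permutes_induct)
  case (swap a b p)
  have swap1: "\<alpha> (\<lambda>i. x (Transposition.transpose a b i)) = - \<alpha> x" for x
  proof -
    from swap have ab: "a < m" "b < m" "a \<noteq> b" by auto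
    let ?w = "\<lambda>u v. x(a := u, b := v)"
    have add2: "\<alpha> (?w u (v + v')) = \<alpha> (?w u v) + \<alpha> (?w u v')" for u v v'
      by (rule linear_add[OF alt_formsD(2)[OF \<alpha> ab(2)]])
    have add1: "\<alpha> (?w (u + u') v) = \<alpha> (?w u v) + \<alpha> (?w u' v)" for u u' v
      using linear_add[OF alt_formsD(2)[OF \<alpha> ab(1)], of "x(b := v)"] ab(3) by (simp add: fun_upd_twist)
    have diag: "\<alpha> (?w u u) = 0" for u
      by (rule alt_formsD(3)[OF \<alpha> ab]) (use ab in auto)
    \<comment> \<open>Polarization: the form vanishes with x a + x b in both slots, and so do the
      two diagonal terms of its expansion.\<close>
    have "\<alpha> (?w (x b) (x a)) + \<alpha> (?w (x a) (x b)) = 0"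
      using add1[of "x a" "x b" "x a + x b"] diag[of "x a + x b"] diag[of "x a"] diag[of "x b"]
      unfolding add2 by (simp add: add.commute)
    then have "\<alpha> (?w (x b) (x a)) = - \<alpha> x" by (simp add: eq_neg_iff_add_eq_0 add.commute)
    moreover have "?w (x b) (x a) = (\<lambda>i. x (Transposition.transpose a b i))"
      by (auto simp: fun_eq_iff Transposition.transpose_def)
    ultimately show ?thesis by simp
  qed
  have "\<alpha> (\<lambda>i. x ((Transposition.transpose a b \<circ> p) i)) = of_int (sign p) *\<^sub>R \<alpha> (\<lambda>i. x (Transposition.transpose a b i))"
    using swap.IH[of "\<lambda>i. x (Transposition.transpose a b i)"] by simp
  also have "\<dots> = of_int (sign (Transposition.transpose a b \<circ> p)) *\<^sub>R \<alpha> x"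
    using swap permutes_imp_permutation[OF finite_lessThan, of p m]
    by (simp add: swap1 sign_compose sign_swap_id permutation_swap_id)
  finally show ?case .
qed simp

text \<open>Index functions that are not injective repeat a vector and contribute 0; the others are
  permutations, so the coefficient is the determinant of T. This permits evaluating an oriented
  plane at another basis of the same span.\<close>

lemma alt_forms_frame:
  assumes \<alpha>: "\<alpha> \<in> alt_forms m"
    and x: "\<And>i. i < m \<Longrightarrow> x i = (\<Sum>j<m. T i j *\<^sub>R y j)"
  shows "\<alpha> x = (\<Sum>p | p permutes {..<m}. of_int (sign p) * (\<Prod>i<m. T i (p i))) *\<^sub>R \<alpha> y"
proof -
  let ?E = "{..<m} \<rightarrow>\<^sub>E {..<m}" and ?P = "{p. p permutes {..<m}}"
  let ?r = "\<lambda>p. restrict p {..<m}"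
  let ?t = "\<lambda>f. (\<Prod>i<m. T i (f i)) *\<^sub>R \<alpha> (\<lambda>i. y (f i))"
  have bij: "bij_betw ?r ?P {f \<in> ?E. inj_on f {..<m}}"
  proof (rule bij_betw_byWitness[where f' = "\<lambda>f i. if i < m then f i else i"])
    show "\<forall>p\<in>?P. (\<lambda>i. if i < m then ?r p i else i) = p"
      by (auto simp: fun_eq_iff permutes_def)
    show "\<forall>f\<in>{f \<in> ?E. inj_on f {..<m}}. ?r (\<lambda>i. if i < m then f i else i) = f"
      by (auto simp: fun_eq_iff PiE_iff extensional_def)
    show "?r ` ?P \<subseteq> {f \<in> ?E. inj_on f {..<m}}"
    proof clarify
      fix p assume p: "p permutes {..<m}"
      then have "p i \<in> {..<m}" if "i \<in> {..<m}" for i using permutes_in_image[OF p] that by simp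
      moreover have "inj_on p {..<m}" using p by (rule permutes_inj_on)
      ultimately show "?r p \<in> ?E \<and> inj_on (?r p) {..<m}" by (auto simp: inj_on_def)
    qed
    show "(\<lambda>f i. if i < m then f i else i) ` {f \<in> ?E. inj_on f {..<m}} \<subseteq> ?P"
    proof clarify
      fix f assume f: "f \<in> ?E" "inj_on f {..<m}"
      then have "f ` {..<m} = {..<m}" by (intro endo_inj_surj) auto
      with f(2) have "bij_betw f {..<m} {..<m}" by (simp add: bij_betw_def)
      then have "bij_betw (\<lambda>i. if i < m then f i else i) {..<m} {..<m}"
        by (subst bij_betw_cong[where g = f]) auto
      then show "(\<lambda>i. if i < m then f i else i) permutes {..<m}"
        by (rule bij_imp_permutes) auto
    qed
  qed
  have "\<alpha> x = (\<Sum>f\<in>?E. ?t f)" by (rule alt_forms_expand[OF \<alpha> _ x]) auto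
  also have "\<dots> = (\<Sum>f\<in>{f \<in> ?E. inj_on f {..<m}}. ?t f)"
  proof (rule sum.mono_neutral_right)
    show "\<forall>f\<in>?E - {f \<in> ?E. inj_on f {..<m}}. ?t f = 0"
    proof
      fix f assume "f \<in> ?E - {f \<in> ?E. inj_on f {..<m}}"
      then obtain i j where "i < m" "j < m" "i \<noteq> j" "f i = f j" by (auto simp: inj_on_def)
      then show "?t f = 0" using alt_formsD(3)[OF \<alpha>, of i j "\<lambda>i. y (f i)"] by simp
    qed
  qed (auto intro: finite_PiE)
  also have "\<dots> = (\<Sum>p\<in>?P. ?t (?r p))" by (rule sum.reindex_bij_betw[OF bij, symmetric])
  also have "\<dots> = (\<Sum>p\<in>?P. (of_int (sign p) * (\<Prod>i<m. T i (p i))) *\<^sub>R \<alpha> y)"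
  proof (rule sum.cong[OF refl])
    fix p assume "p \<in> ?P"
    then have "\<alpha> (\<lambda>i. y (p i)) = of_int (sign p) *\<^sub>R \<alpha> y" using alt_forms_permute[OF \<alpha>, of p y] by simp
    moreover have "\<alpha> (\<lambda>i. y (?r p i)) = \<alpha> (\<lambda>i. y (p i))" by (rule alt_formsD(1)[OF \<alpha>]) auto
    ultimately show "?t (?r p) = (of_int (sign p) * (\<Prod>i<m. T i (p i))) *\<^sub>R \<alpha> y" by simp
  qed
  finally show ?thesis by (simp add: scaleR_sum_left)
qed

text \<open>All tuples from B are summed, not only increasing ones. Each permutation in the Leibniz
  formula reproduces \<alpha> x, whence the division by m!.\<close>

lemma alt_forms_expand_covectors:
  fixes \<alpha> :: "('a::real_inner, real) form"
  assumes \<alpha>: "\<alpha> \<in> alt_forms m" and B: "finite B"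
    and exp: "\<And>v. v = (\<Sum>b\<in>B. (b \<bullet> v) *\<^sub>R b)"
  shows "\<alpha> x = (\<Sum>e\<in>{..<m} \<rightarrow>\<^sub>E B. (\<alpha> e / fact m) * wedge_covectors (\<lambda>i v. e i \<bullet> v) m x)"
proof -
  let ?P = "{p. p permutes {..<m}}" and ?E = "{..<m} \<rightarrow>\<^sub>E B"
  have "(\<Sum>e\<in>?E. \<alpha> e * wedge_covectors (\<lambda>i v. e i \<bullet> v) m x) =
      (\<Sum>e\<in>?E. \<Sum>p\<in>?P. of_int (sign p) * ((\<Prod>i<m. e i \<bullet> x (p i)) * \<alpha> e))"
    unfolding wedge_covectors_eq sum_distrib_left by (simp add: mult_ac)
  also have "\<dots> = (\<Sum>p\<in>?P. \<Sum>e\<in>?E. of_int (sign p) * ((\<Prod>i<m. e i \<bullet> x (p i)) * \<alpha> e))"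
    by (rule sum.swap)
  also have "\<dots> = (\<Sum>p\<in>?P. of_int (sign p) * \<alpha> (\<lambda>i. x (p i)))"
  proof (rule sum.cong[OF refl])
    fix p
    have "\<alpha> (\<lambda>i. x (p i)) = (\<Sum>f\<in>?E. (\<Prod>i<m. f i \<bullet> x (p i)) *\<^sub>R \<alpha> (\<lambda>i. f i))"
      by (rule alt_forms_expand[OF \<alpha> B, of "\<lambda>i. x (p i)" "\<lambda>i b. b \<bullet> x (p i)" "\<lambda>b. b"]) (rule exp)
    then show "(\<Sum>e\<in>?E. of_int (sign p) * ((\<Prod>i<m. e i \<bullet> x (p i)) * \<alpha> e)) = of_int (sign p) * \<alpha> (\<lambda>i. x (p i))"
      by (simp add: sum_distrib_left)
  qed
  also have "\<dots> = (\<Sum>p\<in>?P. \<alpha> x)"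
    by (rule sum.cong[OF refl]) (simp add: alt_forms_permute[OF \<alpha>] flip: of_int_mult mult.assoc)
  also have "\<dots> = fact m * \<alpha> x" by (simp add: card_permutations[OF refl])
  finally have "fact m * \<alpha> x = (\<Sum>e\<in>?E. \<alpha> e * wedge_covectors (\<lambda>i v. e i \<bullet> v) m x)" by simp
  then have "\<alpha> x = (\<Sum>e\<in>?E. \<alpha> e * wedge_covectors (\<lambda>i v. e i \<bullet> v) m x) / fact m"
    by (simp add: nonzero_eq_divide_eq mult.commute)
  then show ?thesis by (simp add: sum_divide_distrib)
qed

section \<open>Unitary frames\<close>

context hermitian_space
begin

text \<open>Arbitrary index sets are allowed because the system read off from a plane can have gaps,
  which \<open>orthonormal_extend\<close> fills.\<close>

definition orthonormal_on :: "nat set \<Rightarrow> (nat \<Rightarrow> 'a) \<Rightarrow> bool" where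
  "orthonormal_on I e \<longleftrightarrow> (\<forall>i\<in>I. \<forall>j\<in>I. H (e i) (e j) = (if i = j then 1 else 0))"

text \<open>A unitary basis of the whole space. Completeness is stated as the Fourier expansion, the
  form in which it enters the computations.\<close>

definition frame :: "nat \<Rightarrow> (nat \<Rightarrow> 'a) \<Rightarrow> bool" where
  "frame n e \<longleftrightarrow> orthonormal_on {..<n} e \<and> (\<forall>v. v = (\<Sum>i<n. scaleC (H (e i) v) (e i)))"

lemma H_add_left: "H (x + y) z = H x z + H y z"
  by (subst (1 2 3) H_cnj) (simp add: H_add_right)

lemma H_scale_left: "H (scaleC c x) y = cnj c * H x y"
  by (subst (1 2) H_cnj) (simp add: H_scale_right)

lemma H_zero_right [simp]: "H x 0 = 0"
  using H_add_right[of x 0 0] by simp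

lemma H_zero_left [simp]: "H 0 x = 0"
  using H_add_left[of 0 0 x] by simp

lemma H_sum_right: "H x (\<Sum>i\<in>I. f i) = (\<Sum>i\<in>I. H x (f i))"
  by (induction I rule: infinite_finite_induct) (simp_all add: H_add_right)

lemma H_sum_left: "H (\<Sum>i\<in>I. f i) x = (\<Sum>i\<in>I. H (f i) x)"
  by (induction I rule: infinite_finite_induct) (simp_all add: H_add_left)

lemma H_scaleR_right: "H x (r *\<^sub>R y) = r * H x y"
  by (simp flip: scaleC_of_real add: H_scale_right)

lemma H_scaleR_left: "H (r *\<^sub>R x) y = r * H x y"
  by (simp flip: scaleC_of_real add: H_scale_left)

lemma H_minus_right: "H x (- y) = - H x y"
  using H_scaleR_right[of x "-1" y] by simp

lemma H_minus_left: "H (- x) y = - H x y"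
  using H_scaleR_left[of "-1" x y] by simp

lemma H_diff_right: "H x (y - z) = H x y - H x z"
  using H_add_right[of x y "- z"] by (simp add: H_minus_right)

lemma H_diff_left: "H (x - y) z = H x z - H y z"
  using H_add_left[of x "- y" z] by (simp add: H_minus_left)

lemma linear_H: "linear (H x)"
  by (rule linearI) (simp_all add: H_add_right H_scaleR_right scaleR_conv_of_real)

lemma Im_H_self: "Im (H x x) = 0"
  using arg_cong[OF H_cnj[of x x], of Im] by simp

lemma H_self: "H x x = of_real (x \<bullet> x)"
  by (rule complex_eqI) (simp_all add: Im_H_self Re_H)

lemma Im_H: "Im (H x y) = scaleC \<i> x \<bullet> y"
  by (simp flip: Re_H add: H_scale_left)

lemma frame_expand: "frame n e \<Longrightarrow> v = (\<Sum>i<n. scaleC (H (e i) v) (e i))"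
  unfolding frame_def by blast

lemma frame_orthonormal:
  "frame n e \<Longrightarrow> i < n \<Longrightarrow> j < n \<Longrightarrow> H (e i) (e j) = (if i = j then 1 else 0)"
  unfolding frame_def orthonormal_on_def by blast

lemma frame_H: "frame n e \<Longrightarrow> H v w = (\<Sum>i<n. H (e i) w * H v (e i))"
  by (subst frame_expand[of n e w]) (simp_all add: H_sum_right H_scale_right)

lemma frame_parseval: "frame n e \<Longrightarrow> H v w = (\<Sum>i<n. cnj (H (e i) v) * H (e i) w)"
  by (subst frame_H, assumption, rule sum.cong[OF refl], subst (2) H_cnj) simp

text \<open>The trace of the projection away from the e i is the codimension n - card I. This
  replaces dimension theory: all residuals of the b j vanish when card I = n, and some residual
  survives when card I < n.\<close>

lemma orthonormal_residual:
  assumes b: "frame n b" and e: "orthonormal_on I e" and I: "finite I"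
  defines "r \<equiv> \<lambda>v. v - (\<Sum>i\<in>I. scaleC (H (e i) v) (e i))"
  shows "i \<in> I \<Longrightarrow> H (e i) (r v) = 0"
    and "(\<Sum>j<n. H (r (b j)) (r (b j))) = of_nat n - of_nat (card I)"
proof -
  show 0: "H (e i) (r v) = 0" if "i \<in> I" for i v
  proof -
    have "H (e i) (r v) = H (e i) v - (\<Sum>k\<in>I. H (e k) v * H (e i) (e k))"
      by (simp add: r_def H_diff_right H_sum_right H_scale_right)
    also have "(\<Sum>k\<in>I. H (e k) v * H (e i) (e k)) = (\<Sum>k\<in>I. if k = i then H (e k) v else 0)"
      using e that by (intro sum.cong) (auto simp: orthonormal_on_def)
    finally show ?thesis using that I by simp
  qed
  have sq: "H (r v) (r v) = H v v - (\<Sum>i\<in>I. H (e i) v * H v (e i))" for v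
  proof -
    have "H (r v) (r v) = H v (r v) - (\<Sum>i\<in>I. cnj (H (e i) v) * H (e i) (r v))"
      by (subst (1) r_def) (simp add: H_diff_left H_sum_left H_scale_left)
    also have "\<dots> = H v (r v)" using 0 by simp
    finally show ?thesis by (simp add: r_def H_diff_right H_sum_right H_scale_right)
  qed
  have "(\<Sum>j<n. H (r (b j)) (r (b j))) = (\<Sum>j<n. H (b j) (b j)) - (\<Sum>i\<in>I. \<Sum>j<n. H (e i) (b j) * H (b j) (e i))"
    by (simp add: sq sum_subtractf) (rule sum.swap)
  also have "(\<Sum>j<n. H (b j) (b j)) = of_nat n"
    using frame_orthonormal[OF b] by simp
  also have "(\<Sum>i\<in>I. \<Sum>j<n. H (e i) (b j) * H (b j) (e i)) = (\<Sum>i\<in>I. H (e i) (e i))"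
    by (intro sum.cong refl) (subst frame_H[OF b], simp add: mult.commute)
  also have "\<dots> = of_nat (card I)"
    using e by (simp add: orthonormal_on_def)
  finally show "(\<Sum>j<n. H (r (b j)) (r (b j))) = of_nat n - of_nat (card I)" .
qed

lemma orthonormal_frame:
  assumes b: "frame n b" and e: "orthonormal_on {..<n} e"
  shows "frame n e"
proof -
  let ?r = "\<lambda>v. v - (\<Sum>i<n. scaleC (H (e i) v) (e i))"
  have lin: "?r (\<Sum>j<n. scaleC (c j) (b j)) = (\<Sum>j<n. scaleC (c j) (?r (b j)))" for c
    by (simp add: H_sum_right H_scale_right scale_sum_left scale_right_diff_distrib scale_sum_right
        sum_subtractf) (rule sum.swap)
  have "(\<Sum>j<n. H (?r (b j)) (?r (b j))) = 0"
    using orthonormal_residual(2)[OF b e] by simp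
  then have "of_real (\<Sum>j<n. ?r (b j) \<bullet> ?r (b j)) = (0 :: complex)"
    by (simp only: H_self flip: of_real_sum)
  then have "(\<Sum>j<n. ?r (b j) \<bullet> ?r (b j)) = 0" by (simp only: of_real_eq_0_iff)
  then have r0: "?r (b j) = 0" if "j < n" for j
    using that by (subst (asm) sum_nonneg_eq_0_iff) auto
  have "?r v = 0" for v
    using lin[of "\<lambda>j. H (b j) v"] r0 unfolding frame_expand[OF b, symmetric] by simp
  then show ?thesis using e by (simp add: frame_def)
qed

text \<open>As long as card I < n, some b j has a nonzero residual by
  \<open>orthonormal_residual\<close>; normalized, it fills a free index.\<close>

lemma orthonormal_extend:
  assumes b: "frame n b"
  shows "orthonormal_on I e \<Longrightarrow> I \<subseteq> {..<n} \<Longrightarrow> \<exists>f. frame n f \<and> (\<forall>i\<in>I. f i = e i)"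
proof (induction "n - card I" arbitrary: I e)
  case 0
  then have "I = {..<n}" by (intro card_seteq) auto
  then show ?case using orthonormal_frame[OF b] 0 by blast
next
  case (Suc k)
  have fin: "finite I" using Suc.prems(2) by (rule finite_subset) simp
  let ?r = "\<lambda>v. v - (\<Sum>i\<in>I. scaleC (H (e i) v) (e i))"
  have "card I < n" using Suc.hyps(2) by simp
  then have "I \<noteq> {..<n}" by auto
  then obtain m where m: "m < n" "m \<notin> I" using Suc.prems(2) by auto
  have "(\<Sum>j<n. H (?r (b j)) (?r (b j))) \<noteq> 0"
    using orthonormal_residual(2)[OF b Suc.prems(1) fin] \<open>card I < n\<close> by simp
  then obtain j where "H (?r (b j)) (?r (b j)) \<noteq> 0" by (meson sum.neutral)
  then have j: "?r (b j) \<noteq> 0" by auto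
  define w where "w = (1 / norm (?r (b j))) *\<^sub>R ?r (b j)"
  have "w \<bullet> w = 1" using j by (simp add: w_def dot_square_norm power2_eq_square)
  then have w1: "H w w = 1" by (simp add: H_self)
  have w0: "H (e i) w = 0" if "i \<in> I" for i
    unfolding w_def H_scaleR_right using orthonormal_residual(1)[OF b Suc.prems(1) fin that] by simp
  then have w0': "H w (e i) = 0" if "i \<in> I" for i
    using that by (subst H_cnj) simp
  have "orthonormal_on (insert m I) (e(m := w))"
    using Suc.prems(1) w1 w0 w0' m by (auto simp: orthonormal_on_def)
  moreover have "k = n - card (insert m I)" using Suc.hyps(2) m fin by simp
  moreover have "insert m I \<subseteq> {..<n}" using m Suc.prems(2) by simp
  ultimately obtain f where f: "frame n f" "\<forall>i\<in>insert m I. f i = (e(m := w)) i"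
    using Suc.hyps(1) by blast
  have "f i = e i" if "i \<in> I" for i
  proof -
    have "i \<noteq> m" using that m(2) by blast
    then show ?thesis using bspec[OF f(2) insertI2[OF that]] by simp
  qed
  with f(1) show ?case by blast
qed

text \<open>In complex dimension n all wedge products of n complex linear covectors are
  proportional, and the factor is found by evaluating at e. Between two frames it is a phase by
  \<open>frame_wedge_frame\<close>.\<close>

lemma frame_change:
  assumes e: "frame n e"
  shows "wedge_covectors (\<lambda>i. H (f i)) n x =
    wedge_covectors (\<lambda>i. H (f i)) n e * wedge_covectors (\<lambda>i. H (e i)) n x"
proof -
  have "wedge_list (map (\<lambda>i. H (f i)) [0..<n] @ []) x =
      det (mat n n (\<lambda>(i, j). H (f i) (e j))) * wedge_list (map (\<lambda>i. H (e i)) [0..<n] @ []) x"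
  proof (rule wedge_list_change[where D = "\<lambda>_ _. 0"])
    fix i j assume "i < n"
    then show "(map (\<lambda>i. H (f i)) [0..<n] ! i) (x j) =
        (\<Sum>b<n. H (f i) (e b) * (map (\<lambda>i. H (e i)) [0..<n] ! b) (x j)) + (\<Sum>b<0. 0 * ([] ! b) (x j))"
      using frame_H[OF e, of "f i" "x j"] by (simp add: mult.commute)
  qed simp_all
  then show ?thesis by (simp add: wedge_covectors_eq_list[symmetric] wedge_covectors_det[of _ _ e])
qed

lemma frame_wedge_self: "frame n e \<Longrightarrow> wedge_covectors (\<lambda>i. H (e i)) n e = 1"
proof -
  assume e: "frame n e"
  have "mat n n (\<lambda>(i, j). H (e i) (e j)) = 1\<^sub>m n"
    by (rule eq_matI) (auto simp: frame_orthonormal[OF e])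
  then show ?thesis by (simp add: wedge_covectors_det)
qed

text \<open>Hermitian symmetry makes the transposed matrix the conjugate one. Vectors and covectors
  can thereby change roles, so that operations on vectors become row operations.\<close>

lemma wedge_covectors_cnj_transpose:
  "wedge_covectors (\<lambda>i. H (e i)) n f = cnj (wedge_covectors (\<lambda>i. H (f i)) n e)"
proof -
  have "det (mat n n (\<lambda>(i, j). H (e i) (f j))) = det (transpose_mat (mat n n (\<lambda>(i, j). H (e i) (f j))))"
    by (rule det_transpose[OF mat_carrier, symmetric])
  also have "transpose_mat (mat n n (\<lambda>(i, j). H (e i) (f j))) = map_mat cnj (mat n n (\<lambda>(i, j). H (f i) (e j)))"
    by (rule eq_matI) (simp_all add: H_cnj[symmetric])
  also have "det \<dots> = cnj (det (mat n n (\<lambda>(i, j). H (f i) (e j))))"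
  proof -
    interpret comm_ring_hom cnj by unfold_locales auto
    show ?thesis by (rule hom_det)
  qed
  finally show ?thesis by (simp add: wedge_covectors_det)
qed

lemma frame_wedge_frame:
  assumes "frame n e" "frame n f"
  shows "cmod (wedge_covectors (\<lambda>i. H (f i)) n e) = 1"
proof -
  have "1 = wedge_covectors (\<lambda>i. H (f i)) n e * wedge_covectors (\<lambda>i. H (e i)) n f"
    using frame_change[OF assms(1), of f f] frame_wedge_self[OF assms(2)] by simp
  then have "of_real ((cmod (wedge_covectors (\<lambda>i. H (f i)) n e))\<^sup>2) = (1 :: complex)"
    unfolding wedge_covectors_cnj_transpose[of e] complex_norm_square ..
  then have "(cmod (wedge_covectors (\<lambda>i. H (f i)) n e))\<^sup>2 = 1"
    unfolding of_real_eq_1_iff .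
  then show ?thesis
    using norm_ge_zero[of "wedge_covectors (\<lambda>i. H (f i)) n e"] by (auto simp: power2_eq_1_iff)
qed

text \<open>Coordinates in the basis are inner products with its members. Unlike
  \<open>representation\<close>, inner products make sense off Y, which is what extends the volume
  forms to the whole space.\<close>

lemma unitary_basis_expand:
  assumes e: "unitary_basis scaleC H Y d e"
  shows "v \<in> Y \<Longrightarrow> v = (\<Sum>i<d. scaleC (H (e i) v) (e i))"
    and "v \<in> Y \<Longrightarrow> i < d \<Longrightarrow> representation (e ` {..<d}) v (e i) = H (e i) v"
    and "i < d \<Longrightarrow> e i \<in> Y"
proof -
  have on: "H (e i) (e j) = (if i = j then 1 else 0)" if "i < d" "j < d" for i j
    using e that unfolding unitary_basis_def by blast
  have sp: "span (e ` {..<d}) = Y" using e unfolding unitary_basis_def by blast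
  have inj: "inj_on e {..<d}"
  proof (rule inj_onI)
    fix i j assume "i \<in> {..<d}" "j \<in> {..<d}" "e i = e j"
    then show "i = j" using on[of i j] on[of j j] by (auto split: if_splits)
  qed
  have coeff: "H (e i) (\<Sum>j<d. scaleC (u (e j)) (e j)) = u (e i)" if "i < d" for u i
  proof -
    have "H (e i) (\<Sum>j<d. scaleC (u (e j)) (e j)) = (\<Sum>j<d. if j = i then u (e j) else 0)"
      unfolding H_sum_right H_scale_right using on that by (intro sum.cong) auto
    then show ?thesis using that by simp
  qed
  have ind: "independent (e ` {..<d})"
  proof (rule notI)
    assume "dependent (e ` {..<d})"
    then obtain u i where u: "i < d" "u (e i) \<noteq> 0" "(\<Sum>v\<in>e ` {..<d}. scaleC (u v) v) = 0"
      by (subst (asm) dependent_finite) auto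
    then have "(\<Sum>j<d. scaleC (u (e j)) (e j)) = 0" by (simp add: sum.reindex[OF inj])
    then show False using coeff[OF u(1), of u] u(2) by simp
  qed
  have rep: "representation (e ` {..<d}) v (e i) = H (e i) v" if "v \<in> Y" "i < d" for v i
  proof -
    have "(\<Sum>b\<in>e ` {..<d}. scaleC (representation (e ` {..<d}) v b) b) = v"
      by (rule sum_representation_eq[OF ind]) (use that sp in auto)
    then have "(\<Sum>j<d. scaleC (representation (e ` {..<d}) v (e j)) (e j)) = v"
      by (simp add: sum.reindex[OF inj])
    then show ?thesis using coeff[OF that(2), of "representation (e ` {..<d}) v"] by simp
  qed
  show "v = (\<Sum>i<d. scaleC (H (e i) v) (e i))" if v: "v \<in> Y" for v
  proof -
    have "(\<Sum>b\<in>e ` {..<d}. scaleC (representation (e ` {..<d}) v b) b) = v"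
      by (rule sum_representation_eq[OF ind]) (use that sp in auto)
    then show ?thesis using rep[OF v] by (simp add: sum.reindex[OF inj])
  qed
  show "representation (e ` {..<d}) v (e i) = H (e i) v" if "v \<in> Y" "i < d" for v i
    using that by (rule rep)
  show "e i \<in> Y" if "i < d" for i
    using that sp span_superset[of "e ` {..<d}"] by blast
qed

lemma holomorphic_volume_form_UNIV:
  assumes "holomorphic_volume_form scaleC H UNIV d \<Omega>"
  obtains e where "frame d e" "\<Omega> = wedge_covectors (\<lambda>i. H (e i)) d"
proof -
  obtain e where e: "unitary_basis scaleC H UNIV d e"
    and \<Omega>: "\<Omega> = wedge_covectors (\<lambda>i v. representation (e ` {..<d}) v (e i)) d"
    using assms unfolding holomorphic_volume_form_def by blast
  have "frame d e"
    unfolding frame_def orthonormal_on_def using unitary_basis_expand(1)[OF e] e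
    by (auto simp: unitary_basis_def)
  moreover have "\<Omega> = wedge_covectors (\<lambda>i. H (e i)) d"
    unfolding \<Omega> by (rule ext, rule wedge_covectors_cong) (simp add: unitary_basis_expand(2)[OF e])
  ultimately show ?thesis by (rule that)
qed

lemma orth_proj_direct_sum:
  assumes X1: "subspace X1" and "u \<in> X1" "w \<in> X2" and orth: "\<forall>u\<in>X1. \<forall>v\<in>X2. H u v = 0"
  shows "orth_proj X1 (u + w) = u"
  unfolding orth_proj_def
proof (rule the_equality)
  have "z \<bullet> w = 0" if "z \<in> X1" for z
    using orth that assms(3) by (simp flip: Re_H)
  then show "u \<in> X1 \<and> (\<forall>z\<in>X1. orthogonal z (u + w - u))"
    using assms(2) by (simp add: Linear_Algebra.orthogonal_def)
  fix y assume y: "y \<in> X1 \<and> (\<forall>z\<in>X1. orthogonal z (u + w - y))"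
  have d: "u - y \<in> X1" using y assms(2) X1 by (simp add: subspace_diff)
  then have "(u - y) \<bullet> (u + w - y) = 0" using y by (simp add: Linear_Algebra.orthogonal_def)
  moreover have "(u - y) \<bullet> w = 0"
    using orth d assms(3) by (simp flip: Re_H)
  ultimately have "(u - y) \<bullet> (u - y) = 0" by (simp add: algebra_simps)
  then show "y = u" by simp
qed

text \<open>The component of a vector in X2 is orthogonal to every e i, so H (e i) does not notice
  the projection and the pulled back form has the same formula on the whole space.\<close>

lemma pullback_holomorphic_volume_form:
  assumes X1: "subspace X1" and orth: "\<forall>u\<in>X1. \<forall>v\<in>X2. H u v = 0"
    and sum: "{u + v | u v. u \<in> X1 \<and> v \<in> X2} = UNIV"
    and e: "unitary_basis scaleC H X1 d e"
    and \<Omega>: "\<Omega> = wedge_covectors (\<lambda>i v. representation (e ` {..<d}) v (e i)) d"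
  shows "pullback (orth_proj X1) \<Omega> = wedge_covectors (\<lambda>i. H (e i)) d"
  unfolding pullback_def \<Omega>
proof (rule ext, rule wedge_covectors_cong)
  fix x :: "nat \<Rightarrow> 'a" and i j assume i: "i < d"
  obtain u w where x: "x j = u + w" "u \<in> X1" "w \<in> X2" using sum by blast
  then have "(orth_proj X1 \<circ> x) j = u" using orth_proj_direct_sum[OF X1 x(2,3) orth] by simp
  moreover have "H (e i) w = 0" using orth unitary_basis_expand(3)[OF e i] x by blast
  ultimately show "representation (e ` {..<d}) ((orth_proj X1 \<circ> x) j) (e i) = H (e i) (x j)"
    using unitary_basis_expand(2)[OF e _ i] x by (simp add: H_add_right)
qed

lemma adapted_frame:
  assumes X: "subspace X1" "subspace X2" and orth: "\<forall>u\<in>X1. \<forall>v\<in>X2. H u v = 0"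
    and sum: "{u + v | u v. u \<in> X1 \<and> v \<in> X2} = UNIV"
    and "holomorphic_volume_form scaleC H X1 d \<Omega>1" "holomorphic_volume_form scaleC H X2 d' \<Omega>2"
  obtains e where "frame (d + d') e"
    "pullback (orth_proj X1) \<Omega>1 = wedge_covectors (\<lambda>i. H (e i)) d"
    "pullback (orth_proj X2) \<Omega>2 = wedge_covectors (\<lambda>i. H (e (d + i))) d'"
proof -
  obtain e1 where e1: "unitary_basis scaleC H X1 d e1"
    and \<Omega>1: "\<Omega>1 = wedge_covectors (\<lambda>i v. representation (e1 ` {..<d}) v (e1 i)) d"
    using assms unfolding holomorphic_volume_form_def by blast
  obtain e2 where e2: "unitary_basis scaleC H X2 d' e2"
    and \<Omega>2: "\<Omega>2 = wedge_covectors (\<lambda>i v. representation (e2 ` {..<d'}) v (e2 i)) d'"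
    using assms unfolding holomorphic_volume_form_def by blast
  have orth': "\<forall>u\<in>X2. \<forall>v\<in>X1. H u v = 0"
    using orth by (metis H_cnj complex_cnj_zero)
  have sum': "{u + v | u v. u \<in> X2 \<and> v \<in> X1} = UNIV"
  proof -
    have "\<exists>u v. z = u + v \<and> u \<in> X2 \<and> v \<in> X1" for z
    proof -
      obtain u v where "z = u + v" "u \<in> X1" "v \<in> X2" using sum by blast
      then show ?thesis by (metis add.commute)
    qed
    then show ?thesis by blast
  qed
  define e where "e i = (if i < d then e1 i else e2 (i - d))" for i
  have on1: "H (e1 i) (e1 j) = (if i = j then 1 else 0)" if "i < d" "j < d" for i j
    using e1 that unfolding unitary_basis_def by blast
  have on2: "H (e2 i) (e2 j) = (if i = j then 1 else 0)" if "i < d'" "j < d'" for i j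
    using e2 that unfolding unitary_basis_def by blast
  have z12: "H (e1 i) v = 0" if "i < d" "v \<in> X2" for i v
    using orth unitary_basis_expand(3)[OF e1 that(1)] that(2) by blast
  have z21: "H (e2 i) v = 0" if "i < d'" "v \<in> X1" for i v
    using orth' unitary_basis_expand(3)[OF e2 that(1)] that(2) by blast
  have "orthonormal_on {..<d + d'} e"
    unfolding orthonormal_on_def e_def
    using on1 on2 z12 z21 unitary_basis_expand(3)[OF e1] unitary_basis_expand(3)[OF e2] by auto
  moreover have "v = (\<Sum>i<d + d'. scaleC (H (e i) v) (e i))" for v
  proof -
    obtain u w where v: "v = u + w" "u \<in> X1" "w \<in> X2" using sum by blast
    have u: "u = (\<Sum>i<d. scaleC (H (e1 i) v) (e1 i))"
      using unitary_basis_expand(1)[OF e1 v(2)] z12 v by (simp add: H_add_right)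
    have w: "w = (\<Sum>i<d'. scaleC (H (e2 i) v) (e2 i))"
      using unitary_basis_expand(1)[OF e2 v(3)] z21 v by (simp add: H_add_right)
    have "(\<Sum>i<d + d'. scaleC (H (e i) v) (e i)) =
        (\<Sum>i<d. scaleC (H (e1 i) v) (e1 i)) + (\<Sum>i<d'. scaleC (H (e2 i) v) (e2 i))"
      by (simp add: sum_lessThan_add e_def)
    then show ?thesis unfolding u[symmetric] w[symmetric] v(1)[symmetric] by (rule sym)
  qed
  ultimately have "frame (d + d') e" unfolding frame_def by blast
  moreover have "pullback (orth_proj X1) \<Omega>1 = wedge_covectors (\<lambda>i. H (e i)) d"
    unfolding pullback_holomorphic_volume_form[OF X(1) orth sum e1 \<Omega>1]
    by (rule ext, rule wedge_covectors_cong) (simp add: e_def)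
  moreover have "pullback (orth_proj X2) \<Omega>2 = wedge_covectors (\<lambda>i. H (e (d + i))) d'"
    unfolding pullback_holomorphic_volume_form[OF X(2) orth' sum' e2 \<Omega>2]
    by (rule ext, rule wedge_covectors_cong) (simp add: e_def)
  ultimately show ?thesis by (rule that)
qed

end

section \<open>Divided powers of the Kaehler form\<close>

lemma wedge_of_real:
  "wedge k l (\<lambda>x. complex_of_real (\<alpha> x)) (\<lambda>x. complex_of_real (\<beta> x)) = (\<lambda>x. of_real (wedge k l \<alpha> \<beta> x))"
  by (simp add: wedge_def Alt_def tensor_def fun_eq_iff)

lemma wedge_power_of_real:
  "wedge_power k (\<lambda>x. complex_of_real (\<omega> x)) n = (\<lambda>x. of_real (wedge_power k \<omega> n x))"
  by (induction n) (simp_all add: wedge_of_real)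

lemma scaled_sum_Re_Im:
  "Re (of_real c * (\<Sum>i\<in>I. of_int (s i) * f i)) = c * (\<Sum>i\<in>I. of_int (s i) * Re (f i))"
  "Im (of_real c * (\<Sum>i\<in>I. of_int (s i) * f i)) = c * (\<Sum>i\<in>I. of_int (s i) * Im (f i))"
proof -
  have "Re (of_int k * z) = of_int k * Re z" "Im (of_int k * z) = of_int k * Im z" for k and z :: complex
    by (simp_all add: times_complex.sel)
  then show "Re (of_real c * (\<Sum>i\<in>I. of_int (s i) * f i)) = c * (\<Sum>i\<in>I. of_int (s i) * Re (f i))"
    "Im (of_real c * (\<Sum>i\<in>I. of_int (s i) * f i)) = c * (\<Sum>i\<in>I. of_int (s i) * Im (f i))"
    by simp_all
qed

lemma wedge_alt_scaled:
  "wedge k l \<alpha> \<beta> x = of_real (1 / (fact k * fact l)) *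
    (\<Sum>\<sigma> | \<sigma> permutes {..<k + l}. of_int (sign \<sigma>) * (\<alpha> (x \<circ> \<sigma>) * \<beta> (\<lambda>i. (x \<circ> \<sigma>) (k + i))))"
  for \<alpha> \<beta> :: "('a, 'b::{real_div_algebra, field_char_0}) form"
  using fact_nonzero[of "k + l", where 'a='b]
  by (simp add: wedge_def Alt_def tensor_def field_simps del: fact_Suc)

lemma wedge_Re_right:
  "Re (wedge k l (\<lambda>x. complex_of_real (\<alpha> x)) \<beta> x) = wedge k l \<alpha> (\<lambda>x. Re (\<beta> x)) x"
  unfolding wedge_alt_scaled scaled_sum_Re_Im by simp

lemma wedge_Re_left:
  "Re (wedge k l \<beta> (\<lambda>x. complex_of_real (\<alpha> x)) x) = wedge k l (\<lambda>x. Re (\<beta> x)) \<alpha> x"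
  unfolding wedge_alt_scaled scaled_sum_Re_Im by simp

lemma wedge_list_2: "wedge_list [f, g] x = f (x 0) * g (x 1) - f (x 1) * g (x 0)"
proof -
  have "length [f, g] = 2" by simp
  then have "wedge_list [f, g] x = det (mat 2 2 (\<lambda>(i, j). ([f, g] ! i) (x j)))"
    unfolding wedge_list_def wedge_covectors_det by (simp only:)
  then show ?thesis by (simp only: det_mat_2) simp
qed

text \<open>By \<open>inner\<close> the covector of a i is a combination of gs with the values of Fs
  at a i as coefficients, plus a combination of the rows fs, which the wedge product kills. The
  coefficients form the transpose of the matrix of Fs on a, so their determinant is the wedge of Fs
  evaluated there.\<close>

lemma wedge_dual:
  fixes fs gs Fs hs :: "('a::real_inner \<Rightarrow> complex) list"
  assumes l: "length Fs = m" "length gs = m" "length hs = n" "length fs = n"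
    and inner: "\<And>v w. of_real (v \<bullet> w) = (\<Sum>(F, g)\<leftarrow>zip Fs gs. F v * g w) + (\<Sum>(h, f)\<leftarrow>zip hs fs. h v * f w)"
  shows "wedge m n (wedge_covectors (\<lambda>i v. of_real (a i \<bullet> v)) m) (wedge_list fs) x =
    wedge_list Fs a * wedge_list (gs @ fs) x"
proof -
  have zip: "(\<Sum>(F, g)\<leftarrow>zip Fs gs. F v * g w) = (\<Sum>b<length Fs. (Fs ! b) v * (gs ! b) w)"
    if "length Fs = length gs" for v w :: 'a and Fs gs :: "('a \<Rightarrow> complex) list"
    using that by (simp add: sum_list_sum_nth atLeast0LessThan)
  have "wedge m n (wedge_covectors (\<lambda>i v. of_real (a i \<bullet> v)) m) (wedge_list fs) x =
      wedge_list (map (\<lambda>i v. of_real (a i \<bullet> v)) [0..<m] @ fs) x"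
    unfolding wedge_covectors_eq_list by (subst wedge_wedge_list) (simp_all add: l)
  also have "\<dots> = det (mat m m (\<lambda>(i, b). (Fs ! b) (a i))) * wedge_list (gs @ fs) x"
    by (rule wedge_list_change[where D = "\<lambda>i b. (hs ! b) (a i)"])
      (use l in \<open>simp_all add: inner zip\<close>)
  also have "mat m m (\<lambda>(i, b). (Fs ! b) (a i)) = transpose_mat (mat m m (\<lambda>(b, i). (Fs ! b) (a i)))"
    by (rule eq_matI) auto
  also have "det \<dots> = wedge_list Fs a"
    by (subst det_transpose[OF mat_carrier]) (simp add: wedge_list_def wedge_covectors_det l)
  finally show ?thesis .
qed

lemma sum_list_zip_map: "(\<Sum>(F, g)\<leftarrow>zip (map f js) (map h js). \<phi> F g) = (\<Sum>j\<leftarrow>js. \<phi> (f j) (h j))"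
  by (induction js) auto

lemma sum_list_zip_pair_rows:
  "(\<Sum>(F, g)\<leftarrow>zip (pair_rows f g js) (pair_rows h k js). \<phi> F g) = (\<Sum>j\<leftarrow>js. \<phi> (f j) (h j) + \<phi> (g j) (k j))"
  for \<phi> :: "_ \<Rightarrow> _ \<Rightarrow> 'b::comm_monoid_add"
  by (induction js) (auto simp: ac_simps)

lemma sum_list_sorted_list_of_set: "finite S \<Longrightarrow> (\<Sum>j\<leftarrow>sorted_list_of_set S. f j) = sum f S"
  by (simp add: sum_list_distinct_conv_sum_set)

lemma pair_mset_append:
  "f \<in> set fs \<Longrightarrow> g \<in> set gs \<Longrightarrow> {#f, g#} \<subseteq># mset (fs @ gs)"
  using subset_mset.add_mono[of "{#f#}" "mset fs" "{#g#}" "mset gs"] by (simp add: add_mset_commute)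

lemma pair_rows_submset:
  assumes "j \<in> set js"
  shows "{#f j, g j#} \<subseteq># mset (pair_rows f g js)"
proof -
  obtain us vs where "js = us @ j # vs" using split_list[OF assms] by blast
  then show ?thesis by (simp add: mset_pair_rows ac_simps)
qed

text \<open>The pairs indexed by S and S' move freely. On K the rows f and g are interleaved, which
  accounts for the first sign, and each pair is converted to p, q by a 2 by 2 determinant. This
  serves both self-duality and the square, with different f and g.\<close>

lemma wedge_list_grouped:
  assumes d: "finite K" "finite S" "finite S'" "K \<inter> S = {}" "K \<inter> S' = {}" "S \<inter> S' = {}" "K \<union> S \<union> S' = {..<n}"
    and f: "\<And>j v. j \<in> K \<Longrightarrow> f j v = a * p j v + b * q j v"
    and g: "\<And>j v. j \<in> K \<Longrightarrow> g j v = c * p j v + d * q j v"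
  shows "wedge_list (map f (sorted_list_of_set K) @ pair_rows p q (sorted_list_of_set S') @
      map g (sorted_list_of_set K) @ pair_rows p q (sorted_list_of_set S)) x =
    (- 1) ^ (card K choose 2) * (a * d - b * c) ^ card K * wedge_list (pair_rows p q [0..<n]) x"
proof -
  let ?K = "sorted_list_of_set K" and ?P = "\<lambda>S. pair_rows p q (sorted_list_of_set S)"
  have "wedge_list (map f ?K @ ?P S' @ map g ?K @ ?P S) x =
      wedge_list (?P S' @ map f ?K @ map g ?K @ ?P S) x"
    using wedge_list_pair_rows_front[of "[]" "map f ?K" p q "sorted_list_of_set S'" _ x] by simp
  also have "\<dots> = (- 1) ^ (card K choose 2) * wedge_list (?P S' @ pair_rows f g ?K @ ?P S) x"
    by (simp add: wedge_list_interleave)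
  also have "wedge_list (?P S' @ pair_rows f g ?K @ ?P S) x =
      (a * d - b * c) ^ card K * wedge_list (?P S' @ ?P K @ ?P S) x"
    by (subst wedge_list_pair_rows_change[where a = a and b = b and c = c and d = d])
      (use d f g in auto)
  also have "wedge_list (?P S' @ ?P K @ ?P S) x = wedge_list (pair_rows p q [0..<n]) x"
  proof -
    have "mset (sorted_list_of_set S' @ ?K @ sorted_list_of_set S) = mset [0..<n]"
      by (subst set_eq_iff_mset_eq_distinct[symmetric]) (use d in auto)
    from wedge_list_pair_rows_mset[OF this, of "[]" p q "[]" x] show ?thesis by simp
  qed
  finally show ?thesis by (simp add: mult.assoc)
qed

context hermitian_space
begin

section \<open>Mixed forms in a unitary frame\<close>

definition re_cov :: "(nat \<Rightarrow> 'a) \<Rightarrow> nat \<Rightarrow> 'a \<Rightarrow> complex" where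
  "re_cov e j v = of_real (Re (H (e j) v))"

definition im_cov :: "(nat \<Rightarrow> 'a) \<Rightarrow> nat \<Rightarrow> 'a \<Rightarrow> complex" where
  "im_cov e j v = of_real (Im (H (e j) v))"

text \<open>The flag chooses between dz_j and its conjugate. Both kinds are needed because a real
  part is half the sum of a form and its conjugate.\<close>

definition holo_cov :: "(nat \<Rightarrow> 'a) \<Rightarrow> bool \<Rightarrow> nat \<Rightarrow> 'a \<Rightarrow> complex" where
  "holo_cov e b j v = (if b then H (e j) v else cnj (H (e j) v))"

definition mixed_rows :: "(nat \<Rightarrow> 'a) \<Rightarrow> bool \<Rightarrow> nat set \<Rightarrow> nat set \<Rightarrow> ('a \<Rightarrow> complex) list" where
  "mixed_rows e b K S = map (holo_cov e b) (sorted_list_of_set K) @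
     pair_rows (re_cov e) (im_cov e) (sorted_list_of_set S)"

text \<open>
  The wedge of the (anti)holomorphic coordinates in K with the m-th divided power of the
  Kaehler form, in a frame e of length n.  Indices of S in K can be left out because
  dz \<and> dx \<and> dy = 0.
\<close>

definition mixed_form :: "nat \<Rightarrow> (nat \<Rightarrow> 'a) \<Rightarrow> bool \<Rightarrow> nat set \<Rightarrow> nat \<Rightarrow> ('a, complex) form" where
  "mixed_form n e b K m x = (\<Sum>S | S \<subseteq> {..<n} - K \<and> card S = m. wedge_list (mixed_rows e b K S) x)"

lemma length_mixed_rows [simp]: "length (mixed_rows e b K S) = card K + 2 * card S"
  by (simp add: mixed_rows_def)

lemma holo_cov_eq:
  "holo_cov e b j v = 1 * re_cov e j v + (if b then \<i> else - \<i>) * im_cov e j v"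
  by (simp add: holo_cov_def re_cov_def im_cov_def complex_eq_iff)

lemma linear_holo_cov: "linear (holo_cov e b j)"
  using linear_H[of "e j"] by (auto simp: holo_cov_def linear_iff)

lemma linear_re_cov: "linear (re_cov e j)"
  using linear_H[of "e j"] by (auto simp: re_cov_def linear_iff scaleR_conv_of_real)

lemma linear_im_cov: "linear (im_cov e j)"
  using linear_H[of "e j"] by (auto simp: im_cov_def linear_iff scaleR_conv_of_real)

lemma linear_mixed_rows: "f \<in> set (mixed_rows e b K S) \<Longrightarrow> linear f"
  by (auto simp: mixed_rows_def pair_rows_def linear_holo_cov linear_re_cov linear_im_cov)

lemma mixed_form_alt_forms: "mixed_form n e b K m \<in> alt_forms (card K + 2 * m)"
  unfolding mixed_form_def[abs_def]
  by (intro alt_forms_sum wedge_list_alt_forms) (auto intro: linear_mixed_rows)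

text \<open>Since H is conjugate linear in the first argument, the imaginary part of cnj (z(v)) z(w)
  is x(v) y(w) - y(v) x(w), so each dx_j \<and> dy_j has coefficient +1.\<close>

lemma kahler_pairs:
  assumes "frame n e"
  shows "(\<lambda>x. complex_of_real (kahler_form H x)) =
    (\<lambda>x. \<Sum>j\<in>{..<n}. 1 * wedge_list [re_cov e j, im_cov e j] x)"
  by (simp add: fun_eq_iff kahler_form_def frame_parseval[OF assms, of "_ 0"] wedge_list_2 re_cov_def im_cov_def
      algebra_simps of_real_sum[symmetric] of_real_mult[symmetric] of_real_diff[symmetric]
      del: of_real_mult of_real_sum of_real_diff)

lemma kahler_power:
  assumes "frame n e"
  shows "complex_of_real (wedge_power 2 (kahler_form H) m x) = fact m * mixed_form n e b {} m x"
  using fun_cong[OF wedge_power_pairs[OF kahler_pairs[OF assms] finite_lessThan, of m], of x]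
  by (simp add: wedge_power_of_real mixed_form_def mixed_rows_def)

lemma kahler_volume:
  assumes "frame n e"
  shows "complex_of_real (wedge_power 2 (kahler_form H) n x) =
    fact n * wedge_list (pair_rows (re_cov e) (im_cov e) [0..<n]) x"
proof -
  have "{S. S \<subseteq> {..<n} \<and> card S = n} = {{..<n}}"
    using card_subset_eq[of "{..<n}"] by auto
  then show ?thesis
    unfolding kahler_power[OF assms, of n x True]
    by (simp add: mixed_form_def mixed_rows_def lessThan_atLeast0)
qed

lemma inner_covectors:
  assumes "frame n e"
  shows "complex_of_real (v \<bullet> w) = (\<Sum>j<n. re_cov e j v * re_cov e j w + im_cov e j v * im_cov e j w)"
  unfolding Re_H[symmetric] frame_parseval[OF assms, of v w]
  by (simp add: re_cov_def im_cov_def algebra_simps)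

text \<open>There are three causes: a repeated dx_j, a repeated dz_j of the same type, or dz_j
  together with the dx_j and dy_j on which it depends linearly.\<close>

lemma mixed_rows_zero:
  assumes fin: "finite K" "finite S" "finite K'" "finite S'"
    and "S \<inter> S' \<noteq> {} \<or> S \<inter> K' \<noteq> {} \<or> S' \<inter> K \<noteq> {} \<or> b = b' \<and> K \<inter> K' \<noteq> {}"
  shows "wedge_list (mixed_rows e b K S @ mixed_rows e b' K' S') x = 0"
proof -
  have rows: "{#re_cov e j, im_cov e j#} \<subseteq># mset (mixed_rows e b K S)" if "j \<in> S" "finite S" for j b K S
    using pair_rows_submset[of j "sorted_list_of_set S" "re_cov e" "im_cov e"] that
    by (simp add: mixed_rows_def subset_mset.add_increasing)
  have row: "re_cov e j \<in> set (mixed_rows e b K S)" if "j \<in> S" "finite S" for j b K S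
    using rows[OF that, of b K] by (metis mset_subset_eqD set_mset_mset union_single_eq_member add_mset_commute)
  have hol: "holo_cov e b j \<in> set (mixed_rows e b K S)" if "j \<in> K" "finite K" for j b K S
    using that by (simp add: mixed_rows_def)
  have dep: "wedge_list fs x = 0" if "{#holo_cov e b j, re_cov e j, im_cov e j#} \<subseteq># mset fs" for fs b j
    using that by (rule wedge_list_dependent) (rule holo_cov_eq)
  from assms(5) consider j where "j \<in> S" "j \<in> S'" | j where "j \<in> S" "j \<in> K'" | j where "j \<in> S'" "j \<in> K"
    | j where "b = b'" "j \<in> K" "j \<in> K'" by blast
  then show ?thesis
  proof cases
    case 1
    then show ?thesis
      by (intro wedge_list_repeated[of "re_cov e j"] pair_mset_append row fin)
  next
    case 2
    have "{#re_cov e j, im_cov e j#} + {#holo_cov e b' j#} \<subseteq>#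
        mset (mixed_rows e b K S) + mset (mixed_rows e b' K' S')"
      by (intro subset_mset.add_mono rows fin 2) (use hol[OF 2(2) fin(3)] in simp)
    moreover have "{#holo_cov e b' j, re_cov e j, im_cov e j#} = {#re_cov e j, im_cov e j#} + {#holo_cov e b' j#}"
      by (rule multiset_eqI) simp
    ultimately show ?thesis by (intro dep[of b' j]) (simp only: mset_append)
  next
    case 3
    have "{#holo_cov e b j#} + {#re_cov e j, im_cov e j#} \<subseteq>#
        mset (mixed_rows e b K S) + mset (mixed_rows e b' K' S')"
      by (intro subset_mset.add_mono rows fin 3) (use hol[OF 3(2) fin(1)] in simp)
    moreover have "{#holo_cov e b j, re_cov e j, im_cov e j#} = {#holo_cov e b j#} + {#re_cov e j, im_cov e j#}"
      by (rule multiset_eqI) simp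
    ultimately show ?thesis by (intro dep[of b j]) (simp only: mset_append)
  next
    case 4
    then show ?thesis
      by (intro wedge_list_repeated[of "holo_cov e b j"] pair_mset_append) (use hol fin in auto)
  qed
qed

text \<open>The summand of S is dual to that of its complement S' in the complement of K. Both have
  m elements because card K + 2 m = n, so passing to S' permutes the summands and the total is dual
  to itself. The condition \<open>unit\<close> says that the phase arising from the rows on K is 1;
  it holds when card K is 0, 4 or 8.\<close>

lemma mixed_form_dual:
  assumes e: "frame n e" and K: "K \<subseteq> {..<n}" "card K + 2 * m = n"
    and unit: "(- 1) ^ (card K choose 2) * (if b then \<i> else - \<i>) ^ card K = 1"
  shows "wedge n n (wedge_covectors (\<lambda>i v. of_real (a i \<bullet> v)) n) (mixed_form n e b K m) x =
    mixed_form n e b K m a * wedge_list (pair_rows (re_cov e) (im_cov e) [0..<n]) x"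
proof -
  let ?F = "{S. S \<subseteq> {..<n} - K \<and> card S = m}"
  let ?V = "wedge_list (pair_rows (re_cov e) (im_cov e) [0..<n]) x"
  have finK: "finite K" using K(1) finite_subset by blast
  have cc: "card ({..<n} - K) = 2 * m" using K by (simp add: card_Diff_subset finK)
  have compl: "{..<n} - K - S \<in> ?F" "{..<n} - K - ({..<n} - K - S) = S" if "S \<in> ?F" for S
  proof -
    have "finite S" using that finite_subset[of S "{..<n} - K"] by blast
    then show "{..<n} - K - S \<in> ?F" "{..<n} - K - ({..<n} - K - S) = S"
      using that cc card_Diff_subset[of S "{..<n} - K"] by auto
  qed
  have product: "wedge n n (wedge_covectors (\<lambda>i v. of_real (a i \<bullet> v)) n) (wedge_list (mixed_rows e b K S)) x =
      wedge_list (mixed_rows e b K ({..<n} - K - S)) a * ?V" if S: "S \<in> ?F" for S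
  proof -
    define S' where "S' = {..<n} - K - S"
    have fin: "finite S" "finite S'" using S finite_subset[of S "{..<n} - K"] by (auto simp: S'_def)
    have cS: "card S = m" "card S' = m" using S compl(1)[OF S] by (auto simp: S'_def)
    \<comment> \<open>Half the opposite covector is dual to the chosen one: the contribution of
      coordinate j to the inner product of v and w is \<open>holo_cov\<close> at v times
      \<open>half\<close> at w, plus the same with v and w exchanged.\<close>
    define half where "half j v = 1 / 2 * holo_cov e (\<not> b) j v" for j v
    have half: "half j v = 1 / 2 * re_cov e j v + (if b then - \<i> else \<i>) / 2 * im_cov e j v" for j v
      by (simp add: half_def holo_cov_eq algebra_simps)
    let ?K = "sorted_list_of_set K"
    let ?P = "\<lambda>S. pair_rows (re_cov e) (im_cov e) (sorted_list_of_set S)"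
    have hh: "holo_cov e b j v * half j w + half j v * holo_cov e b j w =
        re_cov e j v * re_cov e j w + im_cov e j v * im_cov e j w" for j v w
      by (auto simp: half holo_cov_eq algebra_simps)
    have inner: "of_real (v \<bullet> w) =
        (\<Sum>(F, g)\<leftarrow>zip (mixed_rows e b K S') (map half ?K @ ?P S'). F v * g w) +
        (\<Sum>(F, g)\<leftarrow>zip (map half ?K @ ?P S) (mixed_rows e b K S). F v * g w)" for v w
    proof -
      let ?t = "\<lambda>j. re_cov e j v * re_cov e j w + im_cov e j v * im_cov e j w"
      have "{..<n} = K \<union> (S \<union> S')" "K \<inter> (S \<union> S') = {}" "S \<inter> S' = {}"
        using S K(1) by (auto simp: S'_def)
      then have "sum ?t {..<n} = sum ?t K + (sum ?t S + sum ?t S')"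
        using finK fin by (simp add: sum.union_disjoint)
      also have "sum ?t K = (\<Sum>j\<in>K. holo_cov e b j v * half j w) + (\<Sum>j\<in>K. half j v * holo_cov e b j w)"
        by (simp add: hh sum.distrib[symmetric])
      finally show ?thesis
        unfolding inner_covectors[OF e] mixed_rows_def using finK fin
        by (simp add: zip_append sum_list_zip_map sum_list_zip_pair_rows sum_list_sorted_list_of_set)
    qed
    have "wedge n n (wedge_covectors (\<lambda>i v. of_real (a i \<bullet> v)) n) (wedge_list (mixed_rows e b K S)) x =
        wedge_list (mixed_rows e b K S') a * wedge_list ((map half ?K @ ?P S') @ mixed_rows e b K S) x"
      by (rule wedge_dual[OF _ _ _ _ inner]) (use K cS in auto)
    also have "wedge_list ((map half ?K @ ?P S') @ mixed_rows e b K S) x = ?V"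
    proof -
      have "wedge_list (map half ?K @ ?P S' @ map (holo_cov e b) ?K @ ?P S) x =
          (- 1) ^ (card K choose 2) * (1 / 2 * (if b then \<i> else - \<i>) - (if b then - \<i> else \<i>) / 2 * 1) ^ card K * ?V"
        by (rule wedge_list_grouped) (use finK fin S K(1) in \<open>auto simp: S'_def half holo_cov_eq\<close>)
      also have "1 / 2 * (if b then \<i> else - \<i>) - (if b then - \<i> else \<i>) / 2 * 1 = (if b then \<i> else - \<i>)"
        by simp
      finally show ?thesis using unit by (simp add: mixed_rows_def)
    qed
    finally show ?thesis by (simp add: S'_def)
  qed
  have "wedge n n (wedge_covectors (\<lambda>i v. of_real (a i \<bullet> v)) n) (mixed_form n e b K m) x =
      (\<Sum>S\<in>?F. wedge n n (wedge_covectors (\<lambda>i v. of_real (a i \<bullet> v)) n) (wedge_list (mixed_rows e b K S)) x)"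
    using fun_cong[OF wedge_sum_right[of n n _ "\<lambda>S. 1" "\<lambda>S. wedge_list (mixed_rows e b K S)" ?F], of _ x]
    by (simp add: mixed_form_def[abs_def])
  also have "\<dots> = (\<Sum>S\<in>?F. wedge_list (mixed_rows e b K ({..<n} - K - S)) a * ?V)"
    by (rule sum.cong[OF refl]) (rule product)
  also have "\<dots> = (\<Sum>S\<in>?F. wedge_list (mixed_rows e b K S) a * ?V)"
    by (rule sum.reindex_bij_witness[where i = "\<lambda>S. {..<n} - K - S" and j = "\<lambda>S. {..<n} - K - S"])
      (use compl in auto)
  finally show ?thesis by (simp add: mixed_form_def sum_distrib_right)
qed

section \<open>Products of two mixed forms\<close>

lemma mixed_form_wedge:
  assumes "card K + 2 * m = n" "card K' + 2 * m' = n"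
  shows "wedge n n (mixed_form n e b K m) (mixed_form n e b' K' m') x =
    (\<Sum>S | S \<subseteq> {..<n} - K \<and> card S = m. \<Sum>S' | S' \<subseteq> {..<n} - K' \<and> card S' = m'.
      wedge_list (mixed_rows e b K S @ mixed_rows e b' K' S') x)"
proof -
  have "wedge n n (mixed_form n e b K m) (mixed_form n e b' K' m') x =
      (\<Sum>S | S \<subseteq> {..<n} - K \<and> card S = m. \<Sum>S' | S' \<subseteq> {..<n} - K' \<and> card S' = m'.
        wedge n n (wedge_list (mixed_rows e b K S)) (wedge_list (mixed_rows e b' K' S')) x)"
    using wedge_sum_left[of n n "\<lambda>S. 1" "\<lambda>S. wedge_list (mixed_rows e b K S)" "{S. S \<subseteq> {..<n} - K \<and> card S = m}"]
      wedge_sum_right[of n n _ "\<lambda>S. 1" "\<lambda>S. wedge_list (mixed_rows e b' K' S)" "{S. S \<subseteq> {..<n} - K' \<and> card S = m'}"]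
    by (simp add: mixed_form_def[abs_def])
  also have "\<dots> = (\<Sum>S | S \<subseteq> {..<n} - K \<and> card S = m. \<Sum>S' | S' \<subseteq> {..<n} - K' \<and> card S' = m'.
      wedge_list (mixed_rows e b K S @ mixed_rows e b' K' S') x)"
    by (intro sum.cong refl, subst wedge_wedge_list) (use assms in auto)
  finally show ?thesis .
qed

lemma mixed_form_wedge_zero:
  assumes K: "K \<subseteq> {..<n}" "K' \<subseteq> {..<n}" "card K + 2 * m = n" "card K' + 2 * m' = n"
    and disj: "\<And>S S'. S \<subseteq> {..<n} - K \<Longrightarrow> card S = m \<Longrightarrow> S' \<subseteq> {..<n} - K' \<Longrightarrow> card S' = m' \<Longrightarrow>
      S \<inter> S' \<noteq> {} \<or> S \<inter> K' \<noteq> {} \<or> S' \<inter> K \<noteq> {} \<or> b = b' \<and> K \<inter> K' \<noteq> {}"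
  shows "wedge n n (mixed_form n e b K m) (mixed_form n e b' K' m') x = 0"
proof -
  have fin: "finite S" if "S \<subseteq> {..<n} - L" for S L
    using finite_subset[OF that] by simp
  have fK: "finite K" "finite K'" using K finite_subset by blast+
  show ?thesis
    unfolding mixed_form_wedge[OF K(3,4)]
    by (intro sum.neutral ballI mixed_rows_zero fK) (use disj fin in auto)
qed

text \<open>For each S only the complementary S' avoids a repeated row. On K the product of dz_j
  with its conjugate is - 2 i dx_j \<and> dy_j, which gives the power; the choices of S give the
  binomial coefficient. If K is empty, no row depends on the flags.\<close>

lemma mixed_form_wedge_conj:
  assumes K: "K \<subseteq> {..<n}" "card K + 2 * m = n" and b: "b' = (\<not> b) \<or> K = {}"
  shows "wedge n n (mixed_form n e b K m) (mixed_form n e b' K m) x =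
    (- 1) ^ (card K choose 2) * (if b then - 2 * \<i> else 2 * \<i>) ^ card K * of_nat (2 * m choose m) *
    wedge_list (pair_rows (re_cov e) (im_cov e) [0..<n]) x"
proof -
  let ?F = "{S. S \<subseteq> {..<n} - K \<and> card S = m}"
  let ?V = "wedge_list (pair_rows (re_cov e) (im_cov e) [0..<n]) x"
  let ?c = "(- 1) ^ (card K choose 2) * (if b then - 2 * \<i> else 2 * \<i>) ^ card K * ?V"
  have finK: "finite K" using K(1) finite_subset by blast
  have cc: "card ({..<n} - K) = 2 * m" using K by (simp add: card_Diff_subset finK)
  have product: "wedge_list (mixed_rows e b K S @ mixed_rows e b' K S') x =
      (if S' = {..<n} - K - S then ?c else 0)" if S: "S \<in> ?F" "S' \<in> ?F" for S S'
  proof -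
    have fin: "finite S" "finite S'"
      using S finite_subset[of S "{..<n} - K"] finite_subset[of S' "{..<n} - K"] by auto
    show ?thesis
    proof (cases "S \<inter> S' = {}")
      case True
      then have S': "S' = {..<n} - K - S"
        by (intro card_subset_eq) (use S fin cc card_Diff_subset[of S "{..<n} - K"] in auto)
      have rows: "mixed_rows e b' K S' = mixed_rows e (\<not> b) K S'"
        using b by (auto simp: mixed_rows_def)
      have vol: "wedge_list (map (holo_cov e b) (sorted_list_of_set K) @
          pair_rows (re_cov e) (im_cov e) (sorted_list_of_set S) @
          map (holo_cov e (\<not> b)) (sorted_list_of_set K) @
          pair_rows (re_cov e) (im_cov e) (sorted_list_of_set S')) x =
        (- 1) ^ (card K choose 2) *
          (1 * (if \<not> b then \<i> else - \<i>) - (if b then \<i> else - \<i>) * 1) ^ card K * ?V"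
      proof (rule wedge_list_grouped)
        show "K \<union> S' \<union> S = {..<n}" using S' S(1) K(1) by auto
      qed (use finK fin S True in \<open>auto simp: holo_cov_eq\<close>)
      have "1 * (if \<not> b then \<i> else - \<i>) - (if b then \<i> else - \<i>) * 1 = (if b then - 2 * \<i> else 2 * \<i>)"
        by simp
      then have "wedge_list (mixed_rows e b K S @ mixed_rows e b' K S') x = ?c"
        unfolding rows unfolding mixed_rows_def append.assoc vol by (simp only:)
      then show ?thesis using S' by (simp only: simp_thms if_True)
    next
      case False
      then have "S' \<noteq> {..<n} - K - S" by auto
      then show ?thesis
        using False finK fin by (simp add: mixed_rows_zero)
    qed
  qed
  have "wedge n n (mixed_form n e b K m) (mixed_form n e b' K m) x =
      (\<Sum>S\<in>?F. \<Sum>S'\<in>?F. wedge_list (mixed_rows e b K S @ mixed_rows e b' K S') x)"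
    by (rule mixed_form_wedge) (fact K(2))+
  also have "\<dots> = (\<Sum>S\<in>?F. \<Sum>S'\<in>?F. if S' = {..<n} - K - S then ?c else 0)"
    by (rule sum.cong[OF refl], rule sum.cong[OF refl]) (rule product)
  also have "\<dots> = (\<Sum>S\<in>?F. ?c)"
  proof (rule sum.cong[OF refl])
    fix S assume S: "S \<in> ?F"
    have "finite S" using S finite_subset[of S "{..<n} - K"] by blast
    then have "{..<n} - K - S \<in> ?F"
      using S cc card_Diff_subset[of S "{..<n} - K"] by auto
    moreover have "finite ?F" by (rule finite_subset[of _ "Pow {..<n}"]) auto
    ultimately show "(\<Sum>S'\<in>?F. if S' = {..<n} - K - S then ?c else 0) = ?c"
      by (subst sum.delta) simp_all
  qed
  also have "\<dots> = of_nat (2 * m choose m) * ?c"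
    using n_subsets[of "{..<n} - K" m] cc by simp
  finally show ?thesis by (simp add: mult_ac)
qed

end

section \<open>Self-duality\<close>

lemma euclidean_expand: "v = (\<Sum>b\<in>Basis. (b \<bullet> v) *\<^sub>R b)" for v :: "'a::euclidean_space"
  using euclidean_representation[of v] by (simp add: inner_commute)

lemma wedge_covectors_inner_alt_forms: "wedge_covectors (\<lambda>i v. a i \<bullet> v) n \<in> alt_forms n"
  by (rule wedge_covectors_alt_forms) (simp add: linear_iff inner_add_right)

text \<open>Supplies the uniqueness that the description in \<open>hodge_star\<close> requires. To
  read off D at a tuple f of distinct basis vectors, wedge with the covectors of the remaining m
  basis vectors and evaluate at both tuples together: the matrices are block triangular and exactly
  D f is left.\<close>

lemma wedge_nondegenerate:
  fixes D :: "('a::euclidean_space, real) form"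
  assumes D: "D \<in> alt_forms k" and dim: "m + k = DIM('a)"
    and z: "\<And>a. wedge m k (wedge_covectors (\<lambda>i v. a i \<bullet> v) m) D = (\<lambda>x. 0)"
  shows "D = (\<lambda>x. 0)"
proof
  fix x
  let ?E = "{..<k} \<rightarrow>\<^sub>E (Basis :: 'a set)"
  have "D f = 0" if f: "f \<in> ?E" for f
  proof (cases "inj_on f {..<k}")
    case False
    then show ?thesis using alt_formsD(3)[OF D] by (auto simp: inj_on_def)
  next
    case True
    have fB: "f ` {..<k} \<subseteq> Basis" using f by auto
    then have "card ((Basis :: 'a set) - f ` {..<k}) = m"
      using dim True by (simp add: card_Diff_subset card_image)
    then obtain a where a: "bij_betw a {0..<m} (Basis - f ` {..<k})"
      using ex_bij_betw_nat_finite[of "Basis - f ` {..<k}"] by auto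
    have aB: "a i \<in> Basis" "a i \<notin> f ` {..<k}" if "i < m" for i
      using bij_betw_apply[OF a, of i] that by simp_all
    have fB': "f j \<in> Basis" if "j < k" for j using f that by auto
    have aa: "a i \<bullet> a j = (if i = j then 1 else 0)" if "i < m" "j < m" for i j
      using a that aB by (auto simp: inner_Basis bij_betw_def inj_on_def)
    have af: "a i \<bullet> f j = 0" if "i < m" "j < k" for i j
      using aB[OF that(1)] fB'[OF that(2)] that(2) by (auto simp: inner_Basis)
    let ?x = "\<lambda>i. if i < m then a i else f (i - m)"
    have block: "wedge m k (wedge_covectors (\<lambda>i v. a i \<bullet> v) m) (wedge_covectors (\<lambda>i v. g i \<bullet> v) k) ?x =
        wedge_covectors (\<lambda>i v. g i \<bullet> v) k f" for g :: "nat \<Rightarrow> 'a"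
    proof -
      have "mat (m + k) (m + k) (\<lambda>(i, j). (if i < m then (\<lambda>v. a i \<bullet> v) else (\<lambda>v. g (i - m) \<bullet> v)) (?x j)) =
          four_block_mat (1\<^sub>m m) (0\<^sub>m m k) (mat k m (\<lambda>(i, j). g i \<bullet> a j)) (mat k k (\<lambda>(i, j). g i \<bullet> f j))"
        by (rule eq_matI) (auto simp: aa af)
      then show ?thesis
        unfolding wedge_wedge_covectors wedge_covectors_det
        by (simp add: det_four_block_mat_upper_right_zero[of _ m _ k])
    qed
    have D_eq: "D = (\<lambda>x. \<Sum>g\<in>?E. (D g / fact k) * wedge_covectors (\<lambda>i v. g i \<bullet> v) k x)"
      by (rule ext, rule alt_forms_expand_covectors[OF D finite_Basis euclidean_expand])
    have "0 = wedge m k (wedge_covectors (\<lambda>i v. a i \<bullet> v) m) D ?x"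
      using z[of a] by simp
    also have "\<dots> = (\<Sum>g\<in>?E. (D g / fact k) *
        wedge m k (wedge_covectors (\<lambda>i v. a i \<bullet> v) m) (wedge_covectors (\<lambda>i v. g i \<bullet> v) k) ?x)"
      by (subst D_eq) (simp only: wedge_sum_right)
    also have "\<dots> = D f"
      unfolding block by (rule alt_forms_expand_covectors[OF D finite_Basis euclidean_expand, symmetric])
    finally show ?thesis ..
  qed
  then have "(\<Sum>f\<in>?E. (\<Prod>i<k. f i \<bullet> x i) *\<^sub>R D (\<lambda>i. f i)) = 0" by simp
  then show "D x = 0"
    using alt_forms_expand[OF D finite_Basis, of x "\<lambda>i b. b \<bullet> x i" "\<lambda>b. b"] euclidean_expand by metis
qed

lemma wedge_diff_right: "wedge k l \<alpha> (\<lambda>x. \<beta> x - \<gamma> x) x = wedge k l \<alpha> \<beta> x - wedge k l \<alpha> \<gamma> x"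
  by (simp add: wedge_def Alt_def tensor_def algebra_simps sum_subtractf)

lemma wedge_add_right: "wedge k l \<alpha> (\<lambda>x. \<beta> x + \<gamma> x) x = wedge k l \<alpha> \<beta> x + wedge k l \<alpha> \<gamma> x"
  by (simp add: wedge_def Alt_def tensor_def algebra_simps sum.distrib)

lemma wedge_add_left: "wedge k l (\<lambda>x. \<beta> x + \<gamma> x) \<alpha> x = wedge k l \<beta> \<alpha> x + wedge k l \<gamma> \<alpha> x"
  by (simp add: wedge_def Alt_def tensor_def algebra_simps sum.distrib)

text \<open>
  It suffices to test the defining equation of the Hodge star on simple covectors, where the
  inner product with \<mu> is evaluation of \<mu>.
\<close>

lemma hodge_star_eqI:
  fixes \<mu> \<nu> :: "('a::euclidean_space, real) form"
  assumes \<nu>: "\<nu> \<in> alt_forms (DIM('a) - m)" and m: "m \<le> DIM('a)"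
    and w: "\<And>a x. wedge m (DIM('a) - m) (wedge_covectors (\<lambda>i v. a i \<bullet> v) m) \<nu> x = \<mu> a * vol x"
  shows "hodge_star vol m \<mu> = \<nu>"
  unfolding hodge_star_def
proof (rule the_equality)
  let ?k = "DIM('a) - m" and ?E = "{..<m} \<rightarrow>\<^sub>E (Basis :: 'a set)"
  have dual: "wedge m ?k \<alpha> \<nu> = (\<lambda>x. form_inner m \<alpha> \<mu> * vol x)" if \<alpha>: "\<alpha> \<in> alt_forms m" for \<alpha>
  proof -
    have \<alpha>_eq: "\<alpha> = (\<lambda>x. \<Sum>e\<in>?E. (\<alpha> e / fact m) * wedge_covectors (\<lambda>i v. e i \<bullet> v) m x)"
      by (rule ext, rule alt_forms_expand_covectors[OF \<alpha> finite_Basis euclidean_expand])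
    have "wedge m ?k \<alpha> \<nu> = (\<lambda>x. \<Sum>e\<in>?E. (\<alpha> e / fact m) * (\<mu> e * vol x))"
      by (subst \<alpha>_eq) (simp only: wedge_sum_left w)
    then show ?thesis
      by (simp add: form_inner_def sum_distrib_left sum_distrib_right mult_ac)
  qed
  then show "\<nu> \<in> alt_forms ?k \<and> (\<forall>\<alpha>\<in>alt_forms m. wedge m ?k \<alpha> \<nu> = (\<lambda>x. form_inner m \<alpha> \<mu> * vol x))"
    using \<nu> by blast
  fix \<nu>' assume \<nu>': "\<nu>' \<in> alt_forms ?k \<and> (\<forall>\<alpha>\<in>alt_forms m. wedge m ?k \<alpha> \<nu>' = (\<lambda>x. form_inner m \<alpha> \<mu> * vol x))"
  have "(\<lambda>x. \<nu>' x - \<nu> x) = (\<lambda>x. 0)"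
  proof (rule wedge_nondegenerate)
    show "(\<lambda>x. \<nu>' x - \<nu> x) \<in> alt_forms ?k"
      using alt_forms_add[OF conjunct1[OF \<nu>'] alt_forms_mult[OF \<nu>, of "-1"]] by simp
    show "m + ?k = DIM('a)" using m by simp
    show "wedge m ?k (wedge_covectors (\<lambda>i v. a i \<bullet> v) m) (\<lambda>x. \<nu>' x - \<nu> x) = (\<lambda>x. 0)" for a
      using \<nu>' dual[OF wedge_covectors_inner_alt_forms, of a]
        wedge_covectors_inner_alt_forms[of a m] by (simp add: fun_eq_iff wedge_diff_right)
  qed
  then show "\<nu>' = \<nu>" by (simp add: fun_eq_iff)
qed

text \<open>Self-duality tested on simple covectors only. The condition is additive, so the summands
  of the calibration can be checked in different frames.\<close>

definition self_dual_form :: "nat \<Rightarrow> ('a::real_inner, real) form \<Rightarrow> ('a, real) form \<Rightarrow> bool" where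
  "self_dual_form n vol \<mu> \<longleftrightarrow> \<mu> \<in> alt_forms n \<and>
    (\<forall>a x. wedge n n (wedge_covectors (\<lambda>i v. a i \<bullet> v) n) \<mu> x = \<mu> a * vol x)"

lemma self_dual_form_add:
  "self_dual_form n vol \<mu> \<Longrightarrow> self_dual_form n vol \<nu> \<Longrightarrow> self_dual_form n vol (\<lambda>x. \<mu> x + \<nu> x)"
  by (simp add: self_dual_form_def alt_forms_add wedge_add_right distrib_right)

lemma hodge_star_self_dual:
  fixes \<mu> :: "('a::euclidean_space, real) form"
  assumes "self_dual_form n vol \<mu>" "DIM('a) = 2 * n"
  shows "hodge_star vol n \<mu> = \<mu>"
  by (rule hodge_star_eqI) (use assms in \<open>auto simp: self_dual_form_def\<close>)

lemma of_real_wedge_covectors: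
  "complex_of_real (wedge_covectors Z n x) = wedge_covectors (\<lambda>i v. complex_of_real (Z i v)) n x"
  by (simp add: wedge_covectors_eq)

lemma linear_Re: "linear Re" and linear_Im: "linear Im"
  by (simp_all add: linear_iff)

context hermitian_space
begin

text \<open>The volume and the covectors of a are real, so taking real parts commutes with both
  sides of \<open>mixed_form_dual\<close>.\<close>

lemma self_dual_mixed_form:
  assumes e: "frame n e" and K: "K \<subseteq> {..<n}" "card K + 2 * m = n"
    and unit: "(- 1) ^ (card K choose 2) * \<i> ^ card K = 1"
    and vol: "\<And>x. complex_of_real (vol x) = wedge_list (pair_rows (re_cov e) (im_cov e) [0..<n]) x"
  shows "self_dual_form n vol (\<lambda>x. Re (mixed_form n e True K m x))"
  unfolding self_dual_form_def
proof (intro conjI allI)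
  show "(\<lambda>x. Re (mixed_form n e True K m x)) \<in> alt_forms n"
    using alt_forms_linear[OF linear_Re mixed_form_alt_forms[of n e True K m]] K by simp
  fix a x
  have "wedge n n (wedge_covectors (\<lambda>i v. a i \<bullet> v) n) (\<lambda>x. Re (mixed_form n e True K m x)) x =
      Re (wedge n n (wedge_covectors (\<lambda>i v. of_real (a i \<bullet> v)) n) (mixed_form n e True K m) x)"
    by (simp add: wedge_Re_right[symmetric] of_real_wedge_covectors)
  also have "\<dots> = Re (mixed_form n e True K m a) * vol x"
    by (subst mixed_form_dual[OF e K]) (use unit in \<open>simp_all flip: vol\<close>)
  finally show "wedge n n (wedge_covectors (\<lambda>i v. a i \<bullet> v) n) (\<lambda>x. Re (mixed_form n e True K m x)) x =
      Re (mixed_form n e True K m a) * vol x" .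
qed

lemma mixed_form_top: "mixed_form n e True {..<n} 0 = wedge_covectors (\<lambda>i. H (e i)) n"
proof
  fix x
  have "{S. S \<subseteq> {..<n} - {..<n} \<and> card S = 0} = {{}}" by auto
  then have "mixed_form n e True {..<n} 0 x = wedge_list (map (holo_cov e True) [0..<n]) x"
    by (simp add: mixed_form_def mixed_rows_def lessThan_atLeast0)
  also have "\<dots> = wedge_covectors (\<lambda>i. H (e i)) n x"
    unfolding wedge_covectors_eq_list by (rule wedge_list_cong) (simp_all add: holo_cov_def)
  finally show "mixed_form n e True {..<n} 0 x = wedge_covectors (\<lambda>i. H (e i)) n x" .
qed

lemma mixed_form_wedge_holo:
  assumes K: "K \<subseteq> {..<n}"
  shows "wedge (card K) (2 * m) (wedge_list (map (holo_cov e b) (sorted_list_of_set K))) (mixed_form n e b' {} m) x =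
    mixed_form n e b K m x"
proof -
  let ?F = "{S. S \<subseteq> {..<n} \<and> card S = m}"
  have finK: "finite K" using K finite_subset by blast
  have fin: "finite S" if "S \<in> ?F" for S using that finite_subset[of S "{..<n}"] by blast
  have "wedge (card K) (2 * m) (wedge_list (map (holo_cov e b) (sorted_list_of_set K))) (mixed_form n e b' {} m) x =
      (\<Sum>S\<in>?F. wedge (card K) (2 * m) (wedge_list (map (holo_cov e b) (sorted_list_of_set K)))
        (wedge_list (mixed_rows e b' {} S)) x)"
    using wedge_sum_right[of "card K" "2 * m" _ "\<lambda>S. 1" "\<lambda>S. wedge_list (mixed_rows e b' {} S)" ?F]
    by (simp add: mixed_form_def[abs_def])
  also have "\<dots> = (\<Sum>S\<in>?F. wedge_list (mixed_rows e b K S) x)"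
  proof (rule sum.cong[OF refl])
    fix S assume "S \<in> ?F"
    then show "wedge (card K) (2 * m) (wedge_list (map (holo_cov e b) (sorted_list_of_set K)))
        (wedge_list (mixed_rows e b' {} S)) x = wedge_list (mixed_rows e b K S) x"
      by (subst wedge_wedge_list) (simp_all add: mixed_rows_def)
  qed
  also have "\<dots> = (\<Sum>S | S \<subseteq> {..<n} - K \<and> card S = m. wedge_list (mixed_rows e b K S) x)"
  proof (rule sum.mono_neutral_right)
    show "finite ?F" by (rule finite_subset[of _ "Pow {..<n}"]) auto
    show "\<forall>S\<in>?F - {S. S \<subseteq> {..<n} - K \<and> card S = m}. wedge_list (mixed_rows e b K S) x = 0"
    proof
      fix S assume S: "S \<in> ?F - {S. S \<subseteq> {..<n} - K \<and> card S = m}"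
      have "mixed_rows e b K S = mixed_rows e b K {} @ mixed_rows e b {} S" by (simp add: mixed_rows_def)
      moreover have "finite S" "S \<inter> K \<noteq> {}" using S fin by blast+
      then have "wedge_list (mixed_rows e b K {} @ mixed_rows e b {} S) x = 0"
        by (intro mixed_rows_zero finK finite.emptyI disjI2 disjI1)
      ultimately show "wedge_list (mixed_rows e b K S) x = 0" by simp
    qed
  qed auto
  finally show ?thesis by (simp add: mixed_form_def)
qed

lemma mixed_form_cnj: "cnj (mixed_form n e b K m x) = mixed_form n e (\<not> b) K m x"
proof -
  have "cnj (wedge_list (mixed_rows e b K S) x) = wedge_list (mixed_rows e (\<not> b) K S) x" for S
  proof -
    have nth: "cnj ((mixed_rows e b K S ! i) v) = (mixed_rows e (\<not> b) K S ! i) v"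
      if "i < length (mixed_rows e b K S)" for i v
    proof -
      have "map (\<lambda>f. cnj (f v)) (mixed_rows e b K S) = map (\<lambda>f. f v) (mixed_rows e (\<not> b) K S)"
        by (auto simp: mixed_rows_def pair_rows_def map_concat o_def holo_cov_def re_cov_def im_cov_def)
      from arg_cong[OF this, of "\<lambda>l. l ! i"] show ?thesis using that by simp
    qed
    have "card K + 2 * card S = length (mixed_rows e b K S)" by simp
    then show ?thesis
      unfolding wedge_list_def wedge_covectors_eq by (simp add: nth cnj_sum cnj_prod)
  qed
  then show ?thesis by (simp add: mixed_form_def)
qed

end

section \<open>Minors of a coisometry\<close>

text \<open>Linear in the first argument, unlike H. Vectors are functions of the index, so that they
  serve at the same time as rows of a \<open>wedge_list\<close> evaluated at the index sequence
  \<open>id\<close>.\<close>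

definition cip :: "nat \<Rightarrow> (nat \<Rightarrow> complex) \<Rightarrow> (nat \<Rightarrow> complex) \<Rightarrow> complex" where
  "cip m p q = (\<Sum>a<m. p a * cnj (q a))"

lemma cip_cnj: "cnj (cip m p q) = cip m q p"
  by (simp add: cip_def mult.commute)

lemma cip_self: "cip m p p = of_real (\<Sum>a<m. (cmod (p a))\<^sup>2)"
  by (simp add: cip_def complex_norm_square[symmetric])

lemma cip_nonneg: "Re (cip m p p) \<ge> 0"
  by (simp add: cip_self sum_nonneg)

lemma cip_self_zero: "Re (cip m p p) = 0 \<Longrightarrow> a < m \<Longrightarrow> p a = 0"
  by (auto simp: cip_self sum_nonneg_eq_0_iff)

lemma cip_combination:
  "cip m (\<lambda>a. x * p a + y * q a) r = x * cip m p r + y * cip m q r"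
  "cip m r (\<lambda>a. x * p a + y * q a) = cnj x * cip m r p + cnj y * cip m r q"
  by (simp_all add: cip_def sum.distrib sum_distrib_left algebra_simps)

lemma cip_scale: "cip m (\<lambda>a. x * p a) r = x * cip m p r" "cip m r (\<lambda>a. x * p a) = cnj x * cip m r p"
  by (simp_all add: cip_def sum_distrib_left algebra_simps)

text \<open>
  With R = sum of Q_i Q_i*, the left-hand side is (tr R)^2 and the double sum is tr R^2.
\<close>

lemma frame_potential:
  "(\<Sum>i\<in>I. Re (cip m (Q i) (Q i)))\<^sup>2 \<le> real m * (\<Sum>i\<in>I. \<Sum>j\<in>I. (cmod (cip m (Q i) (Q j)))\<^sup>2)"
proof -
  define R where "R a b = (\<Sum>i\<in>I. Q i a * cnj (Q i b))" for a b
  let ?g = "\<lambda>a b i j. (Q i a * cnj (Q j a)) * cnj (Q i b * cnj (Q j b))"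
  have RR: "of_real ((cmod (R a b))\<^sup>2) = (\<Sum>i\<in>I. \<Sum>j\<in>I. ?g a b i j)" for a b
    unfolding complex_norm_square R_def cnj_sum sum_product by (intro sum.cong refl) simp
  have "of_real (\<Sum>a<m. \<Sum>b<m. (cmod (R a b))\<^sup>2) =
      (\<Sum>a<m. \<Sum>b<m. \<Sum>i\<in>I. \<Sum>j\<in>I. ?g a b i j)"
    by (simp only: of_real_sum RR)
  also have "\<dots> = (\<Sum>a<m. \<Sum>i\<in>I. \<Sum>j\<in>I. \<Sum>b<m. ?g a b i j)"
  proof (rule sum.cong[OF refl])
    fix a
    have "(\<Sum>b<m. \<Sum>i\<in>I. \<Sum>j\<in>I. ?g a b i j) =
      (\<Sum>i\<in>I. \<Sum>b<m. \<Sum>j\<in>I. ?g a b i j)" by (rule sum.swap)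
    also have "\<dots> = (\<Sum>i\<in>I. \<Sum>j\<in>I. \<Sum>b<m. ?g a b i j)"
      by (rule sum.cong[OF refl], rule sum.swap)
    finally show "(\<Sum>b<m. \<Sum>i\<in>I. \<Sum>j\<in>I. ?g a b i j) =
      (\<Sum>i\<in>I. \<Sum>j\<in>I. \<Sum>b<m. ?g a b i j)" .
  qed
  also have "\<dots> = (\<Sum>i\<in>I. \<Sum>a<m. \<Sum>j\<in>I. \<Sum>b<m. ?g a b i j)"
    by (rule sum.swap)
  also have "\<dots> = (\<Sum>i\<in>I. \<Sum>j\<in>I. \<Sum>a<m. \<Sum>b<m. ?g a b i j)"
    by (rule sum.cong[OF refl], rule sum.swap)
  also have "\<dots> = (\<Sum>i\<in>I. \<Sum>j\<in>I. of_real ((cmod (cip m (Q i) (Q j)))\<^sup>2))"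
    unfolding complex_norm_square cip_def cnj_sum sum_product by simp
  finally have "of_real (\<Sum>a<m. \<Sum>b<m. (cmod (R a b))\<^sup>2) =
      (of_real (\<Sum>i\<in>I. \<Sum>j\<in>I. (cmod (cip m (Q i) (Q j)))\<^sup>2) :: complex)" by simp
  then have eq: "(\<Sum>a<m. \<Sum>b<m. (cmod (R a b))\<^sup>2) = (\<Sum>i\<in>I. \<Sum>j\<in>I. (cmod (cip m (Q i) (Q j)))\<^sup>2)"
    by (simp only: of_real_eq_iff)
  have "(\<Sum>i\<in>I. Re (cip m (Q i) (Q i))) = (\<Sum>a<m. Re (R a a))"
    unfolding cip_def R_def Re_sum by (rule sum.swap)
  \<comment> \<open>The trace is bounded by Cauchy-Schwarz against the constant vector 1, and the
    diagonal of R by its full Hilbert-Schmidt norm.\<close>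
  also have "(\<Sum>a<m. Re (R a a))\<^sup>2 \<le> (\<Sum>a<m. (1 :: real)\<^sup>2) * (\<Sum>a<m. (Re (R a a))\<^sup>2)"
    using Cauchy_Schwarz_ineq_sum[of "\<lambda>_. 1" "\<lambda>a. Re (R a a)" "{..<m}"] by simp
  also have "\<dots> \<le> real m * (\<Sum>a<m. \<Sum>b<m. (cmod (R a b))\<^sup>2)"
  proof -
    have "(Re (R a a))\<^sup>2 \<le> (\<Sum>b<m. (cmod (R a b))\<^sup>2)" if "a < m" for a
    proof -
      have "(Re (R a a))\<^sup>2 \<le> (cmod (R a a))\<^sup>2" by (simp add: cmod_power2)
      also have "\<dots> \<le> (\<Sum>b<m. (cmod (R a b))\<^sup>2)" by (rule member_le_sum) (use that in auto)
      finally show ?thesis .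
    qed
    then show ?thesis by (auto intro!: mult_left_mono sum_mono)
  qed
  finally show ?thesis by (simp add: eq)
qed

text \<open>The row operations used here have determinant 1.\<close>

lemma balance_pair:
  fixes p q :: "nat \<Rightarrow> complex"
  assumes z: "\<And>a. a \<ge> m \<Longrightarrow> p a = 0" "\<And>a. a \<ge> m \<Longrightarrow> q a = 0"
  shows "\<exists>p' q' d. d \<ge> 0 \<and> cip m p' p' = of_real d \<and> cip m q' q' = of_real d \<and> cip m p' q' = 0 \<and>
    2 * d \<le> Re (cip m p p) + Re (cip m q q) \<and>
    (\<forall>as cs x. wedge_list (as @ p # q # cs) x = wedge_list (as @ p' # q' # cs) x)"
proof -
  \<comment> \<open>A dependent pair annihilates every wedge product containing it and is replaced
    by two zero vectors with d = 0.\<close>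
  have dep: ?thesis if "\<And>as cs x. wedge_list (as @ p # q # cs) x = 0"
  proof -
    have "wedge_list (as @ (\<lambda>_. 0) # (\<lambda>_. 0) # cs) x = 0"
      for as cs :: "(nat \<Rightarrow> complex) list" and x
      using wedge_list_pair_change[of "\<lambda>_. 0" 0 "\<lambda>_. 0" 0 "\<lambda>_. 0" "\<lambda>_. 0" 0 0] by simp
    then show ?thesis
      using that cip_nonneg[of m p] cip_nonneg[of m q]
      by (intro exI[of _ "\<lambda>_. 0"] exI[of _ "0 :: real"]) (simp add: cip_def)
  qed
  define P where "P = Re (cip m p p)"
  have P: "cip m p p = of_real P" by (simp add: P_def cip_self)
  show ?thesis
  proof (cases "P = 0")
    case True
    then have "p a = 0" for a
      using cip_self_zero[of m p a] z(1)[of a] by (cases "a < m") (auto simp: P_def)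
    then have "wedge_list (as @ p # q # cs) x = 0" for as cs x
      using wedge_list_pair_change[of p 0 p 0 q q 0 1] by simp
    then show ?thesis by (rule dep)
  next
    case False
    then have P0: "P > 0" using cip_nonneg[of m p] by (simp add: P_def)
    \<comment> \<open>Gram-Schmidt: r is the part of q orthogonal to p.\<close>
    define t where "t = cip m q p / P"
    define r where "r a = (- t) * p a + 1 * q a" for a
    define R where "R = Re (cip m r r)"
    have R: "cip m r r = of_real R" by (simp add: R_def cip_self)
    have q: "q a = t * p a + 1 * r a" for a by (simp add: r_def)
    have rp: "cip m r p = 0"
      unfolding r_def[abs_def] cip_combination P t_def using P0 by simp
    then have pr: "cip m p r = 0" using cip_cnj[of m r p] by simp
    have "cip m q q = t * cnj t * P + R"
      unfolding q[abs_def] cip_combination by (simp add: rp pr P R)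
    then have "Re (cip m q q) = (cmod t)\<^sup>2 * P + R"
      by (simp add: complex_norm_square[symmetric] flip: of_real_power of_real_mult)
    then have Q: "Re (cip m q q) \<ge> R" using P0 by simp
    show ?thesis
    proof (cases "R = 0")
      case True
      then have "r a = 0" for a
        using cip_self_zero[of m r a] z[of a] by (cases "a < m") (auto simp: R_def r_def)
      then have "wedge_list (as @ p # q # cs) x = 0" for as cs x
        using wedge_list_pair_change[of p 1 p 0 q q t 0] q by simp
      then show ?thesis by (rule dep)
    next
      case False
      then have R0: "R > 0" using cip_nonneg[of m r] by (simp add: R_def)
      \<comment> \<open>Scaling p by l and r by 1 / l keeps the determinant. With l the fourth root
        of R / P both squared lengths become sqrt (P R), which the arithmetic-geometric mean
        inequality then compares with P + R.\<close>
      define l where "l = sqrt (sqrt R / sqrt P)"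
      have l: "l > 0" "l * l = sqrt R / sqrt P" using P0 R0 by (simp_all add: l_def)
      have sP: "sqrt P > 0" "sqrt P * sqrt P = P" and sR: "sqrt R > 0" "sqrt R * sqrt R = R"
        using P0 R0 by simp_all
      let ?d = "sqrt P * sqrt R"
      have 1: "cip m (\<lambda>a. of_real l * p a) (\<lambda>a. of_real l * p a) = of_real ?d"
      proof -
        have "l * (l * P) = ?d"
          using l(2) sP by (metis mult.assoc mult.commute nonzero_mult_div_cancel_left order_less_irrefl times_divide_eq_left)
        then show ?thesis by (simp add: cip_scale P flip: of_real_mult)
      qed
      have 2: "cip m (\<lambda>a. of_real (1 / l) * r a) (\<lambda>a. of_real (1 / l) * r a) = of_real ?d"
      proof -
        have "1 / l * (1 / l * R) = R / (l * l)" by simp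
        also have "\<dots> = ?d" unfolding l(2) using sP sR by (simp add: field_simps)
        finally show ?thesis
          unfolding cip_scale R complex_cnj_complex_of_real of_real_mult[symmetric] by (simp only:)
      qed
      have 3: "cip m (\<lambda>a. of_real l * p a) (\<lambda>a. of_real (1 / l) * r a) = 0"
        by (simp only: cip_scale pr) simp
      have "2 * ?d \<le> P + R"
        using sum_squares_bound[of "sqrt P" "sqrt R"] P0 R0 by simp
      then have 4: "2 * ?d \<le> Re (cip m p p) + Re (cip m q q)" using Q by (simp add: P_def)
      have 5: "wedge_list (as @ p # q # cs) x =
          wedge_list (as @ (\<lambda>a. of_real l * p a) # (\<lambda>a. of_real (1 / l) * r a) # cs) x" for as cs x
      proof -
        have "wedge_list (as @ p # q # cs) x = (of_real (1 / l) * of_real l - 0 * (t * of_real (1 / l))) *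
            wedge_list (as @ (\<lambda>a. of_real l * p a) # (\<lambda>a. of_real (1 / l) * r a) # cs) x"
          by (rule wedge_list_pair_change) (use l(1) q in simp_all)
        then show ?thesis using l(1) by simp
      qed
      show ?thesis
        by (intro exI[of _ "\<lambda>a. of_real l * p a"] exI[of _ "\<lambda>a. of_real (1 / l) * r a"] exI[of _ ?d])
          (use 1 2 3 4 5 P0 R0 in simp)
    qed
  qed
qed

lemma det_mat_4:
  fixes M :: "nat \<Rightarrow> nat \<Rightarrow> 'a::comm_ring_1"
  shows "det (mat 4 4 (\<lambda>(i, j). M i j)) =
    M 0 0 * (M 1 1 * (M 2 2 * M 3 3 - M 2 3 * M 3 2) - M 1 2 * (M 2 1 * M 3 3 - M 2 3 * M 3 1) + M 1 3 * (M 2 1 * M 3 2 - M 2 2 * M 3 1)) -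
    M 0 1 * (M 1 0 * (M 2 2 * M 3 3 - M 2 3 * M 3 2) - M 1 2 * (M 2 0 * M 3 3 - M 2 3 * M 3 0) + M 1 3 * (M 2 0 * M 3 2 - M 2 2 * M 3 0)) +
    M 0 2 * (M 1 0 * (M 2 1 * M 3 3 - M 2 3 * M 3 1) - M 1 1 * (M 2 0 * M 3 3 - M 2 3 * M 3 0) + M 1 3 * (M 2 0 * M 3 1 - M 2 1 * M 3 0)) -
    M 0 3 * (M 1 0 * (M 2 1 * M 3 2 - M 2 2 * M 3 1) - M 1 1 * (M 2 0 * M 3 2 - M 2 2 * M 3 0) + M 1 2 * (M 2 0 * M 3 1 - M 2 1 * M 3 0))"
proof -
  have 4: "(4 :: nat) = Suc (Suc (Suc (Suc 0)))" "(3 :: nat) = Suc (Suc (Suc 0))" "(2 :: nat) = Suc (Suc 0)"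
    "(1 :: nat) = Suc 0" by simp_all
  show ?thesis unfolding 4 by (simp add: det_mat_Suc algebra_simps)
qed

lemma wedge_list_gram:
  assumes "length ps = m"
  shows "wedge_list ps id * cnj (wedge_list ps id) = det (mat m m (\<lambda>(i, j). cip m (ps ! i) (ps ! j)))"
proof -
  let ?M = "mat m m (\<lambda>(i, j). (ps ! i) j)"
  interpret comm_ring_hom cnj by unfold_locales auto
  have "mat m m (\<lambda>(i, j). cip m (ps ! i) (ps ! j)) = ?M * transpose_mat (map_mat cnj ?M)"
    by (rule eq_matI) (simp_all add: cip_def scalar_prod_def atLeast0LessThan)
  then have "det (mat m m (\<lambda>(i, j). cip m (ps ! i) (ps ! j))) = det ?M * det (transpose_mat (map_mat cnj ?M))"
    by (simp only:) (rule det_mult[of _ m], simp_all)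
  also have "det (transpose_mat (map_mat cnj ?M)) = det (map_mat cnj ?M)"
    by (rule det_transpose[of _ m]) simp
  also have "det (map_mat cnj ?M) = cnj (det ?M)" by (rule hom_det)
  finally show ?thesis by (simp add: wedge_list_def wedge_covectors_det assms)
qed

text \<open>Bessel's inequality for two orthogonal vectors of common squared length d'. The vector v
  in the proof is d' times the residual of p, so its coefficients contain no quotient.\<close>

lemma bessel_pair:
  assumes r: "cip m r r = of_real d'" "cip m s s = of_real d'" "cip m r s = 0" and p: "cip m p p = of_real d"
    and d: "d \<ge> 0" "d' \<ge> 0"
  shows "(cmod (cip m p r))\<^sup>2 + (cmod (cip m p s))\<^sup>2 \<le> d * d'"
proof (cases "d' = 0")
  case True
  then have "r a = 0" "s a = 0" if "a < m" for a
    using cip_self_zero[of m r a] cip_self_zero[of m s a] r that by simp_all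
  then have "cip m p r = 0" "cip m p s = 0" by (simp_all add: cip_def)
  then show ?thesis using d True by simp
next
  case False
  let ?x = "cip m p r" and ?y = "cip m p s"
  define v where "v a = of_real d' * p a + 1 * ((- ?x) * r a + (- ?y) * s a)" for a
  have s': "cip m s r = 0" "cip m r p = cnj ?x" "cip m s p = cnj ?y"
    using cip_cnj[of m r s] r(3) by (simp_all add: cip_cnj)
  have "cip m v v = of_real d' * of_real d' * of_real d - of_real d' * (?x * cnj ?x + ?y * cnj ?y)"
    unfolding v_def[abs_def] cip_combination by (simp add: r s' p) (simp add: algebra_simps)
  also have "\<dots> = of_real (d' * (d * d' - ((cmod ?x)\<^sup>2 + (cmod ?y)\<^sup>2)))"
    by (simp add: complex_norm_square[symmetric] algebra_simps)
  finally have "d' * (d * d' - ((cmod ?x)\<^sup>2 + (cmod ?y)\<^sup>2)) \<ge> 0"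
    using cip_nonneg[of m v] by simp
  then show ?thesis using False d by (simp add: zero_le_mult_iff)
qed

text \<open>The Gram matrix has diagonal blocks d and d' times the identity and an off-diagonal
  block X with entries x, y, z, w, so its determinant is (d d')^2 - d d' |X|^2 + |det X|^2 with the
  Frobenius norm. Since |det X| \<le> |X|^2 / 2, this is at most the square of d d' - |X|^2 / 2.
  Bessel's inequality makes that number nonnegative, as needed for taking roots.\<close>

lemma balanced_minor_bound:
  assumes p: "cip 4 p p = of_real d" "cip 4 q q = of_real d" "cip 4 p q = 0"
    and r: "cip 4 r r = of_real d'" "cip 4 s s = of_real d'" "cip 4 r s = 0"
    and d: "d \<ge> 0" "d' \<ge> 0"
  shows "cmod (wedge_list [p, q, r, s] id) \<le> d * d' -
    ((cmod (cip 4 p r))\<^sup>2 + (cmod (cip 4 p s))\<^sup>2 + (cmod (cip 4 q r))\<^sup>2 + (cmod (cip 4 q s))\<^sup>2) / 2"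
proof -
  define x y z w where "x = cip 4 p r" and "y = cip 4 p s" and "z = cip 4 q r" and "w = cip 4 q s"
  let ?W = "wedge_list [p, q, r, s] id"
  let ?t = "(cmod x)\<^sup>2 + (cmod y)\<^sup>2 + (cmod z)\<^sup>2 + (cmod w)\<^sup>2"
  have sym: "cip 4 q p = 0" "cip 4 s r = 0" "cip 4 r p = cnj x" "cip 4 s p = cnj y" "cip 4 r q = cnj z" "cip 4 s q = cnj w"
    using cip_cnj[of 4 p q] cip_cnj[of 4 r s] p(3) r(3) by (simp_all add: cip_cnj x_def y_def z_def w_def)
  have "?W * cnj ?W = det (mat 4 4 (\<lambda>(i, j). cip 4 ([p, q, r, s] ! i) ([p, q, r, s] ! j)))"
    by (rule wedge_list_gram) simp
  also have "\<dots> = of_real d * of_real d * of_real d' * of_real d' -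
      of_real d * of_real d' * (x * cnj x + y * cnj y + z * cnj z + w * cnj w) + (x * w - y * z) * cnj (x * w - y * z)"
    unfolding det_mat_4
    by (simp add: p r sym flip: x_def y_def z_def w_def) (simp add: algebra_simps)
  also have "\<dots> = of_real (d * d * d' * d' - d * d' * ?t + (cmod (x * w - y * z))\<^sup>2)"
    unfolding complex_norm_square[symmetric] by simp
  finally have W: "(cmod ?W)\<^sup>2 = d * d * d' * d' - d * d' * ?t + (cmod (x * w - y * z))\<^sup>2"
    unfolding complex_norm_square[symmetric] of_real_eq_iff .
  have "cmod (x * w - y * z) \<le> cmod x * cmod w + cmod y * cmod z"
    using norm_triangle_ineq4[of "x * w" "y * z"] by (simp add: norm_mult)
  also have "\<dots> \<le> ?t / 2"
    using sum_squares_bound[of "cmod x" "cmod w"] sum_squares_bound[of "cmod y" "cmod z"] by simp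
  finally have "(cmod (x * w - y * z))\<^sup>2 \<le> (?t / 2)\<^sup>2" by (rule power_mono) simp
  then have "(cmod ?W)\<^sup>2 \<le> (d * d' - ?t / 2)\<^sup>2"
    unfolding W by (simp add: power2_eq_square algebra_simps)
  moreover have "d * d' - ?t / 2 \<ge> 0"
    using bessel_pair[OF r p(1) d] bessel_pair[OF r p(2) d] by (simp add: x_def y_def z_def w_def)
  ultimately have "cmod ?W \<le> d * d' - ?t / 2" by (rule power2_le_imp_le)
  then show ?thesis by (simp add: x_def y_def z_def w_def add.assoc)
qed

lemma sum_lessThan_4: "sum f {..<4} = f 0 + f 1 + f 2 + f (3 :: nat)"
  by (simp add: eval_nat_numeral)

text \<open>Let s be the sum of the d k. By the minor bounds, 4 times the sum of the A is at most 2
  s^2 - 2 (sum of d_k^2) - 2 (sum of t_kl over k < l). The frame potential gives s^2 \<le> sum of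
  all t_kl, whose diagonal part is 2 (sum of d_k^2). Substituting leaves s^2, and s \<le> 2 by
  \<open>tr\<close>.\<close>

lemma minor_sum_bound:
  fixes p q :: "nat \<Rightarrow> nat \<Rightarrow> complex"
  assumes z: "\<And>k a. a \<ge> 4 \<Longrightarrow> p k a = 0" "\<And>k a. a \<ge> 4 \<Longrightarrow> q k a = 0"
    and tr: "(\<Sum>k<4. Re (cip 4 (p k) (p k)) + Re (cip 4 (q k) (q k))) = 4"
  defines "A \<equiv> \<lambda>k l. cmod (wedge_list [p k, q k, p l, q l] id)"
  shows "A 0 1 + A 0 2 + A 0 3 + A 1 2 + A 1 3 + A 2 3 \<le> 1"
proof -
  have "\<forall>k. \<exists>p' q' d. d \<ge> 0 \<and> cip 4 p' p' = of_real d \<and> cip 4 q' q' = of_real d \<and> cip 4 p' q' = 0 \<and>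
    2 * d \<le> Re (cip 4 (p k) (p k)) + Re (cip 4 (q k) (q k)) \<and>
    (\<forall>as cs x. wedge_list (as @ p k # q k # cs) x = wedge_list (as @ p' # q' # cs) (x :: nat \<Rightarrow> nat))"
    using balance_pair z by blast
  then obtain p' q' d where d: "d k \<ge> 0" and pp: "cip 4 (p' k) (p' k) = of_real (d k)"
    and qq: "cip 4 (q' k) (q' k) = of_real (d k)" and pq: "cip 4 (p' k) (q' k) = 0"
    and le: "2 * d k \<le> Re (cip 4 (p k) (p k)) + Re (cip 4 (q k) (q k))"
    and w: "wedge_list (as @ p k # q k # cs) x = wedge_list (as @ p' k # q' k # cs) x"
    for k :: nat and as cs and x :: "nat \<Rightarrow> nat"
    by metis
  define t where "t k l = (cmod (cip 4 (p' k) (p' l)))\<^sup>2 + (cmod (cip 4 (p' k) (q' l)))\<^sup>2 +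
    (cmod (cip 4 (q' k) (p' l)))\<^sup>2 + (cmod (cip 4 (q' k) (q' l)))\<^sup>2" for k l
  have A: "A k l \<le> d k * d l - t k l / 2" for k l
  proof -
    have "A k l = cmod (wedge_list [p' k, q' k, p' l, q' l] id)"
      using w[of "[]" k "[p l, q l]"] w[of "[p' k, q' k]" l "[]"] by (simp add: A_def)
    then show ?thesis
      using balanced_minor_bound[OF pp qq pq pp qq pq d d, of k l] by (simp add: t_def)
  qed
  have cs: "cmod (cip m r s) = cmod (cip m s r)" for m r s
    by (metis cip_cnj complex_mod_cnj)
  have sym: "t k l = t l k" for k l
    unfolding t_def using cs[of 4 "p' k" "p' l"] cs[of 4 "p' k" "q' l"] cs[of 4 "q' k" "p' l"] cs[of 4 "q' k" "q' l"]
    by simp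
  have diag: "t k k = 2 * (d k)\<^sup>2" for k
    using cs[of 4 "q' k" "p' k"] d by (simp add: t_def pp qq pq)
  define Q where "Q i = (if snd i then p' (fst i) else q' (fst i))" for i :: "nat \<times> bool"
  have I: "sum f ({..<4} \<times> UNIV) = (\<Sum>k<4. f (k, True) + f (k, False))" for f :: "nat \<times> bool \<Rightarrow> real"
  proof -
    have "sum f ({..<4} \<times> UNIV) = (\<Sum>k<4. \<Sum>b\<in>UNIV. f (k, b))"
      by (subst sum.cartesian_product) simp
    then show ?thesis by (simp add: UNIV_bool add.commute)
  qed
  have "(\<Sum>i\<in>{..<4} \<times> UNIV. Re (cip 4 (Q i) (Q i)))\<^sup>2 \<le> real 4 * (\<Sum>i\<in>{..<4} \<times> UNIV. \<Sum>j\<in>{..<4} \<times> UNIV. (cmod (cip 4 (Q i) (Q j)))\<^sup>2)"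
    by (rule frame_potential)
  also have "(\<Sum>i\<in>{..<4} \<times> UNIV. Re (cip 4 (Q i) (Q i))) = 2 * (\<Sum>k<4. d k)"
    unfolding I by (simp add: Q_def pp qq sum_distrib_left)
  also have "(\<Sum>i\<in>{..<4} \<times> UNIV. \<Sum>j\<in>{..<4} \<times> UNIV. (cmod (cip 4 (Q i) (Q j)))\<^sup>2) = (\<Sum>k<4. \<Sum>l<4. t k l)"
    unfolding I by (simp add: Q_def t_def sum.distrib[symmetric] algebra_simps)
  finally have fp: "(\<Sum>k<4. d k)\<^sup>2 \<le> (\<Sum>k<4. \<Sum>l<4. t k l)"
    by (simp add: power_mult_distrib)
  have "2 * (\<Sum>k<4. d k) \<le> 4"
    unfolding tr[symmetric] sum_distrib_left by (intro sum_mono le)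
  then have "(\<Sum>k<4. d k)\<^sup>2 \<le> 2\<^sup>2"
    using d by (intro power_mono) (auto intro: sum_nonneg)
  moreover have "4 * (A 0 1 + A 0 2 + A 0 3 + A 1 2 + A 1 3 + A 2 3) \<le> (\<Sum>k<4. d k)\<^sup>2"
    using fp A[of 0 1] A[of 0 2] A[of 0 3] A[of 1 2] A[of 1 3] A[of 2 3]
      sym[of 1 0] sym[of 2 0] sym[of 3 0] sym[of 2 1] sym[of 3 1] sym[of 3 2]
      diag[of 0] diag[of 1] diag[of 2] diag[of 3]
    unfolding sum_lessThan_4 by (simp add: power2_eq_square algebra_simps)
  ultimately show ?thesis by simp
qed

text \<open>The weights are grouped by the three splittings of the indices into two pairs. Expanding
  the product for one splitting yields the first two terms of the claim and the two weights of that
  splitting, whose sum is therefore at most r. The complementary indexing of B puts both weights of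
  a splitting under the same coefficient, and these coefficients add up to at most 1.\<close>

lemma calibration_bound:
  fixes C S :: "nat \<Rightarrow> real" and A B :: "nat \<Rightarrow> nat \<Rightarrow> real"
  assumes CS: "\<And>k. C k \<ge> 0" "\<And>k. S k \<ge> 0" "\<And>k. (C k)\<^sup>2 + (S k)\<^sup>2 = 1"
    and A: "\<And>k l. A k l \<ge> 0" "A 0 1 + A 0 2 + A 0 3 + A 1 2 + A 1 3 + A 2 3 \<le> 1"
    and B: "B 2 3 = A 0 1" "B 1 3 = A 0 2" "B 1 2 = A 0 3" "B 0 3 = A 1 2" "B 0 2 = A 1 3" "B 0 1 = A 2 3"
  defines "T \<equiv> \<lambda>M. C 0 * C 1 * (S 2 * S 3 * M 2 3) + C 0 * C 2 * (S 1 * S 3 * M 1 3) + C 0 * C 3 * (S 1 * S 2 * M 1 2) +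
    C 1 * C 2 * (S 0 * S 3 * M 0 3) + C 1 * C 3 * (S 0 * S 2 * M 0 2) + C 2 * C 3 * (S 0 * S 1 * M 0 (1 :: nat))"
  shows "S 0 * S 1 * S 2 * S 3 + C 0 * C 1 * C 2 * C 3 + T A + T B \<le> 1"
proof -
  define r where "r = 1 - S 0 * S 1 * S 2 * S 3 - C 0 * C 1 * C 2 * C 3"
  have pair: "C k * C l + S k * S l \<le> 1" for k l
    using sum_squares_bound[of "C k" "C l"] sum_squares_bound[of "S k" "S l"] CS(3)[of k] CS(3)[of l] by linarith
  have y: "C i * C j * (S k * S l) + S i * S j * (C k * C l) \<le> 1 - S i * S j * (S k * S l) - C i * C j * (C k * C l)"
    for i j k l
  proof -
    have "(C i * C j + S i * S j) * (C k * C l + S k * S l) \<le> 1"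
      by (intro mult_le_one pair) (simp add: CS)
    then show ?thesis by (simp add: algebra_simps)
  qed
  have y1: "C 0 * C 1 * (S 2 * S 3) + S 0 * S 1 * (C 2 * C 3) \<le> r"
    using y[of 0 1 2 3] by (simp add: r_def mult_ac)
  have y2: "C 0 * C 2 * (S 1 * S 3) + S 0 * S 2 * (C 1 * C 3) \<le> r"
    using y[of 0 2 1 3] by (simp add: r_def mult_ac)
  have y3: "C 0 * C 3 * (S 1 * S 2) + S 0 * S 3 * (C 1 * C 2) \<le> r"
    using y[of 0 3 1 2] by (simp add: r_def mult_ac)
  have r0: "r \<ge> 0"
    by (rule order_trans[OF _ y1]) (simp add: CS)
  have "T A + T B = (A 0 1 + A 2 3) * (C 0 * C 1 * (S 2 * S 3) + S 0 * S 1 * (C 2 * C 3)) +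
      (A 0 2 + A 1 3) * (C 0 * C 2 * (S 1 * S 3) + S 0 * S 2 * (C 1 * C 3)) +
      (A 0 3 + A 1 2) * (C 0 * C 3 * (S 1 * S 2) + S 0 * S 3 * (C 1 * C 2))"
    unfolding T_def B by (simp add: algebra_simps)
  also have "\<dots> \<le> (A 0 1 + A 2 3) * r + (A 0 2 + A 1 3) * r + (A 0 3 + A 1 2) * r"
    by (intro add_mono mult_left_mono y1 y2 y3) (simp_all add: A)
  also have "\<dots> = (A 0 1 + A 0 2 + A 0 3 + A 1 2 + A 1 3 + A 2 3) * r" by (simp add: algebra_simps)
  also have "\<dots> \<le> r" using mult_right_mono[OF A(2) r0] by simp
  finally show ?thesis by (simp add: r_def)
qed

section \<open>Oriented planes and their skew normal form\<close>

lemma orthonormal_subspace_expand: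
  fixes u :: "nat \<Rightarrow> 'a::euclidean_space"
  assumes V: "subspace V" "dim V = n" and u: "\<And>i. i < n \<Longrightarrow> u i \<in> V"
    and on: "\<And>i j. i < n \<Longrightarrow> j < n \<Longrightarrow> u i \<bullet> u j = (if i = j then 1 else 0)" and v: "v \<in> V"
  shows "v = (\<Sum>i<n. (u i \<bullet> v) *\<^sub>R u i)"
proof -
  let ?B = "u ` {..<n}"
  have inj: "inj_on u {..<n}"
  proof (rule inj_onI)
    fix i j assume ij: "i \<in> {..<n}" "j \<in> {..<n}" "u i = u j"
    then have "u i \<bullet> u j = 1" using on[of i i] by simp
    then show "i = j" using on[of i j] ij by (simp split: if_splits)
  qed
  have orth: "pairwise orthogonal ?B"
    using on by (auto simp: pairwise_def Linear_Algebra.orthogonal_def)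
  have norm1: "norm b = 1" if "b \<in> ?B" for b
    using that on by (auto simp: norm_eq_1)
  have "0 \<notin> ?B" using norm1[of 0] by auto
  then have ind: "independent ?B" by (rule pairwise_orthogonal_independent[OF orth])
  have "?B \<subseteq> V" using u by auto
  moreover have "dim V \<le> card ?B" using V(2) by (simp add: card_image[OF inj])
  ultimately have "V \<subseteq> span ?B" using ind by (intro card_ge_dim_independent) auto
  then have "(\<Sum>b\<in>?B. (v \<bullet> b) *\<^sub>R b) = v"
    using v by (intro orthonormal_basis_expand[OF orth norm1]) auto
  then show ?thesis by (simp add: sum.reindex[OF inj] inner_commute)
qed

lemma orthonormal_pair_exists:
  fixes V :: "'a::euclidean_space set"
  assumes "subspace V" "dim V \<ge> 2"
  shows "\<exists>p\<in>V. \<exists>q\<in>V. norm p = 1 \<and> norm q = 1 \<and> p \<bullet> q = 0"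
proof -
  obtain B where B: "B \<subseteq> V" "pairwise orthogonal B" "\<And>x. x \<in> B \<Longrightarrow> norm x = 1" "card B = dim V" "independent B"
    using orthonormal_basis_subspace[OF assms(1)] by metis
  then obtain p where p: "p \<in> B" using assms(2) by (metis card.empty ex_in_conv not_numeral_le_zero)
  have "card (B - {p}) \<ge> 1"
    using p independent_imp_finite[OF B(5)] B(4) assms(2) by simp
  then have "B - {p} \<noteq> {}" by (metis card.empty not_one_le_zero)
  then obtain q where q: "q \<in> B" "q \<noteq> p" by blast
  have "p \<bullet> q = 0" using B(2) p q by (auto simp: pairwise_def Linear_Algebra.orthogonal_def)
  then show ?thesis using B p q by blast
qed

text \<open>First-order condition at a maximum of (c + t d)^2 / (1 + t^2 W) at t = 0.\<close>

lemma maximum_first_order: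
  fixes c d W :: real
  assumes "\<And>t. (c + t * d)\<^sup>2 \<le> c\<^sup>2 * (1 + t\<^sup>2 * W)"
  shows "d = 0"
proof (rule ccontr)
  assume d: "d \<noteq> 0"
  define A where "A = c\<^sup>2 * W - d\<^sup>2"
  have *: "2 * c * d * t \<le> A * t\<^sup>2" for t
    using assms[of t] by (simp add: A_def power2_eq_square algebra_simps)
  show False
  proof (cases "c = 0")
    case True
    then show ?thesis using *[of 1] d by (simp add: A_def)
  next
    case False
    \<comment> \<open>Any K > 0 with A < 2 K will do: at t = c d / K the linear term exceeds the
      quadratic one.\<close>
    define K where "K = \<bar>A\<bar> + 1"
    have K: "K > 0" "A < 2 * K" by (auto simp: K_def)
    have "2 * (c * d) * (c * d / K) \<le> A * (c * d / K)\<^sup>2" using *[of "c * d / K"] by (simp add: mult_ac)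
    then have "2 * K * (c * d)\<^sup>2 \<le> A * (c * d)\<^sup>2" using K(1) by (simp add: power2_eq_square field_simps)
    then show ?thesis using K(2) d False by (simp add: mult_le_cancel_right)
  qed
qed

text \<open>
  The first two vectors maximise the skew form over orthonormal pairs; by the first-order
  condition their orthogonal complement is invariant.
\<close>

lemma skew_normal_form:
  fixes J :: "'a::euclidean_space \<Rightarrow> 'a"
  assumes J: "linear J" "\<And>x y. J x \<bullet> y = - (x \<bullet> J y)"
  shows "subspace V \<Longrightarrow> dim V = 2 * n \<Longrightarrow> \<exists>u. (\<forall>i<2 * n. u i \<in> V) \<and>
    (\<forall>i<2 * n. \<forall>j<2 * n. u i \<bullet> u j = (if i = j then 1 else 0)) \<and>
    (\<forall>i<2 * n. \<forall>j<2 * n. i div 2 \<noteq> j div 2 \<longrightarrow> J (u i) \<bullet> u j = 0)"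
proof (induction n arbitrary: V)
  case (Suc n)
  let ?S = "{z. fst z \<in> V \<and> snd z \<in> V \<and> norm (fst z) = 1 \<and> norm (snd z) = 1 \<and> fst z \<bullet> snd z = 0}"
  let ?f = "\<lambda>z :: 'a \<times> 'a. (J (fst z) \<bullet> snd z)\<^sup>2"
  have contJ: "continuous_on UNIV J" using J(1) by (simp add: linear_continuous_on linear_conv_bounded_linear)
  have "?S = (V \<times> V) \<inter> {z. norm (fst z) = 1} \<inter> {z. norm (snd z) = 1} \<inter> {z. fst z \<bullet> snd z = 0}"
    by auto
  moreover have "closed ((V \<times> V) \<inter> {z. norm (fst z) = 1} \<inter> {z. norm (snd z) = 1} \<inter> {z :: 'a \<times> 'a. fst z \<bullet> snd z = 0})"
    using closed_subspace[OF Suc.prems(1)]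
    by (intro closed_Int closed_Times closed_Collect_eq continuous_intros) auto
  moreover have "bounded ?S"
  proof (rule bounded_subset)
    show "bounded (cball (0 :: 'a) 1 \<times> cball (0 :: 'a) 1)" by (intro bounded_Times bounded_cball)
  qed auto
  ultimately have "compact ?S" by (simp add: compact_eq_bounded_closed)
  moreover have "?S \<noteq> {}"
    using orthonormal_pair_exists[OF Suc.prems(1)] Suc.prems(2) by auto
  moreover have "continuous_on ?S ?f"
    by (intro continuous_intros continuous_on_compose2[OF contJ]) auto
  ultimately obtain z where z: "z \<in> ?S" "\<And>y. y \<in> ?S \<Longrightarrow> ?f y \<le> ?f z"
    using continuous_attains_sup[of ?S ?f] by blast
  define p q where "p = fst z" and "q = snd z"
  define c where "c = J p \<bullet> q"
  have p: "p \<in> V" "norm p = 1" and q: "q \<in> V" "norm q = 1" and pq: "p \<bullet> q = 0"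
    using z(1) by (auto simp: p_def q_def)
  have mx: "(J a \<bullet> b)\<^sup>2 \<le> c\<^sup>2" if "a \<in> V" "b \<in> V" "norm a = 1" "norm b = 1" "a \<bullet> b = 0" for a b
    using z(2)[of "(a, b)"] that by (simp add: c_def p_def q_def)
  have skew: "J a \<bullet> b = - (J b \<bullet> a)" for a b using J(2)[of a b] by (simp add: inner_commute)
  \<comment> \<open>Homogeneous in b, so that the perturbed vectors q + t w and p + t w need not be
    normalized.\<close>
  have mx': "(J a \<bullet> b)\<^sup>2 \<le> c\<^sup>2 * (norm b)\<^sup>2" if "a \<in> V" "b \<in> V" "norm a = 1" "a \<bullet> b = 0" for a b
  proof (cases "b = 0")
    case False
    have "(J a \<bullet> ((1 / norm b) *\<^sub>R b))\<^sup>2 \<le> c\<^sup>2"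
      by (rule mx) (use that False Suc.prems(1) in \<open>auto simp: subspace_scale\<close>)
    then show ?thesis using False by (simp add: power_divide field_simps)
  qed simp
  have nrm: "(norm (a + t *\<^sub>R w))\<^sup>2 = 1 + t\<^sup>2 * (norm w)\<^sup>2" if "norm a = 1" "a \<bullet> w = 0" for a w :: 'a and t
    using that unfolding power2_norm_eq_inner norm_eq_1
    by (simp add: inner_add_left inner_add_right inner_commute power2_eq_square)
  define V' where "V' = {y \<in> V. \<forall>x\<in>span {p, q}. orthogonal x y}"
  have V'D: "w \<in> V" "p \<bullet> w = 0" "q \<bullet> w = 0" if "w \<in> V'" for w
    using that span_base[of p "{p, q}"] span_base[of q "{p, q}"]
    by (auto simp: V'_def Linear_Algebra.orthogonal_def)
  have Jp: "J p \<bullet> w = 0" if w: "w \<in> V'" for w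
  proof (rule maximum_first_order)
    fix t
    have "(J p \<bullet> (q + t *\<^sub>R w))\<^sup>2 \<le> c\<^sup>2 * (norm (q + t *\<^sub>R w))\<^sup>2"
      by (rule mx') (use p q pq V'D[OF w] Suc.prems(1) in \<open>auto simp: subspace_add subspace_scale inner_add_right\<close>)
    then show "(c + t * (J p \<bullet> w))\<^sup>2 \<le> c\<^sup>2 * (1 + t\<^sup>2 * (norm w)\<^sup>2)"
      using nrm[of q w t] q V'D[OF w] by (simp add: inner_add_right c_def)
  qed
  \<comment> \<open>The pair in the order (q, p) is a maximum too: the skew form takes the value - c
    there.\<close>
  have Jq: "J q \<bullet> w = 0" if w: "w \<in> V'" for w
  proof (rule maximum_first_order)
    fix t
    have "(J q \<bullet> (p + t *\<^sub>R w))\<^sup>2 \<le> c\<^sup>2 * (norm (p + t *\<^sub>R w))\<^sup>2"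
      by (rule mx') (use p q pq V'D[OF w] Suc.prems(1) in
          \<open>auto simp: subspace_add subspace_scale inner_add_right inner_commute\<close>)
    moreover have "J q \<bullet> p = - c" using skew[of q p] by (simp add: c_def)
    ultimately show "(- c + t * (J q \<bullet> w))\<^sup>2 \<le> (- c)\<^sup>2 * (1 + t\<^sup>2 * (norm w)\<^sup>2)"
      using nrm[of p w t] p V'D[OF w] by (simp add: inner_add_right)
  qed
  have subV': "subspace V'"
    using Suc.prems(1) unfolding V'_def subspace_def
    by (auto simp: orthogonal_clauses(1) Linear_Algebra.orthogonal_def inner_add_right)
  have "dim V' = 2 * n"
  proof -
    have "{p, q} \<subseteq> V" using p q by simp
    then have "span {p, q} \<subseteq> V" using Suc.prems(1) span_minimal by blast
    then have "dim V' + dim (span {p, q}) = dim V"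
      unfolding V'_def by (intro dim_subspace_orthogonal_to_vectors) (use Suc.prems(1) in auto)
    moreover have "p \<noteq> q" using pq p by (auto simp: norm_eq_1)
    moreover have "independent {p, q}"
    proof (rule pairwise_orthogonal_independent)
      show "pairwise orthogonal {p, q}"
        using pq by (auto simp: pairwise_def Linear_Algebra.orthogonal_def inner_commute)
    qed (use p q in auto)
    ultimately show ?thesis using Suc.prems(2) by (simp add: dim_eq_card_independent)
  qed
  from Suc.IH[OF subV' this] obtain u where u: "\<And>i. i < 2 * n \<Longrightarrow> u i \<in> V'"
    "\<And>i j. i < 2 * n \<Longrightarrow> j < 2 * n \<Longrightarrow> u i \<bullet> u j = (if i = j then 1 else 0)"
    "\<And>i j. i < 2 * n \<Longrightarrow> j < 2 * n \<Longrightarrow> i div 2 \<noteq> j div 2 \<Longrightarrow> J (u i) \<bullet> u j = 0" by blast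
  define u' where "u' i = (if i = 0 then p else if i = 1 then q else u (i - 2))" for i
  have cases: "i = 0 \<or> i = 1 \<or> (\<exists>k<2 * n. i = k + 2)" if "i < 2 * Suc n" for i
    using that by (auto simp: le_iff_add[of 2] not_less_eq_eq intro: exI[of _ "i - 2"])
  have u'0: "u' 0 = p" "u' (Suc 0) = q" "u' (k + 2) = u k" "u' (Suc (Suc k)) = u k" for k by (auto simp: u'_def)
  have pp: "p \<bullet> p = 1" "q \<bullet> q = 1" "q \<bullet> p = 0" using p q pq by (simp_all add: norm_eq_1 inner_commute)
  have up: "u k \<bullet> p = 0" "u k \<bullet> q = 0" "p \<bullet> u k = 0" "q \<bullet> u k = 0"
    "J p \<bullet> u k = 0" "J q \<bullet> u k = 0" "J (u k) \<bullet> p = 0" "J (u k) \<bullet> q = 0" if "k < 2 * n" for k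
    using V'D[OF u(1)[OF that]] Jp[OF u(1)[OF that]] Jq[OF u(1)[OF that]] skew[of "u k"]
    by (simp_all add: inner_commute)
  have "u' i \<in> V" if "i < 2 * Suc n" for i
    using cases[OF that] p q V'D(1) u(1) u'0 by auto
  moreover have "u' i \<bullet> u' j = (if i = j then 1 else 0)" if "i < 2 * Suc n" "j < 2 * Suc n" for i j
    using cases[OF that(1)] cases[OF that(2)] u(2) up pp pq by (auto simp: u'0 split: if_splits)
  moreover have "J (u' i) \<bullet> u' j = 0" if "i < 2 * Suc n" "j < 2 * Suc n" "i div 2 \<noteq> j div 2" for i j
    using cases[OF that(1)] cases[OF that(2)] u(3) up that(3) by (auto simp: u'0)
  ultimately show ?case by blast
qed simp

text \<open>Expanding the x i in an orthonormal basis with fewer than m members makes every term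
  repeat a vector. Applied to the wedge of the covectors of x, this shows that the vectors of an
  oriented plane are independent.\<close>

lemma alt_forms_low_dim:
  fixes x :: "nat \<Rightarrow> 'a::euclidean_space"
  assumes \<alpha>: "\<alpha> \<in> alt_forms m" and low: "dim (x ` {..<m}) < m"
  shows "\<alpha> x = 0"
proof -
  obtain B where B: "B \<subseteq> span (x ` {..<m})" "pairwise orthogonal B" "\<And>b. b \<in> B \<Longrightarrow> norm b = 1"
    "independent B" "card B = dim (span (x ` {..<m}))" "span B = span (x ` {..<m})"
    using orthonormal_basis_subspace[OF subspace_span] by metis
  have fin: "finite B" using B(4) by (rule independent_imp_finite)
  have "x i = (\<Sum>b\<in>B. (x i \<bullet> b) *\<^sub>R b)" if "i < m" for i
    by (rule orthonormal_basis_expand[OF B(2,3) _ fin, symmetric]) (use that in \<open>auto simp: B(6) span_base\<close>)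
  then have "\<alpha> x = (\<Sum>f\<in>{..<m} \<rightarrow>\<^sub>E B. (\<Prod>i<m. x i \<bullet> f i) *\<^sub>R \<alpha> (\<lambda>i. f i))"
    by (rule alt_forms_expand[OF \<alpha> fin])
  also have "\<dots> = 0"
  proof (rule sum.neutral, rule ballI)
    fix f assume "f \<in> {..<m} \<rightarrow>\<^sub>E B"
    then have "f ` {..<m} \<subseteq> B" by auto
    then have "\<not> inj_on f {..<m}"
      using card_inj_on_le[of f "{..<m}" B] fin low B(5) by (auto simp: dim_span)
    then obtain i j where "i < m" "j < m" "i \<noteq> j" "f i = f j" by (auto simp: inj_on_def)
    then show "(\<Prod>i<m. x i \<bullet> f i) *\<^sub>R \<alpha> (\<lambda>i. f i) = 0" using alt_formsD(3)[OF \<alpha>, of i j f] by simp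
  qed
  finally show ?thesis .
qed

text \<open>Norm 1 forces the spanning vectors x to be independent, so the skew normal form applies
  to their span. Passing from u to x multiplies every form by the same determinant D.\<close>

lemma oriented_plane_normal_form:
  fixes J :: "'a::euclidean_space \<Rightarrow> 'a"
  assumes J: "linear J" "\<And>x y. J x \<bullet> y = - (x \<bullet> J y)" and \<xi>: "\<xi> \<in> oriented_planes (2 * n)"
  obtains u D where "\<bar>D\<bar> = 1" "\<And>\<alpha>. \<alpha> \<in> alt_forms (2 * n) \<Longrightarrow> \<xi> \<alpha> = D * \<alpha> u"
    "\<And>i j. i < 2 * n \<Longrightarrow> j < 2 * n \<Longrightarrow> u i \<bullet> u j = (if i = j then 1 else 0)"
    "\<And>i j. i < 2 * n \<Longrightarrow> j < 2 * n \<Longrightarrow> i div 2 \<noteq> j div 2 \<Longrightarrow> J (u i) \<bullet> u j = 0"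
proof -
  let ?m = "2 * n"
  obtain x where x: "\<xi> = simple_mvector ?m x" "gram_det ?m x x = 1"
    using \<xi> by (auto simp: oriented_planes_def)
  have gram: "wedge_covectors (\<lambda>i v. x i \<bullet> v) ?m x = 1"
    using x(2) by (simp add: wedge_covectors_eq gram_det_def)
  have "\<not> dim (x ` {..<?m}) < ?m"
    using alt_forms_low_dim[OF wedge_covectors_inner_alt_forms, of x ?m x] gram by auto
  moreover have "dim (x ` {..<?m}) \<le> ?m"
    using dim_le_card'[of "x ` {..<?m}"] card_image_le[of "{..<?m}" x] by simp
  ultimately have dimV: "dim (span (x ` {..<?m})) = 2 * n" by (simp add: dim_span)
  obtain u where u: "\<And>i. i < 2 * n \<Longrightarrow> u i \<in> span (x ` {..<?m})"
    "\<And>i j. i < 2 * n \<Longrightarrow> j < 2 * n \<Longrightarrow> u i \<bullet> u j = (if i = j then 1 else 0)"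
    "\<And>i j. i < 2 * n \<Longrightarrow> j < 2 * n \<Longrightarrow> i div 2 \<noteq> j div 2 \<Longrightarrow> J (u i) \<bullet> u j = 0"
    using skew_normal_form[OF J subspace_span dimV] by blast
  have ex: "x i = (\<Sum>j<?m. (u j \<bullet> x i) *\<^sub>R u j)" if "i < ?m" for i
    by (rule orthonormal_subspace_expand[OF subspace_span dimV u(1,2)]) (use that in \<open>auto simp: span_base\<close>)
  define D where "D = (\<Sum>p | p permutes {..<?m}. of_int (sign p) * (\<Prod>i<?m. u (p i) \<bullet> x i))"
  have D: "\<alpha> x = D * \<alpha> u" if "\<alpha> \<in> alt_forms ?m" for \<alpha> :: "('a, real) form"
    using alt_forms_frame[OF that ex] by (simp add: D_def)
  \<comment> \<open>The wedge of the covectors of x has the value D at u and, by the norm condition,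
    1 at x; so the change of basis applied to this form itself gives D^2 = 1.\<close>
  have "wedge_covectors (\<lambda>i v. x i \<bullet> v) ?m u = D"
    by (simp add: wedge_covectors_eq D_def inner_commute)
  then have "D * D = 1" using D[OF wedge_covectors_inner_alt_forms, of x] gram by simp
  then have "\<bar>D\<bar> = 1" by (auto simp: square_eq_1_iff)
  moreover have "\<xi> \<alpha> = D * \<alpha> u" if "\<alpha> \<in> alt_forms ?m" for \<alpha>
    using D[OF that] that x(1) by (simp add: simple_mvector_def)
  ultimately show ?thesis using u(2,3) by (rule that)
qed

section \<open>Evaluation on planes in normal form\<close>

text \<open>The covectors dual to the basis u of a plane: after pulling back along u, forms become
  forms on index sequences, and evaluation at u becomes evaluation at \<open>id\<close>.\<close>

definition index_cov :: "nat \<Rightarrow> nat \<Rightarrow> complex" where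
  "index_cov p q = (if p = q then 1 else 0)"

lemma wedge_list_index_cov_id: "wedge_list (map index_cov [0..<n]) id = 1"
proof -
  have "mat n n (\<lambda>(i, j). (map index_cov [0..<n] ! i) (id j)) = 1\<^sub>m n"
    by (rule eq_matI) (auto simp: index_cov_def)
  then show ?thesis by (simp add: wedge_list_def wedge_covectors_det)
qed

lemma cmod_wedge_list_mset:
  "mset fs = mset gs \<Longrightarrow> cmod (wedge_list fs x) = cmod (wedge_list gs x)"
  using wedge_list_mset[of fs gs x] by auto

text \<open>Modulo the index covectors of qs, each row of gs reduces to its entries at the indices
  ps. What remains is the minor of gs in the columns ps times the sign of the arrangement ps @
  qs.\<close>

lemma wedge_list_complement:
  assumes perm: "mset (ps @ qs) = mset [0..<n]" and l: "length gs = length ps"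
  shows "wedge_list (gs @ map index_cov qs) id =
    wedge_list gs (\<lambda>i. ps ! i) * wedge_list (map index_cov (ps @ qs)) id"
proof -
  have n: "length ps + length qs = n" using arg_cong[OF perm, of size] by simp
  have sum: "(\<Sum>b<length ps. h (ps ! b)) + (\<Sum>b<length qs. h (qs ! b)) = (\<Sum>p<n. h p)" for h :: "nat \<Rightarrow> complex"
  proof -
    have "(\<Sum>b<length ps. h (ps ! b)) + (\<Sum>b<length qs. h (qs ! b)) = sum_list (map h (ps @ qs))"
      using sum_list_sum_nth[of "map h ps"] sum_list_sum_nth[of "map h qs"] by (simp add: atLeast0LessThan)
    also have "\<dots> = sum_mset (image_mset h (mset (ps @ qs)))"
      by (metis mset_map sum_mset_sum_list)
    also have "\<dots> = sum_list (map h [0..<n])"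
      unfolding perm by (metis mset_map sum_mset_sum_list)
    finally show ?thesis by (simp add: interv_sum_list_conv_sum_set_nat atLeast0LessThan)
  qed
  have "wedge_list (gs @ map index_cov qs) id =
      det (mat (length ps) (length ps) (\<lambda>(i, b). (gs ! i) (ps ! b))) *
      wedge_list (map index_cov ps @ map index_cov qs) id"
  proof (rule wedge_list_change[where D = "\<lambda>i b. (gs ! i) (qs ! b)"])
    fix i j assume ij: "i < length ps" "j < length ps + length qs"
    have "(\<Sum>p<n. (gs ! i) p * index_cov p j) = (\<Sum>p<n. if p = j then (gs ! i) p else 0)"
      by (rule sum.cong) (auto simp: index_cov_def)
    also have "\<dots> = (gs ! i) j" using ij n by simp
    finally show "(gs ! i) (id j) = (\<Sum>b<length ps. (gs ! i) (ps ! b) * (map index_cov ps ! b) (id j)) +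
        (\<Sum>b<length qs. (gs ! i) (qs ! b) * (map index_cov qs ! b) (id j))"
      using sum[of "\<lambda>p. (gs ! i) p * index_cov p j"] by simp
  qed (use l in simp_all)
  then show ?thesis by (simp add: wedge_list_def wedge_covectors_det l)
qed

lemma cmod_wedge_list_complement:
  assumes perm: "mset (ps @ qs) = mset [0..<n]" and l: "length gs = length ps"
  shows "cmod (wedge_list (gs @ map index_cov qs) id) = cmod (wedge_list gs (\<lambda>i. ps ! i))"
proof -
  have "mset (map index_cov (ps @ qs)) = mset (map index_cov [0..<n])"
    using perm by (metis mset_map)
  then have "cmod (wedge_list (map index_cov (ps @ qs)) id) = 1"
    using cmod_wedge_list_mset wedge_list_index_cov_id by (metis norm_one)
  then show ?thesis by (simp add: wedge_list_complement[OF assms] norm_mult)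
qed

lemma wedge_pullback:
  "wedge k l (\<lambda>x. \<alpha> (\<lambda>i. u (x i))) (\<lambda>x. \<beta> (\<lambda>i. u (x i))) = (\<lambda>x. wedge k l \<alpha> \<beta> (\<lambda>i. u (x i)))"
  by (simp add: wedge_def Alt_def tensor_def fun_eq_iff o_def)

lemma wedge_power_pullback:
  "wedge_power k (\<lambda>x. \<alpha> (\<lambda>i. u (x i))) n = (\<lambda>x. wedge_power k \<alpha> n (\<lambda>i. u (x i)))"
  by (induction n) (simp_all add: wedge_pullback)

section \<open>Unitary frames of planes and complementary minors\<close>

context hermitian_space
begin

text \<open>Distinct blocks are Hermitian orthogonal, since the real and the imaginary part of H
  both vanish between them. Within a block, u_2k+1 minus its complex projection to u_2k has squared
  length 1 - c_k^2; normalized, it becomes f_2k+1.\<close>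

lemma unitary_frame_of_plane:
  fixes u :: "nat \<Rightarrow> 'a"
  assumes b: "frame (2 * n) b"
    and on: "\<And>i j. i < 2 * n \<Longrightarrow> j < 2 * n \<Longrightarrow> u i \<bullet> u j = (if i = j then 1 else 0)"
    and block: "\<And>i j. i < 2 * n \<Longrightarrow> j < 2 * n \<Longrightarrow> i div 2 \<noteq> j div 2 \<Longrightarrow> scaleC \<i> (u i) \<bullet> u j = 0"
  defines "c \<equiv> \<lambda>k. Im (H (u (2 * k)) (u (2 * k + 1)))"
  obtains f s where "frame (2 * n) f" "\<And>k. k < n \<Longrightarrow> s k \<ge> 0" "\<And>k. k < n \<Longrightarrow> (c k)\<^sup>2 + (s k)\<^sup>2 = 1"
    "\<And>k. k < n \<Longrightarrow> u (2 * k) = f (2 * k)"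
    "\<And>k. k < n \<Longrightarrow> u (2 * k + 1) = scaleC (\<i> * c k) (f (2 * k)) + s k *\<^sub>R f (2 * k + 1)"
proof -
  have H0: "H (u i) (u j) = 0" if "i < 2 * n" "j < 2 * n" "i div 2 \<noteq> j div 2" for i j
    using on[OF that(1,2)] block[OF that] that(3) by (auto intro!: complex_eqI simp: Re_H Im_H)
  have H1: "H (u i) (u i) = 1" if "i < 2 * n" for i
    using on[OF that that] by (simp add: H_self)
  have Hc: "H (u (2 * k)) (u (2 * k + 1)) = \<i> * c k" if "k < n" for k
    using on[of "2 * k" "2 * k + 1"] that by (auto intro!: complex_eqI simp: Re_H c_def)
  have Hc': "H (u (2 * k + 1)) (u (2 * k)) = - \<i> * c k" if "k < n" for k
    by (subst H_cnj) (simp only: Hc[OF that], simp)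
  define r where "r k = u (2 * k + 1) - scaleC (\<i> * c k) (u (2 * k))" for k
  have ur: "H (u (2 * l)) (r k) = 0" if "k < n" "l < n" for k l
    using that Hc[OF that(1)] H1[of "2 * k"] H0[of "2 * l" "2 * k + 1"] H0[of "2 * l" "2 * k"]
    by (cases "l = k") (simp_all add: r_def H_diff_right H_scale_right)
  have rr: "H (r l) (r k) = (if l = k then of_real (1 - (c k)\<^sup>2) else 0)" if "k < n" "l < n" for k l
  proof -
    have "H (r l) (r k) = H (u (2 * l + 1)) (r k)"
      by (subst r_def) (simp add: H_diff_left H_scale_left ur that)
    also have "\<dots> = H (u (2 * l + 1)) (u (2 * k + 1)) - \<i> * c k * H (u (2 * l + 1)) (u (2 * k))"
      by (simp add: r_def H_diff_right H_scale_right)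
    finally show ?thesis
      using that Hc'[OF that(1)] H1[of "2 * k + 1"] H0[of "2 * l + 1" "2 * k + 1"] H0[of "2 * l + 1" "2 * k"]
      by (cases "l = k") (simp_all add: power2_eq_square algebra_simps)
  qed
  have ru: "H (r k) (u (2 * l)) = 0" if "k < n" "l < n" for k l
    using ur[OF that] by (subst H_cnj) simp
  have nonneg: "r k \<bullet> r k = 1 - (c k)\<^sup>2" if "k < n" for k
    using rr[OF that that] by (simp only: H_self if_True simp_thms of_real_eq_iff)
  have c1: "(c k)\<^sup>2 \<le> 1" if "k < n" for k
    using nonneg[OF that] inner_ge_zero[of "r k"] by simp
  define s where "s k = sqrt (1 - (c k)\<^sup>2)" for k
  have s: "s k \<ge> 0" "(s k)\<^sup>2 = 1 - (c k)\<^sup>2" if "k < n" for k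
    using c1[OF that] by (simp_all add: s_def)
  \<comment> \<open>If s k = 0, the block is a complex line and determines no second unitary vector;
    its odd index is left free for \<open>orthonormal_extend\<close>.\<close>
  define I where "I = {i. i < 2 * n \<and> (even i \<or> s (i div 2) \<noteq> 0)}"
  define e where "e i = (if even i then u i else (1 / s (i div 2)) *\<^sub>R r (i div 2))" for i
  have "H (e i) (e j) = (if i = j then 1 else 0)" if i: "i \<in> I" and j: "j \<in> I" for i j
  proof -
    have ij: "i div 2 < n" "j div 2 < n" "i < 2 * n" "j < 2 * n" using i j by (auto simp: I_def)
    consider "even i" "even j" | "even i" "odd j" | "odd i" "even j" | "odd i" "odd j" by blast
    then show ?thesis
    proof cases
      case 1
      then have "i \<noteq> j \<Longrightarrow> i div 2 \<noteq> j div 2" by (metis dvd_mult_div_cancel)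
      then show ?thesis using 1 H0[OF ij(3,4)] H1[OF ij(3)] by (auto simp: e_def)
    next
      case 2
      then have "i = 2 * (i div 2)" "i \<noteq> j" by auto
      then show ?thesis using 2 ur[OF ij(2,1)] by (simp add: e_def H_scaleR_right)
    next
      case 3
      then have "j = 2 * (j div 2)" "i \<noteq> j" by auto
      then show ?thesis using 3 ru[OF ij(1,2)] by (simp add: e_def H_scaleR_left)
    next
      case 4
      have e_odd: "H (e i) (e j) = of_real (1 / s (i div 2)) * (of_real (1 / s (j div 2)) * H (r (i div 2)) (r (j div 2)))"
        using 4 by (simp add: e_def H_scaleR_right H_scaleR_left)
      show ?thesis
      proof (cases "i = j")
        case True
        have "s (i div 2) \<noteq> 0" using i 4 by (simp add: I_def)
        have "1 / s (i div 2) * (1 / s (i div 2) * (1 - (c (i div 2))\<^sup>2)) = 1"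
          unfolding s(2)[OF ij(1), symmetric] using \<open>s (i div 2) \<noteq> 0\<close> by (simp add: power2_eq_square)
        then show ?thesis
          unfolding e_odd rr[OF ij(2,1)] using True by (simp only: if_True simp_thms of_real_mult[symmetric] of_real_1)
      next
        case False
        then have "i div 2 \<noteq> j div 2" using 4 by (metis odd_two_times_div_two_succ)
        then show ?thesis unfolding e_odd rr[OF ij(2,1)] using False by simp
      qed
    qed
  qed
  then have "orthonormal_on I e" by (simp add: orthonormal_on_def)
  moreover have "I \<subseteq> {..<2 * n}" by (auto simp: I_def)
  ultimately obtain f where f: "frame (2 * n) f" "\<forall>i\<in>I. f i = e i"
    using orthonormal_extend[OF b] by blast
  have f0: "u (2 * k) = f (2 * k)" if "k < n" for k
    using bspec[OF f(2), of "2 * k"] that by (simp add: I_def e_def)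
  have "r k = s k *\<^sub>R f (2 * k + 1)" if "k < n" for k
  proof (cases "s k = 0")
    case True
    then have "r k \<bullet> r k = 0" using s(2)[OF that] nonneg[OF that] by simp
    then show ?thesis using True by simp
  next
    case False
    then have "f (2 * k + 1) = (1 / s k) *\<^sub>R r k"
      using bspec[OF f(2), of "2 * k + 1"] that by (simp add: I_def e_def)
    then show ?thesis using False by simp
  qed
  then have "u (2 * k + 1) = scaleC (\<i> * c k) (f (2 * k)) + s k *\<^sub>R f (2 * k + 1)" if "k < n" for k
    unfolding f0[OF that, symmetric] using that by (simp add: r_def algebra_simps)
  moreover have "(c k)\<^sup>2 + (s k)\<^sup>2 = 1" if "k < n" for k using s(2)[OF that] by simp
  ultimately show ?thesis using f(1) s(1) f0 by (intro that)
qed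

text \<open>A single n-form, with the rows of f at ps and of e at bs, is evaluated at both frames.
  At e the rows from e single out the minor with columns as; at f the rows from f single out the
  complementary minor, up to conjugate transposition. The two values differ by a phase.\<close>

lemma complementary_minors:
  assumes e: "frame n e" and f: "frame n f"
    and ps: "mset (ps @ qs) = mset [0..<n]" and as: "mset (as @ bs) = mset [0..<n]"
    and l: "length as = length ps"
  shows "cmod (wedge_list (map (\<lambda>p. H (f p)) ps) (\<lambda>i. e (as ! i))) =
    cmod (wedge_list (map (\<lambda>q. H (f q)) qs) (\<lambda>i. e (bs ! i)))"
proof -
  have n: "length ps + length qs = n" "length as + length bs = n"
    using arg_cong[OF ps, of size] arg_cong[OF as, of size] by simp_all
  have restrict: "cmod (wedge_list (map (\<lambda>p. H (g p)) xs @ map (\<lambda>q. H (e q)) zs) e) =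
      cmod (wedge_list (map (\<lambda>p. H (g p)) xs) (\<lambda>i. e (ys ! i)))"
    if e: "frame n e" and perm: "mset (ys @ zs) = mset [0..<n]" and len: "length xs = length ys" for e g xs ys zs
  proof -
    have nn: "length ys + length zs = n" using arg_cong[OF perm, of size] by simp
    have zn: "q < n" if "q \<in> set zs" for q using that arg_cong[OF perm, of set_mset] by auto
    have "wedge_list (map (\<lambda>p. H (g p)) xs @ map (\<lambda>q. H (e q)) zs) e =
        wedge_list (map (\<lambda>p i. H (g p) (e i)) xs @ map index_cov zs) id"
    proof (rule wedge_list_cong)
      fix i j
      assume "i < length (map (\<lambda>p. H (g p)) xs @ map (\<lambda>q. H (e q)) zs)"
        "j < length (map (\<lambda>p. H (g p)) xs @ map (\<lambda>q. H (e q)) zs)"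
      then show "((map (\<lambda>p. H (g p)) xs @ map (\<lambda>q. H (e q)) zs) ! i) (e j) =
          ((map (\<lambda>p i. H (g p) (e i)) xs @ map index_cov zs) ! i) (id j)"
        using len nn zn by (auto simp: nth_append index_cov_def frame_orthonormal[OF e])
    qed simp
    then have "cmod (wedge_list (map (\<lambda>p. H (g p)) xs @ map (\<lambda>q. H (e q)) zs) e) =
        cmod (wedge_list (map (\<lambda>p i. H (g p) (e i)) xs) (\<lambda>i. ys ! i))"
      using cmod_wedge_list_complement[OF perm, of "map (\<lambda>p i. H (g p) (e i)) xs"] len by simp
    also have "wedge_list (map (\<lambda>p i. H (g p) (e i)) xs) (\<lambda>i. ys ! i) =
        wedge_list (map (\<lambda>p. H (g p)) xs) (\<lambda>i. e (ys ! i))"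
      by (rule wedge_list_cong) simp_all
    finally show ?thesis .
  qed
  let ?gs = "map f ps @ map e bs"
  let ?W = "wedge_list (map (\<lambda>p. H (f p)) ps @ map (\<lambda>q. H (e q)) bs)"
  have W: "?W x = wedge_covectors (\<lambda>i. H (?gs ! i)) n x" for x
    unfolding wedge_list_def using n l
    by (auto intro!: wedge_covectors_cong simp: nth_append)
  have "cmod (?W e) = cmod (?W f)"
    unfolding W using frame_change[OF f, of "\<lambda>i. ?gs ! i" e] frame_wedge_frame[OF e f]
    by (simp add: norm_mult)
  moreover have "cmod (?W e) = cmod (wedge_list (map (\<lambda>p. H (f p)) ps) (\<lambda>i. e (as ! i)))"
    by (rule restrict[OF e as]) (simp add: l)
  moreover have "cmod (?W f) = cmod (wedge_list (map (\<lambda>q. H (e q)) bs @ map (\<lambda>p. H (f p)) ps) f)"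
    by (rule cmod_wedge_list_mset) simp
  moreover have "\<dots> = cmod (wedge_list (map (\<lambda>q. H (e q)) bs) (\<lambda>i. f (qs ! i)))"
    by (rule restrict[OF f]) (use ps n l in \<open>auto simp: ac_simps\<close>)
  moreover have "\<dots> = cmod (wedge_list (map (\<lambda>q. H (f q)) qs) (\<lambda>i. e (bs ! i)))"
  proof -
    have len: "length bs = length qs" using n l by simp
    have "wedge_list (map (\<lambda>q. H (e q)) bs) (\<lambda>i. f (qs ! i)) =
        wedge_covectors (\<lambda>i. H (e (bs ! i))) (length qs) (\<lambda>i. f (qs ! i))"
      unfolding wedge_list_def using len by (auto intro!: wedge_covectors_cong)
    also have "\<dots> = cnj (wedge_covectors (\<lambda>i. H (f (qs ! i))) (length qs) (\<lambda>i. e (bs ! i)))"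
      by (rule wedge_covectors_cnj_transpose)
    also have "wedge_covectors (\<lambda>i. H (f (qs ! i))) (length qs) (\<lambda>i. e (bs ! i)) =
        wedge_list (map (\<lambda>q. H (f q)) qs) (\<lambda>i. e (bs ! i))"
      unfolding wedge_list_def by (auto intro!: wedge_covectors_cong)
    finally show ?thesis by simp
  qed
  ultimately show ?thesis by simp
qed

end

section \<open>Restriction of the forms to a plane in normal form\<close>

definition pair_indices :: "nat list \<Rightarrow> nat list" where
  "pair_indices = concat \<circ> map (\<lambda>k. [2 * k, 2 * k + 1])"

lemma pair_indices_simps [simp]:
  "pair_indices [] = []" "pair_indices (k # ks) = (2 * k) # (2 * k + 1) # pair_indices ks"
  "pair_indices (ks @ js) = pair_indices ks @ pair_indices js"
  by (simp_all add: pair_indices_def)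

lemma map_pair_indices: "map h (pair_indices ks) = pair_rows (\<lambda>k. h (2 * k)) (\<lambda>k. h (2 * k + 1)) ks"
  by (induction ks) auto

lemma length_pair_indices [simp]: "length (pair_indices ks) = 2 * length ks"
  by (induction ks) auto

lemma mset_pair_indices:
  assumes "mset ks = mset [0..<n]"
  shows "mset (pair_indices ks) = mset [0..<2 * n]"
proof -
  have "mset (pair_indices ks) = (\<Sum>k\<in>#mset ks. {#2 * k, 2 * k + 1#})" for ks
    by (induction ks) auto
  moreover have "pair_indices [0..<n] = [0..<2 * n]" by (induction n) auto
  ultimately show ?thesis using assms by metis
qed

text \<open>Rearranging whole pairs of indices is an even permutation, so the sign in
  \<open>wedge_list_complement\<close> is 1.\<close>

lemma wedge_list_pair_complement:
  assumes perm: "mset (js @ ks) = mset [0..<n]" and l: "length gs = 2 * length js"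
  shows "wedge_list (gs @ map index_cov (pair_indices ks)) id = wedge_list gs (\<lambda>i. pair_indices js ! i)"
proof -
  have "wedge_list (map index_cov (pair_indices js @ pair_indices ks)) id =
      wedge_list (map index_cov (pair_indices [0..<n])) id"
    using wedge_list_pair_rows_mset[OF perm, of "[]" "\<lambda>k. index_cov (2 * k)" "\<lambda>k. index_cov (2 * k + 1)" "[]" id]
    by (simp only: map_pair_indices append_Nil append_Nil2 pair_indices_simps(3)[symmetric])
  also have "pair_indices [0..<n] = [0..<2 * n]" by (induction n) auto
  finally have 1: "wedge_list (map index_cov (pair_indices js @ pair_indices ks)) id = 1"
    by (simp only: wedge_list_index_cov_id)
  have "mset (pair_indices js @ pair_indices ks) = mset [0..<2 * n]"
    using mset_pair_indices[OF perm] by simp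
  from wedge_list_complement[OF this, of gs] show ?thesis using l by (simp add: 1 del: map_append)
qed

lemma two_subsets_of_four:
  "{S. S \<subseteq> {..<4 :: nat} \<and> card S = 2} = {{0, 1}, {0, 2}, {0, 3}, {1, 2}, {1, 3}, {2, 3}}"
proof (intro equalityI subsetI)
  fix S assume "S \<in> {S. S \<subseteq> {..<4 :: nat} \<and> card S = 2}"
  then obtain x y where S: "S = {x, y}" "x \<noteq> y" "x < 4" "y < 4" by (auto simp: card_2_iff)
  then have "x \<in> {0, 1, 2, 3}" "y \<in> {0, 1, 2, 3}" by auto
  then show "S \<in> {{0, 1}, {0, 2}, {0, 3}, {1, 2}, {1, 3}, {2, 3}}"
    using S(2) unfolding S(1) by (elim insertE emptyE; simp add: insert_commute)
qed auto

context hermitian_space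
begin

text \<open>Double counting: expanded by Parseval, the sum of b \<bullet> b over the real basis is
  the sum of the squared lengths of the e i and i e i. It identifies the complementary degree in the
  Hodge star.\<close>

lemma frame_DIM:
  assumes e: "frame n e"
  shows "DIM('a) = 2 * n"
proof -
  have nsq: "(\<Sum>b\<in>Basis. (v \<bullet> b)\<^sup>2) = v \<bullet> v" for v :: 'a
    by (simp add: euclidean_inner[of v v] power2_eq_square)
  have e1: "e i \<bullet> e i = 1" "scaleC \<i> (e i) \<bullet> scaleC \<i> (e i) = 1" if "i < n" for i
    using frame_orthonormal[OF e that that] by (simp_all flip: Re_H add: H_scale_left H_scale_right)
  have "b \<bullet> b = (\<Sum>i<n. (e i \<bullet> b)\<^sup>2 + (scaleC \<i> (e i) \<bullet> b)\<^sup>2)" for b :: 'a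
    by (simp add: Re_H[symmetric, of b] frame_parseval[OF e, of b b] Re_H Im_H power2_eq_square)
  then have "(\<Sum>b\<in>(Basis :: 'a set). b \<bullet> b) =
      (\<Sum>i<n. (\<Sum>b\<in>Basis. (e i \<bullet> b)\<^sup>2) + (\<Sum>b\<in>Basis. (scaleC \<i> (e i) \<bullet> b)\<^sup>2))"
    by (simp add: sum.swap[of _ "Basis"] flip: sum.distrib)
  also have "\<dots> = real (2 * n)" by (simp add: nsq e1)
  finally have "real DIM('a) = real (2 * n)" by simp
  then show ?thesis by (simp only: of_nat_eq_iff)
qed

text \<open>Away from the pairs (2 k, 2 k + 1) the values vanish by the block condition or because u
  is 0 from 2 n on. This cut-off makes the identity hold for all index sequences, so that wedge
  powers of it can be taken.\<close>

lemma kahler_on_plane: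
  fixes u :: "nat \<Rightarrow> 'a"
  assumes z: "\<And>i. i \<ge> 2 * n \<Longrightarrow> u i = 0"
    and block: "\<And>i j. i < 2 * n \<Longrightarrow> j < 2 * n \<Longrightarrow> i div 2 \<noteq> j div 2 \<Longrightarrow> scaleC \<i> (u i) \<bullet> u j = 0"
  shows "(\<lambda>x :: nat \<Rightarrow> nat. complex_of_real (kahler_form H (\<lambda>i. u (x i)))) =
    (\<lambda>x. \<Sum>k\<in>{..<n}. of_real (Im (H (u (2 * k)) (u (2 * k + 1)))) *
      wedge_list [index_cov (2 * k), index_cov (2 * k + 1)] x)"
proof
  fix x :: "nat \<Rightarrow> nat"
  define p q where "p = x 0" and "q = x 1"
  let ?c = "\<lambda>k. Im (H (u (2 * k)) (u (2 * k + 1)))"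
  let ?t = "\<lambda>k. of_real (?c k) * (index_cov (2 * k) p * index_cov (2 * k + 1) q - index_cov (2 * k) q * index_cov (2 * k + 1) p)"
  have "complex_of_real (Im (H (u p) (u q))) = (\<Sum>k<n. ?t k)"
  proof (cases "p < 2 * n")
    case False
    then have "(\<Sum>k<n. ?t k) = 0" by (intro sum.neutral) (auto simp: index_cov_def)
    then show ?thesis using False z by simp
  next
    case True
    define k where "k = p div 2"
    have k: "k < n" using True by (auto simp: k_def)
    have "(\<Sum>l<n. ?t l) = (\<Sum>l<n. if l = k then ?t k else 0)"
    proof (rule sum.cong[OF refl])
      fix l
      show "?t l = (if l = k then ?t k else 0)"
        by (cases "l = k") (auto simp: index_cov_def k_def)
    qed
    also have "\<dots> = ?t k" using k by simp
    also have "?t k = complex_of_real (Im (H (u p) (u q)))"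
    proof -
      have anti: "Im (H v w) = - Im (H w v)" for v w by (subst H_cnj) simp
      consider "p = 2 * k" | "p = 2 * k + 1" unfolding k_def by linarith
      then show ?thesis
      proof cases
        case 1
        show ?thesis
        proof (cases "q = 2 * k + 1 \<or> q = 2 * k \<or> q \<ge> 2 * n")
          case True
          then show ?thesis using 1 k z by (auto simp: index_cov_def Im_H_self)
        next
          case False
          then have "q div 2 \<noteq> k" "q < 2 * n" by linarith+
          then show ?thesis using False 1 k block[of "2 * k" q] by (simp add: index_cov_def Im_H)
        qed
      next
        case 2
        show ?thesis
        proof (cases "q = 2 * k + 1 \<or> q = 2 * k \<or> q \<ge> 2 * n")
          case True
          then show ?thesis using 2 k z anti[of "u (2 * k + 1)" "u (2 * k)"] by (auto simp: index_cov_def Im_H_self)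
        next
          case False
          then have "q div 2 \<noteq> k" "q < 2 * n" by linarith+
          then show ?thesis using False 2 k block[of "2 * k + 1" q] by (simp add: index_cov_def Im_H)
        qed
      qed
    qed
    finally show ?thesis by simp
  qed
  then show "complex_of_real (kahler_form H (\<lambda>i. u (x i))) =
      (\<Sum>k\<in>{..<n}. of_real (?c k) * wedge_list [index_cov (2 * k), index_cov (2 * k + 1)] x)"
    by (simp add: kahler_form_def wedge_list_2 p_def q_def)
qed

lemma kahler_power_on_plane:
  fixes u :: "nat \<Rightarrow> 'a"
  assumes z: "\<And>i. i \<ge> 2 * n \<Longrightarrow> u i = 0"
    and block: "\<And>i j. i < 2 * n \<Longrightarrow> j < 2 * n \<Longrightarrow> i div 2 \<noteq> j div 2 \<Longrightarrow> scaleC \<i> (u i) \<bullet> u j = 0"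
  shows "complex_of_real (wedge_power 2 (kahler_form H) m (\<lambda>i. u (x i))) =
    fact m * (\<Sum>S | S \<subseteq> {..<n} \<and> card S = m. (\<Prod>k\<in>S. of_real (Im (H (u (2 * k)) (u (2 * k + 1))))) *
      wedge_list (map index_cov (pair_indices (sorted_list_of_set S))) x)"
proof -
  have pairs: "(\<lambda>x :: nat \<Rightarrow> nat. complex_of_real (kahler_form H (\<lambda>i. u (x i)))) =
    (\<lambda>x. \<Sum>k\<in>{..<n}. of_real (Im (H (u (2 * k)) (u (2 * k + 1)))) *
      wedge_list [index_cov (2 * k), index_cov (2 * k + 1)] x)"
    by (rule kahler_on_plane) (use z block in auto)
  have "complex_of_real (wedge_power 2 (kahler_form H) m (\<lambda>i. u (x i))) =
      wedge_power 2 (\<lambda>x. complex_of_real (kahler_form H (\<lambda>i. u (x i)))) m x"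
    using wedge_power_pullback[of 2 "kahler_form H" u m] by (simp add: wedge_power_of_real)
  then show ?thesis
    unfolding wedge_power_pairs[OF pairs finite_lessThan] map_pair_indices .
qed

text \<open>The multiple of f_2k contained in u_2k+1 is absorbed by the row of f_2k, so the 2 by 2
  determinant is just s.\<close>

lemma plane_row_reduce:
  assumes "u (2 * k) = f (2 * k)" "u (2 * k + 1) = scaleC (\<i> * c) (f (2 * k)) + s *\<^sub>R f (2 * k + 1)"
  shows "wedge_list (as @ H (u (2 * k)) # H (u (2 * k + 1)) # cs) x =
    of_real s * wedge_list (as @ H (f (2 * k)) # H (f (2 * k + 1)) # cs) x"
proof -
  have "wedge_list (as @ H (u (2 * k)) # H (u (2 * k + 1)) # cs) x =
      (1 * of_real s - 0 * cnj (\<i> * c)) * wedge_list (as @ H (f (2 * k)) # H (f (2 * k + 1)) # cs) x"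
    by (rule wedge_list_pair_change) (simp_all add: assms H_add_left H_scale_left H_scaleR_left)
  then show ?thesis by simp
qed

end

lemma upt_0_4: "[0..<4] = [0, 1, 2, 3]"
  by (simp add: eval_nat_numeral)

context hermitian_space
begin

text \<open>Conjugate transposition turns the vectors of the plane into rows; every block in js then
  contributes its factor s by \<open>plane_row_reduce\<close>.\<close>

lemma minor_reduce:
  assumes f: "\<And>k. k < n \<Longrightarrow> u (2 * k) = f (2 * k)" "\<And>k. k < n \<Longrightarrow> s k \<ge> 0"
    "\<And>k. k < n \<Longrightarrow> u (2 * k + 1) = scaleC (\<i> * complex_of_real (c k)) (f (2 * k)) + s k *\<^sub>R f (2 * k + 1)"
    and js: "set js \<subseteq> {..<n}" and l: "length E = 2 * length js"
  shows "cmod (wedge_list (map H E) (\<lambda>i. u (pair_indices js ! i))) =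
    prod_list (map s js) * cmod (wedge_list (map (\<lambda>p. H (f p)) (pair_indices js)) (\<lambda>i. E ! i))"
proof -
  have rows: "wedge_list (as @ map (\<lambda>p. H (u p)) (pair_indices js)) x =
      of_real (prod_list (map s js)) * wedge_list (as @ map (\<lambda>p. H (f p)) (pair_indices js)) x"
    if "set js \<subseteq> {..<n}" for as js x
    using that
  proof (induction js arbitrary: as)
    case (Cons k js)
    have k: "k < n" using Cons.prems by simp
    have "wedge_list (as @ map (\<lambda>p. H (u p)) (pair_indices (k # js))) x =
        of_real (s k) * wedge_list ((as @ [H (f (2 * k)), H (f (2 * k + 1))]) @ map (\<lambda>p. H (u p)) (pair_indices js)) x"
      using plane_row_reduce[OF f(1,3)[OF k], of as "map (\<lambda>p. H (u p)) (pair_indices js)" x] by simp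
    then show ?case using Cons by (simp del: append_assoc) simp
  qed simp
  have "wedge_list (map H E) (\<lambda>i. u (pair_indices js ! i)) =
      wedge_covectors (\<lambda>i. H (E ! i)) (2 * length js) (\<lambda>i. u (pair_indices js ! i))"
    unfolding wedge_list_def using l by (auto intro!: wedge_covectors_cong)
  also have "\<dots> = cnj (wedge_covectors (\<lambda>i. H (u (pair_indices js ! i))) (2 * length js) (\<lambda>i. E ! i))"
    by (rule wedge_covectors_cnj_transpose)
  also have "wedge_covectors (\<lambda>i. H (u (pair_indices js ! i))) (2 * length js) (\<lambda>i. E ! i) =
      wedge_list (map (\<lambda>p. H (u p)) (pair_indices js)) (\<lambda>i. E ! i)"
    unfolding wedge_list_def by (auto intro!: wedge_covectors_cong)
  also have "\<dots> = of_real (prod_list (map s js)) * wedge_list (map (\<lambda>p. H (f p)) (pair_indices js)) (\<lambda>i. E ! i)"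
    using rows[OF js, of "[]"] by simp
  finally have "cmod (wedge_list (map H E) (\<lambda>i. u (pair_indices js ! i))) =
      \<bar>prod_list (map s js)\<bar> * cmod (wedge_list (map (\<lambda>p. H (f p)) (pair_indices js)) (\<lambda>i. E ! i))"
    by (simp add: norm_mult)
  moreover have "prod_list (map s js) \<ge> 0"
    using f(2) js by (induction js) auto
  ultimately show ?thesis by simp
qed

text \<open>Each 2-element set of blocks used by half the square of the Kaehler form contributes the
  product of its c and leaves the two other blocks to the four covectors of E.\<close>

lemma holo_kahler_on_plane:
  fixes u :: "nat \<Rightarrow> 'a"
  assumes z: "\<And>i. i \<ge> 8 \<Longrightarrow> u i = 0"
    and block: "\<And>i j. i < 8 \<Longrightarrow> j < 8 \<Longrightarrow> i div 2 \<noteq> j div 2 \<Longrightarrow> scaleC \<i> (u i) \<bullet> u j = 0"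
    and l: "length E = 4"
  defines "c \<equiv> \<lambda>k. complex_of_real (Im (H (u (2 * k)) (u (2 * k + 1))))"
    and "a \<equiv> \<lambda>k l. wedge_list (map H E) (\<lambda>i. u (pair_indices [k, l] ! i))"
  shows "wedge 4 4 (wedge_list (map H E)) (\<lambda>x. complex_of_real (1 / 2 * wedge_power 2 (kahler_form H) 2 x)) u =
    c 0 * c 1 * a 2 3 + c 0 * c 2 * a 1 3 + c 0 * c 3 * a 1 2 + c 1 * c 2 * a 0 3 + c 1 * c 3 * a 0 2 + c 2 * c 3 * a 0 1"
proof -
  let ?Z = "map (\<lambda>w p. H w (u p)) E"
  let ?F = "{S. S \<subseteq> {..<4 :: nat} \<and> card S = 2}"
  let ?P = "\<lambda>S. wedge_list (map index_cov (pair_indices (sorted_list_of_set S)))"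
  have Z: "wedge_list (map H E) (\<lambda>i. u (x i)) = wedge_list ?Z x" for x
    by (rule wedge_list_cong) simp_all
  have W: "complex_of_real (1 / 2 * wedge_power 2 (kahler_form H) 2 (\<lambda>i. u (x i))) = (\<Sum>S\<in>?F. prod c S * ?P S x)" for x
    using kahler_power_on_plane[of 4 u 2 x] z block by (simp add: c_def)
  have "wedge 4 4 (wedge_list (map H E)) (\<lambda>x. complex_of_real (1 / 2 * wedge_power 2 (kahler_form H) 2 x)) u =
      wedge 4 4 (\<lambda>x. wedge_list (map H E) (\<lambda>i. u (x i)))
        (\<lambda>x. complex_of_real (1 / 2 * wedge_power 2 (kahler_form H) 2 (\<lambda>i. u (x i)))) id"
    using fun_cong[OF wedge_pullback[of 4 4 "wedge_list (map H E)" u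
        "\<lambda>x. complex_of_real (1 / 2 * wedge_power 2 (kahler_form H) 2 x)"], of id]
    by (simp only: id_apply)
  also have "\<dots> = (\<Sum>S\<in>?F. prod c S * wedge 4 4 (wedge_list ?Z) (?P S) id)"
    unfolding W Z wedge_sum_right ..
  also have "\<dots> = (\<Sum>S\<in>?F. prod c S * wedge_list (?Z @ map index_cov (pair_indices (sorted_list_of_set S))) id)"
  proof (rule sum.cong[OF refl])
    fix S assume "S \<in> ?F"
    then show "prod c S * wedge 4 4 (wedge_list ?Z) (?P S) id =
        prod c S * wedge_list (?Z @ map index_cov (pair_indices (sorted_list_of_set S))) id"
      by (subst wedge_wedge_list) (simp_all add: l)
  qed
  also have "\<dots> = c 0 * c 1 * a 2 3 + c 0 * c 2 * a 1 3 + c 0 * c 3 * a 1 2 + c 1 * c 2 * a 0 3 + c 1 * c 3 * a 0 2 + c 2 * c 3 * a 0 1"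
  proof -
    have minor: "wedge_list (?Z @ map index_cov (pair_indices ks)) id = a k m"
      if "mset ([k, m] @ ks) = mset [0, 1, 2, 3]" for k m ks
    proof -
      have "mset ([k, m] @ ks) = mset [0..<4]" unfolding upt_0_4 using that .
      from wedge_list_pair_complement[OF this, of ?Z]
      have "wedge_list (?Z @ map index_cov (pair_indices ks)) id = wedge_list ?Z (\<lambda>i. pair_indices [k, m] ! i)"
        by (simp add: l)
      then show ?thesis unfolding a_def Z .
    qed
    have m1: "wedge_list (?Z @ map index_cov (pair_indices [0, 1])) id = a 2 3"
      and m2: "wedge_list (?Z @ map index_cov (pair_indices [0, 2])) id = a 1 3"
      and m3: "wedge_list (?Z @ map index_cov (pair_indices [0, 3])) id = a 1 2"
      and m4: "wedge_list (?Z @ map index_cov (pair_indices [1, 2])) id = a 0 3"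
      and m5: "wedge_list (?Z @ map index_cov (pair_indices [1, 3])) id = a 0 2"
      and m6: "wedge_list (?Z @ map index_cov (pair_indices [2, 3])) id = a 0 1"
      by (rule minor; simp)+
    have sorted: "sorted_list_of_set {i, j} = [i, j]" if "i < j" for i j :: nat using that by simp
    have fin: "sum g {{0, 1}, {0, 2}, {0, 3}, {1, 2}, {1, 3}, {2, 3}} =
        g {0, 1} + g {0, 2} + g {0, 3} + g {1, 2} + g {1, 3} + g {2, 3 :: nat}" for g :: "nat set \<Rightarrow> complex"
      by (simp add: doubleton_eq_iff add.assoc)
    have pr: "prod c {i, j} = c i * c j" if "i < j" for i j :: nat using that by simp
    show ?thesis
      unfolding two_subsets_of_four fin
      using m1 m2 m3 m4 m5 m6 sorted[of 0 1] sorted[of 0 2] sorted[of 0 3] sorted[of 1 2] sorted[of 1 3] sorted[of 2 3]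
        pr[of 0 1] pr[of 0 2] pr[of 0 3] pr[of 1 2] pr[of 1 3] pr[of 2 3]
      by (simp only: zero_less_one one_less_numeral_iff zero_less_numeral numeral_less_iff semiring_norm simp_thms)
  qed
  finally show ?thesis .
qed

lemma kahler_fourth_power_on_plane:
  fixes u :: "nat \<Rightarrow> 'a"
  assumes z: "\<And>i. i \<ge> 8 \<Longrightarrow> u i = 0"
    and block: "\<And>i j. i < 8 \<Longrightarrow> j < 8 \<Longrightarrow> i div 2 \<noteq> j div 2 \<Longrightarrow> scaleC \<i> (u i) \<bullet> u j = 0"
  defines "c \<equiv> \<lambda>k. Im (H (u (2 * k)) (u (2 * k + 1)))"
  shows "wedge_power 2 (kahler_form H) 4 u = fact 4 * (c 0 * c 1 * c 2 * c 3)"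
proof -
  have F: "{S. S \<subseteq> {..<4 :: nat} \<and> card S = 4} = {{..<4}}"
    using card_subset_eq[of "{..<4 :: nat}"] by auto
  have "pair_indices (sorted_list_of_set {..<4}) = [0..<8]"
    by (simp add: lessThan_atLeast0 upt_rec)
  then have 1: "wedge_list (map index_cov (pair_indices (sorted_list_of_set {..<4}))) id = 1"
    by (simp only: wedge_list_index_cov_id)
  have "(\<Prod>k<4. complex_of_real (c k)) = of_real (c 0 * c 1 * c 2 * c 3)"
    by (simp add: eval_nat_numeral)
  moreover have "complex_of_real (wedge_power 2 (kahler_form H) 4 (\<lambda>i. u (id i))) =
      fact 4 * (\<Prod>k<4. complex_of_real (c k))"
    using kahler_power_on_plane[of 4 u 4 id] z block 1 unfolding F by (simp add: c_def)
  ultimately have "complex_of_real (wedge_power 2 (kahler_form H) 4 u) = of_real (fact 4 * (c 0 * c 1 * c 2 * c 3))"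
    by simp
  then show ?thesis by (simp only: of_real_eq_iff)
qed

text \<open>The rows p k and q k are conjugated coordinates of f_2k and f_2k+1, cut off after the
  first four. By Parseval in f each e a contributes 1, which gives the total squared length
  4.\<close>

lemma frame_minor_sum_bound:
  assumes e: "frame 8 e" and f: "frame 8 f"
  defines "A \<equiv> \<lambda>k l. cmod (wedge_list (map (\<lambda>p. H (f p)) (pair_indices [k, l])) e)"
  shows "A 0 1 + A 0 2 + A 0 3 + A 1 2 + A 1 3 + A 2 3 \<le> 1"
proof -
  define p where "p k a = (if a < 4 then H (f (2 * k)) (e a) else 0)" for k a
  define q where "q k a = (if a < 4 then H (f (2 * k + 1)) (e a) else 0)" for k a
  have A: "A k l = cmod (wedge_list [p k, q k, p l, q l] id)" for k l
    unfolding A_def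
    by (rule arg_cong[where f = cmod], rule wedge_list_cong)
      (auto simp: p_def q_def nth_Cons split: nat.split)
  have "(\<Sum>k<4. Re (cip 4 (p k) (p k)) + Re (cip 4 (q k) (q k))) =
      (\<Sum>k<4. \<Sum>a<4. (cmod (H (f (2 * k)) (e a)))\<^sup>2 + (cmod (H (f (2 * k + 1)) (e a)))\<^sup>2)"
    by (simp add: cip_self p_def q_def sum.distrib)
  also have "\<dots> = (\<Sum>a<4. \<Sum>k<4. (cmod (H (f (2 * k)) (e a)))\<^sup>2 + (cmod (H (f (2 * k + 1)) (e a)))\<^sup>2)"
    by (rule sum.swap)
  also have "\<dots> = (\<Sum>a<4. \<Sum>i<8. (cmod (H (f i) (e a)))\<^sup>2)"
    by (simp add: eval_nat_numeral)
  also have "\<dots> = (\<Sum>a<(4 :: nat). 1)"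
  proof (rule sum.cong[OF refl])
    fix a :: nat assume "a \<in> {..<4}"
    then have "1 = (\<Sum>i<8. cnj (H (f i) (e a)) * H (f i) (e a))"
      using frame_orthonormal[OF e, of a a] frame_parseval[OF f, of "e a" "e a"] by simp
    also have "\<dots> = of_real (\<Sum>i<8. (cmod (H (f i) (e a)))\<^sup>2)"
      unfolding of_real_sum complex_norm_square by (simp add: mult.commute)
    finally show "(\<Sum>i<8. (cmod (H (f i) (e a)))\<^sup>2) = 1" by (metis of_real_eq_1_iff)
  qed
  finally have tr: "(\<Sum>k<4. Re (cip 4 (p k) (p k)) + Re (cip 4 (q k) (q k))) = 4" by simp
  show ?thesis
    unfolding A by (rule minor_sum_bound[OF _ _ tr]) (simp_all add: p_def q_def)
qed

lemma plane_bound: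
  fixes u :: "nat \<Rightarrow> 'a"
  assumes e: "frame 8 e" and g: "frame 8 g"
    and z: "\<And>i. i \<ge> 8 \<Longrightarrow> u i = 0"
    and on: "\<And>i j. i < 8 \<Longrightarrow> j < 8 \<Longrightarrow> u i \<bullet> u j = (if i = j then 1 else 0)"
    and block: "\<And>i j. i < 8 \<Longrightarrow> j < 8 \<Longrightarrow> i div 2 \<noteq> j div 2 \<Longrightarrow> scaleC \<i> (u i) \<bullet> u j = 0"
  defines "w \<equiv> \<lambda>E. wedge 4 4 (wedge_list (map H E)) (\<lambda>x. complex_of_real (1 / 2 * wedge_power 2 (kahler_form H) 2 x)) u"
  shows "cmod (wedge_list (map H (map g [0..<8])) u) + 1 / fact 4 * \<bar>wedge_power 2 (kahler_form H) 4 u\<bar> +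
    cmod (w (map e [0..<4])) + cmod (w (map e [4..<8])) \<le> 1"
proof -
  define c where "c k = Im (H (u (2 * k)) (u (2 * k + 1)))" for k
  obtain f s where f: "frame 8 f" and s: "\<And>k. k < 4 \<Longrightarrow> s k \<ge> 0" and cs: "\<And>k. k < 4 \<Longrightarrow> (c k)\<^sup>2 + (s k)\<^sup>2 = 1"
    and uf: "\<And>k. k < 4 \<Longrightarrow> u (2 * k) = f (2 * k)"
    "\<And>k. k < 4 \<Longrightarrow> u (2 * k + 1) = scaleC (\<i> * c k) (f (2 * k)) + s k *\<^sub>R f (2 * k + 1)"
    using unitary_frame_of_plane[of 4 e u] e on block unfolding c_def by (simp only: mult_numeral_1_right) (auto simp: numeral_eq_Suc)
  \<comment> \<open>Absolute values, because c k may be negative. Beyond the four blocks 1 and 0 are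
    chosen so that C^2 + S^2 = 1 for every index.\<close>
  define C where "C k = (if k < 4 then \<bar>c k\<bar> else 1)" for k
  define S where "S k = (if k < 4 then s k else 0)" for k
  have CS: "C k \<ge> 0" "S k \<ge> 0" "(C k)\<^sup>2 + (S k)\<^sup>2 = 1" for k
    using s cs by (auto simp: C_def S_def)
  define M where "M x k l = cmod (wedge_list (map (\<lambda>p. H (f p)) (pair_indices [k, l])) x)" for x k l
  have M_cong: "M x k l = M y k l" if "\<And>i. i < 4 \<Longrightarrow> x i = y i" for x y k l
    unfolding M_def by (rule arg_cong[where f = cmod], rule wedge_list_cong) (use that in auto)
  let ?A = "M e" and ?B = "M (\<lambda>i. e (4 + i))"
  have minor: "cmod (wedge_list (map H E) (\<lambda>i. u (pair_indices [k, l] ! i))) = S k * S l * M (\<lambda>i. E ! i) k l"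
    if "k < 4" "l < 4" "length E = 4" for k l E
    using minor_reduce[OF uf(1) s uf(2), where js = "[k, l]" and E = E] that by (simp add: M_def S_def)
  let ?T = "\<lambda>M. C 0 * C 1 * (S 2 * S 3 * M 2 3) + C 0 * C 2 * (S 1 * S 3 * M 1 3) +
    C 0 * C 3 * (S 1 * S 2 * M 1 2) + C 1 * C 2 * (S 0 * S 3 * M 0 3) +
    C 1 * C 3 * (S 0 * S 2 * M 0 2) + C 2 * C 3 * (S 0 * S 1 * M 0 (1 :: nat))"
  have w_bound: "cmod (w E) \<le> ?T (M (\<lambda>i. E ! i))"
    if l: "length E = 4" for E
  proof -
    have t: "cmod (complex_of_real (c i) * complex_of_real (c j) * wedge_list (map H E) (\<lambda>i. u (pair_indices [k, l] ! i))) =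
        C i * C j * (S k * S l * M (\<lambda>i. E ! i) k l)" if "i < 4" "j < 4" "k < 4" "l < 4" for i j k l
      using minor[OF that(3,4) \<open>length E = 4\<close>] that by (simp add: norm_mult C_def)
    let ?c = "\<lambda>k. complex_of_real (c k)" and ?m = "\<lambda>k l. wedge_list (map H E) (\<lambda>i. u (pair_indices [k, l] ! i))"
    have eq: "w E = ?c 0 * ?c 1 * ?m 2 3 + ?c 0 * ?c 2 * ?m 1 3 + ?c 0 * ?c 3 * ?m 1 2 + ?c 1 * ?c 2 * ?m 0 3 +
        ?c 1 * ?c 3 * ?m 0 2 + ?c 2 * ?c 3 * ?m 0 1"
      unfolding w_def c_def by (rule holo_kahler_on_plane) (use z block l in simp_all)
    show ?thesis
      unfolding eq by (intro norm_triangle_le add_mono eq_refl t) simp_all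
  qed
  \<comment> \<open>The unitary matrix between f and e, with columns 0 to 3 for the blocks k, l and
    columns 4 to 7 for the other two blocks.\<close>
  have compl: "?B k' l' = ?A k l"
    if "mset ([k, l] @ [k', l']) = mset [0, 1, 2, 3]" for k l k' l'
  proof -
    have "mset ([k, l] @ [k', l']) = mset [0..<4]" unfolding upt_0_4 using that .
    then have perm: "mset (pair_indices [k, l] @ pair_indices [k', l']) = mset [0..<8]"
      using mset_pair_indices[of "[k, l] @ [k', l']" 4] by simp
    have "cmod (wedge_list (map (\<lambda>p. H (f p)) (pair_indices [k, l])) (\<lambda>i. e ([0..<4] ! i))) =
        cmod (wedge_list (map (\<lambda>q. H (f q)) (pair_indices [k', l'])) (\<lambda>i. e ([4..<8] ! i)))"
    proof (rule complementary_minors[OF e f perm])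
      show "mset ([0..<4] @ [4..<8]) = mset [0..<8 :: nat]"
        using upt_add_eq_append[of 0 4 4] by simp
    qed simp
    then have "M (\<lambda>i. e ([0..<4] ! i)) k l = M (\<lambda>i. e ([4..<8] ! i)) k' l'" unfolding M_def .
    moreover have "M (\<lambda>i. e ([0..<4] ! i)) k l = ?A k l" by (rule M_cong) simp
    moreover have "M (\<lambda>i. e ([4..<8] ! i)) k' l' = ?B k' l'" by (rule M_cong) (simp del: upt_rec_numeral)
    ultimately show ?thesis by (simp only:)
  qed
  have B: "?B 2 3 = ?A 0 1" "?B 1 3 = ?A 0 2" "?B 1 2 = ?A 0 3" "?B 0 3 = ?A 1 2" "?B 0 2 = ?A 1 3" "?B 0 1 = ?A 2 3"
    by (rule compl; simp)+
  have A1: "?A 0 1 + ?A 0 2 + ?A 0 3 + ?A 1 2 + ?A 1 3 + ?A 2 3 \<le> 1"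
    using frame_minor_sum_bound[OF e f] by (simp add: M_def)
  have A0: "?A k l \<ge> 0" for k l by (simp add: M_def)
  \<comment> \<open>Row reduction produces the factors s; the determinant that remains relates the
    frames f and g and has modulus 1.\<close>
  have "cmod (wedge_list (map H (map g [0..<8])) u) = S 0 * S 1 * S 2 * S 3"
  proof -
    have idx: "pair_indices [0, 1, 2, 3] = [0..<8]" by (simp add: upt_rec)
    have "cmod (wedge_list (map H (map g [0..<8])) u) = cmod (wedge_list (map H (map g [0..<8])) (\<lambda>i. u (pair_indices [0, 1, 2, 3] ! i)))"
      unfolding idx by (rule arg_cong[where f = cmod], rule wedge_list_cong) simp_all
    also have "\<dots> = prod_list (map s [0, 1, 2, 3]) * cmod (wedge_list (map (\<lambda>p. H (f p)) (pair_indices [0, 1, 2, 3])) (\<lambda>i. map g [0..<8] ! i))"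
      using minor_reduce[OF uf(1) s uf(2), where js = "[0, 1, 2, 3]" and E = "map g [0..<8]"] by simp
    also have "wedge_list (map (\<lambda>p. H (f p)) (pair_indices [0, 1, 2, 3])) (\<lambda>i. map g [0..<8] ! i) =
        wedge_covectors (\<lambda>i. H (f i)) 8 g"
      unfolding idx wedge_covectors_eq_list by (rule wedge_list_cong) simp_all
    finally show ?thesis
      using frame_wedge_frame[OF g f] by (simp add: S_def mult.assoc)
  qed
  moreover have "1 / fact 4 * \<bar>wedge_power 2 (kahler_form H) 4 u\<bar> = C 0 * C 1 * C 2 * C 3"
  proof -
    have "wedge_power 2 (kahler_form H) 4 u = fact 4 * (c 0 * c 1 * c 2 * c 3)"
      unfolding c_def by (rule kahler_fourth_power_on_plane) (use z block in simp_all)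
    then show ?thesis by (simp add: abs_mult C_def)
  qed
  moreover have "cmod (w (map e [0..<4])) \<le> ?T ?A"
  proof -
    have "M (\<lambda>i. map e [0..<4] ! i) k l = ?A k l" for k l by (rule M_cong) simp
    then show ?thesis using w_bound[of "map e [0..<4]"] by simp
  qed
  moreover have "cmod (w (map e [4..<8])) \<le> ?T ?B"
  proof -
    have "M (\<lambda>i. map e [4..<8] ! i) k l = ?B k l" for k l by (rule M_cong) (simp del: upt_rec_numeral)
    then show ?thesis using w_bound[of "map e [4..<8]"] by (simp del: upt_rec_numeral)
  qed
  ultimately show ?thesis
    using calibration_bound[of C S ?A ?B, OF CS A0 A1 B] by linarith
qed

end

section \<open>The calibration\<close>

lemma subsets_meet:
  assumes "S \<subseteq> {..<n}" "T \<subseteq> {..<n}" "card S + card T > n"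
  shows "S \<inter> T \<noteq> {}"
proof
  assume "S \<inter> T = {}"
  moreover have "finite S" "finite T" using assms finite_subset by blast+
  ultimately have "card S + card T = card (S \<union> T)" by (simp add: card_Un_disjoint)
  also have "\<dots> \<le> n" using card_mono[of "{..<n}" "S \<union> T"] assms by simp
  finally show False using assms(3) by simp
qed

context hermitian_space
begin

text \<open>The four summands of the calibration, as (K, m) in \<open>mixed_form\<close>.\<close>

definition summand_indices :: "nat \<Rightarrow> nat set" where
  "summand_indices t = [{..<8}, {}, {..<4}, {4..<8}] ! t"

definition summand_power :: "nat \<Rightarrow> nat" where
  "summand_power t = [0, 4, 2, 2] ! t"

text \<open>The coefficients of the volume in the product of a summand with its conjugate: 2^8, then
  8 choose 4, and for the last two 2^4 times 4 choose 2.\<close>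

definition summand_norm :: "nat \<Rightarrow> nat" where
  "summand_norm t = [256, 70, 96, 96] ! t"

lemma less_4_cases: "t < 4 \<Longrightarrow> t = 0 \<or> t = 1 \<or> t = 2 \<or> t = (3 :: nat)"
  by auto

lemma summand_simps [simp]:
  "summand_indices 0 = {..<8}" "summand_indices (Suc 0) = {}" "summand_indices 2 = {..<4}" "summand_indices 3 = {4..<8}"
  "summand_power 0 = 0" "summand_power (Suc 0) = 4" "summand_power 2 = 2" "summand_power 3 = 2"
  "summand_norm 0 = 256" "summand_norm (Suc 0) = 70" "summand_norm 2 = 96" "summand_norm 3 = 96"
  by (simp_all add: summand_indices_def summand_power_def summand_norm_def)

lemma summand_card:
  "t < 4 \<Longrightarrow> summand_indices t \<subseteq> {..<8}" "t < 4 \<Longrightarrow> card (summand_indices t) + 2 * summand_power t = 8"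
  by (drule less_4_cases, auto)+

lemma power_2i: "(if b then - 2 * \<i> else 2 * \<i>) ^ 4 = 16" "(if b then - 2 * \<i> else 2 * \<i>) ^ 8 = 256"
proof -
  let ?z = "if b then - 2 * \<i> else 2 * \<i>"
  have "?z ^ 2 = - 4" by (simp add: power2_eq_square)
  then have 4: "?z ^ 4 = 16" using power_mult[of ?z 2 2] by simp
  then show "?z ^ 4 = 16" .
  show "?z ^ 8 = 256" using power_mult[of ?z 4 2] 4 by simp
qed

lemma choose_values: "(0 :: nat) choose 2 = 0" "(8 :: nat) choose 2 = 28" "(4 :: nat) choose 2 = 6" "(8 :: nat) choose 4 = 70"
  by (simp_all add: choose_two binomial_fact' fact_numeral binomial_eq_0)

text \<open>Different summands multiply to 0 because their index sets cannot avoid each other within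
  eight indices. A summand survives only against its conjugate, and t = 1 is its own
  conjugate.\<close>

lemma summand_wedge:
  assumes e: "frame 8 e" and t: "t < 4" "t' < 4"
  shows "wedge 8 8 (mixed_form 8 e b (summand_indices t) (summand_power t))
      (mixed_form 8 e b' (summand_indices t') (summand_power t')) x =
    (if t = t' \<and> (b \<noteq> b' \<or> t = 1) then of_nat (summand_norm t) else 0) *
    wedge_list (pair_rows (re_cov e) (im_cov e) [0..<8]) x"
proof (cases "t = t' \<and> (b \<noteq> b' \<or> t = 1)")
  case True
  then have "b' = (\<not> b) \<or> summand_indices t = {}" by auto
  note conj = mixed_form_wedge_conj[OF summand_card[OF t(1)] this, of e x]
  show ?thesis
    using True conj less_4_cases[OF t(1)] by (auto simp: power_2i choose_values)
next
  case False
  have ne: "S \<noteq> {}" if "card S \<in> {2, 4}" for S :: "nat set" using that by auto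
  have "wedge 8 8 (mixed_form 8 e b (summand_indices t) (summand_power t))
      (mixed_form 8 e b' (summand_indices t') (summand_power t')) x = 0"
  proof (rule mixed_form_wedge_zero)
    fix S S' :: "nat set"
    assume S: "S \<subseteq> {..<8} - summand_indices t" "card S = summand_power t"
      "S' \<subseteq> {..<8} - summand_indices t'" "card S' = summand_power t'"
    let ?goal = "S \<inter> S' \<noteq> {} \<or> S \<inter> summand_indices t' \<noteq> {} \<or> S' \<inter> summand_indices t \<noteq> {} \<or>
      b = b' \<and> summand_indices t \<inter> summand_indices t' \<noteq> {}"
    have fin: "finite S" "finite S'" using S finite_subset by blast+
    have in1: ?goal if "S \<noteq> {}" "S \<subseteq> summand_indices t'" using that by blast
    have in2: ?goal if "S' \<noteq> {}" "S' \<subseteq> summand_indices t" using that by blast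
    \<comment> \<open>The rows belonging to t' occupy six of the eight indices, so the four elements
      of S must hit one of them.\<close>
    have big1: ?goal if "card S = 4" "card (summand_indices t') = 4" "card S' = 2"
    proof -
      have "card (S' \<union> summand_indices t') = 6"
        using that S(3) fin summand_card(1)[OF t(2)] finite_subset[of "summand_indices t'" "{..<8}"]
        by (subst card_Un_disjoint) auto
      then have "S \<inter> (S' \<union> summand_indices t') \<noteq> {}"
        using that S summand_card(1)[OF t(2)] by (intro subsets_meet[of _ 8]) auto
      then show ?thesis by blast
    qed
    have big2: ?goal if "card S' = 4" "card (summand_indices t) = 4" "card S = 2"
    proof -
      have "card (S \<union> summand_indices t) = 6"
        using that S(1) fin summand_card(1)[OF t(1)] finite_subset[of "summand_indices t" "{..<8}"]
        by (subst card_Un_disjoint) auto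
      then have "S' \<inter> (S \<union> summand_indices t) \<noteq> {}"
        using that S summand_card(1)[OF t(1)] by (intro subsets_meet[of _ 8]) auto
      then show ?thesis by blast
    qed
    consider "t = t'" | "t = 0" "t' \<noteq> 0" | "t' = 0" "t \<noteq> 0" | "t = 1" "t' \<in> {2, 3}" | "t' = 1" "t \<in> {2, 3}"
      | "t = 2" "t' = 3" | "t = 3" "t' = 2"
      using less_4_cases[OF t(1)] less_4_cases[OF t(2)] by auto
    then show ?goal
    proof cases
      case 1
      then have "b = b'" "t \<noteq> 1" using False by auto
      moreover have "summand_indices t \<noteq> {}" using less_4_cases[OF t(1)] \<open>t \<noteq> 1\<close> by (auto simp: lessThan_empty_iff)
      ultimately show ?thesis using 1 by simp
    next
      case 2
      have "S' \<noteq> {}" using S(4) less_4_cases[OF t(2)] 2 by (intro ne) auto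
      moreover have "S' \<subseteq> summand_indices t" using S(3) 2 by auto
      ultimately show ?thesis by (rule in2)
    next
      case 3
      have "S \<noteq> {}" using S(2) less_4_cases[OF t(1)] 3 by (intro ne) auto
      moreover have "S \<subseteq> summand_indices t'" using S(1) 3 by auto
      ultimately show ?thesis by (rule in1)
    next
      case 4
      then show ?thesis using S(2,4) by (intro big1) auto
    next
      case 5
      then show ?thesis using S(2,4) by (intro big2) auto
    next
      case 6
      then show ?thesis using S(3,4) by (intro in2) auto
    next
      case 7
      then show ?thesis using S(3,4) by (intro in2) auto
    qed
  qed (use summand_card t in auto)
  then show ?thesis by (simp only: False if_False mult_zero_left)
qed

text \<open>Splitting each real part into half a form and half its conjugate makes \<Phi> a
  combination of eight mixed forms, most of whose products vanish by \<open>summand_wedge\<close>.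
  The phase \<phi> meets only its own conjugate.\<close>

lemma square_of_summands:
  assumes e: "frame 8 e" and \<phi>: "cmod \<phi> = 1"
    and vol: "\<And>x. complex_of_real (vol x) = wedge_list (pair_rows (re_cov e) (im_cov e) [0..<8]) x"
    and \<Phi>: "\<And>x. \<Phi> x = Re (\<phi> * mixed_form 8 e True {..<8} 0 x) + Re (mixed_form 8 e True {} 4 x) +
      (Re (mixed_form 8 e True {..<4} 2 x) + Re (mixed_form 8 e True {4..<8} 2 x))"
  shows "wedge 8 8 \<Phi> \<Phi> x = 294 * vol x"
proof -
  define I where "I = {..<4 :: nat} \<times> (UNIV :: bool set)"
  define c where "c i = (if fst i = 0 then if snd i then \<phi> else cnj \<phi> else 1) / 2" for i :: "nat \<times> bool"
  define M where "M i = mixed_form 8 e (snd i) (summand_indices (fst i)) (summand_power (fst i))" for i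
  have sumI: "sum g I = (\<Sum>t<4. g (t, True) + g (t, False))" for g :: "nat \<times> bool \<Rightarrow> complex"
  proof -
    have "sum g I = (\<Sum>t<4. \<Sum>b\<in>UNIV. g (t, b))"
      unfolding I_def by (subst sum.cartesian_product) simp
    then show ?thesis by (simp add: UNIV_bool add.commute)
  qed
  have ReM: "complex_of_real (Re (z * mixed_form 8 e True K m x)) =
      z / 2 * mixed_form 8 e True K m x + cnj z / 2 * mixed_form 8 e False K m x" for z K m x
  proof -
    have "complex_of_real (Re w) = w / 2 + cnj w / 2" for w
      by (simp add: complex_eq_iff)
    then show ?thesis
      by (simp only: complex_cnj_mult mixed_form_cnj not_True_eq_False times_divide_eq_left)
  qed
  have \<Phi>_eq: "(\<lambda>x. complex_of_real (\<Phi> x)) = (\<lambda>x. \<Sum>i\<in>I. c i * M i x)"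
  proof
    fix x
    show "complex_of_real (\<Phi> x) = (\<Sum>i\<in>I. c i * M i x)"
      using ReM[of \<phi> "{..<8}" 0 x] ReM[of 1 "{}" 4 x] ReM[of 1 "{..<4}" 2 x] ReM[of 1 "{4..<8}" 2 x]
      by (simp add: \<Phi> sumI sum_lessThan_4 c_def M_def)
  qed
  have "complex_of_real (wedge 8 8 \<Phi> \<Phi> x) = wedge 8 8 (\<lambda>x. complex_of_real (\<Phi> x)) (\<lambda>x. complex_of_real (\<Phi> x)) x"
    by (simp add: wedge_of_real)
  also have "\<dots> = (\<Sum>i\<in>I. c i * (\<Sum>j\<in>I. c j * wedge 8 8 (M i) (M j) x))"
    unfolding \<Phi>_eq wedge_sum_left wedge_sum_right ..
  also have "\<dots> = (\<Sum>i\<in>I. c i * (\<Sum>j\<in>I. c j * ((if fst i = fst j \<and> (snd i \<noteq> snd j \<or> fst i = 1)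
      then of_nat (summand_norm (fst i)) else 0) * complex_of_real (vol x))))"
  proof -
    have "wedge 8 8 (M i) (M j) x = (if fst i = fst j \<and> (snd i \<noteq> snd j \<or> fst i = 1)
      then of_nat (summand_norm (fst i)) else 0) * complex_of_real (vol x)" if "i \<in> I" "j \<in> I" for i j
      unfolding M_def vol by (rule summand_wedge[OF e]) (use that in \<open>auto simp: I_def\<close>)
    then show ?thesis by simp
  qed
  \<comment> \<open>Here 128 = 256 / 2 comes from the holomorphic volume form and 166 = 70 + 48 + 48
    from the other three summands, 48 being 96 / 2.\<close>
  also have "\<dots> = (128 * (\<phi> * cnj \<phi>) + 166) * complex_of_real (vol x)"
    by (simp add: sumI sum_lessThan_4 c_def algebra_simps)
  also have "\<phi> * cnj \<phi> = 1" using \<phi> by (simp add: complex_norm_square[symmetric])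
  finally have "complex_of_real (wedge 8 8 \<Phi> \<Phi> x) = of_real (294 * vol x)" by simp
  then show ?thesis by (simp only: of_real_eq_iff)
qed

lemma cmod_ceval:
  assumes "\<bar>D\<bar> = 1" "\<And>\<beta>. \<beta> \<in> alt_forms m \<Longrightarrow> \<xi> \<beta> = D * \<beta> u" "\<alpha> \<in> alt_forms m"
  shows "cmod (ceval \<alpha> \<xi>) = cmod (\<alpha> u)"
proof -
  have "ceval \<alpha> \<xi> = of_real D * \<alpha> u"
    using assms(2)[OF alt_forms_linear[OF linear_Re assms(3)]] assms(2)[OF alt_forms_linear[OF linear_Im assms(3)]]
    by (simp add: ceval_def complex_eq_iff)
  then show ?thesis using assms(1) by (simp add: norm_mult)
qed

end

text \<open>The comass is a real supremum, and bounding it by a bound for its members requires that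
  there are some.\<close>

lemma oriented_planes_nonempty:
  fixes e :: "nat \<Rightarrow> 'a::real_inner"
  assumes "\<And>i j. i < m \<Longrightarrow> j < m \<Longrightarrow> e i \<bullet> e j = (if i = j then 1 else 0)"
  shows "(oriented_planes m :: 'a mvector set) \<noteq> {}"
proof -
  have "mat m m (\<lambda>(i, j). e i \<bullet> e j) = 1\<^sub>m m"
    by (rule eq_matI) (auto simp: assms)
  then have "wedge_covectors (\<lambda>i v. e i \<bullet> v) m e = 1" by (simp add: wedge_covectors_det)
  then have "gram_det m e e = 1" by (simp add: wedge_covectors_eq gram_det_def)
  then show ?thesis by (auto simp: oriented_planes_def)
qed

theorem theorem1p1:
  fixes scaleC :: "complex \<Rightarrow> 'a::euclidean_space \<Rightarrow> 'a"
    and H :: "'a \<Rightarrow> 'a \<Rightarrow> complex"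
    and X1 X2 :: "'a set"
    and \<Omega> \<Omega>1 \<Omega>2 \<Omega>1X \<Omega>2X :: "('a, complex) form"
    and \<omega> vol \<Phi> :: "('a, real) form"
  assumes "hermitian_space scaleC H"
    and "vector_space.dim scaleC (UNIV :: 'a set) = 8"
    and "\<omega> = kahler_form H"
    and "holomorphic_volume_form scaleC H UNIV 8 \<Omega>"
    and "module.subspace scaleC X1" and "module.subspace scaleC X2"
    and "vector_space.dim scaleC X1 = 4" and "vector_space.dim scaleC X2 = 4"
    and "\<forall>u\<in>X1. \<forall>v\<in>X2. H u v = 0"
    and "{u + v | u v. u \<in> X1 \<and> v \<in> X2} = UNIV"
    and "holomorphic_volume_form scaleC H X1 4 \<Omega>1"
    and "holomorphic_volume_form scaleC H X2 4 \<Omega>2"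
    and "\<Omega>1X = pullback (orth_proj X1) \<Omega>1"
    and "\<Omega>2X = pullback (orth_proj X2) \<Omega>2"
    and "vol = (\<lambda>x. 1 / fact 8 * wedge_power 2 \<omega> 8 x)"
    and "\<Phi> = (\<lambda>x. Re (\<Omega> x) + 1 / fact 4 * wedge_power 2 \<omega> 4 x
               + wedge 4 4 (\<lambda>x. Re (\<Omega>1X x + \<Omega>2X x)) (\<lambda>x. 1 / 2 * wedge_power 2 \<omega> 2 x) x)"
  shows "calibration 8 \<Phi> \<and>
    hodge_star vol 8 \<Phi> = \<Phi> \<and>
    (\<forall>\<xi>\<in>oriented_planes 8.
       let s = cmod (ceval \<Omega> \<xi>) + 1 / fact 4 * \<bar>\<xi> (wedge_power 2 \<omega> 4)\<bar>
             + cmod (ceval (wedge 4 4 \<Omega>1X (\<lambda>x. of_real (1 / 2 * wedge_power 2 \<omega> 2 x))) \<xi>)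
             + cmod (ceval (wedge 4 4 \<Omega>2X (\<lambda>x. of_real (1 / 2 * wedge_power 2 \<omega> 2 x))) \<xi>)
       in \<bar>\<xi> \<Phi>\<bar> \<le> s \<and> s \<le> 1) \<and>
    wedge 8 8 \<Phi> \<Phi> = (\<lambda>x. 294 * vol x)"
proof -
  interpret hermitian_space scaleC H by fact
  \<comment> \<open>The basis g of \<Omega> is unrelated to the basis e adapted to X1 and X2 below;
    the Kaehler form has the same expression in both.\<close>
  obtain g where g: "frame 8 g" and \<Omega>: "\<Omega> = wedge_covectors (\<lambda>i. H (g i)) 8"
    using holomorphic_volume_form_UNIV[OF assms(4)] by blast
  obtain e where e4: "frame (4 + 4) e" and \<Omega>1X: "\<Omega>1X = wedge_covectors (\<lambda>i. H (e i)) 4"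
    and \<Omega>2X: "\<Omega>2X = wedge_covectors (\<lambda>i. H (e (4 + i))) 4"
    using adapted_frame[OF assms(5,6,9-12)] unfolding assms(13,14) by blast
  have e: "frame 8 e" using e4 by simp
  have up: "[0..<8 :: nat] = [0..<4] @ [4..<8]" using upt_add_eq_append[of 0 4 4] by simp
  let ?N = "mixed_form 8"
  have \<Omega>_mixed: "\<Omega> = ?N g True {..<8} 0" by (simp only: mixed_form_top \<Omega>)
  have \<omega>4: "1 / fact 4 * wedge_power 2 \<omega> 4 x = Re (?N e True {} 4 x)" for x
    using arg_cong[OF kahler_power[OF e, of 4 x True], of Re] by (simp add: assms(3))
  have half: "(\<lambda>x. complex_of_real (1 / 2 * wedge_power 2 \<omega> 2 x)) = ?N e True {} 2"
    using kahler_power[OF e, of 2 _ True] by (simp add: fun_eq_iff assms(3))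
  have \<Omega>1_list: "\<Omega>1X = wedge_list (map (holo_cov e True) (sorted_list_of_set {..<4}))"
    unfolding \<Omega>1X wedge_covectors_eq_list lessThan_atLeast0
    by (rule ext, rule wedge_list_cong) (simp_all add: holo_cov_def)
  have \<Omega>2_list: "\<Omega>2X = wedge_list (map (holo_cov e True) (sorted_list_of_set {4..<8}))"
    unfolding \<Omega>2X wedge_covectors_eq_list sorted_list_of_set_range
    by (rule ext, rule wedge_list_cong) (simp_all add: holo_cov_def del: upt_rec_numeral)
  have W1: "wedge 4 4 \<Omega>1X (\<lambda>x. of_real (1 / 2 * wedge_power 2 \<omega> 2 x)) = ?N e True {..<4} 2"
    unfolding half \<Omega>1_list using mixed_form_wedge_holo[of "{..<4}" 8 2 e True True] by (simp add: fun_eq_iff)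
  have W2: "wedge 4 4 \<Omega>2X (\<lambda>x. of_real (1 / 2 * wedge_power 2 \<omega> 2 x)) = ?N e True {4..<8} 2"
  proof -
    have "{4..<8} \<subseteq> {..<8 :: nat}" by auto
    from mixed_form_wedge_holo[OF this, of 2 e True True] show ?thesis
      unfolding half \<Omega>2_list by (simp add: fun_eq_iff)
  qed
  have ReW: "wedge 4 4 (\<lambda>x. Re (\<Omega>1X x + \<Omega>2X x)) (\<lambda>x. 1 / 2 * wedge_power 2 \<omega> 2 x) x =
      Re (?N e True {..<4} 2 x) + Re (?N e True {4..<8} 2 x)" for x
    unfolding wedge_Re_left[symmetric] wedge_add_left W1 W2 by simp
  have \<Phi>: "\<Phi> = (\<lambda>x. Re (?N g True {..<8} 0 x) + Re (?N e True {} 4 x) +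
      (Re (?N e True {..<4} 2 x) + Re (?N e True {4..<8} 2 x)))"
    unfolding assms(16) ReW \<omega>4 \<Omega>_mixed ..
  have vol: "complex_of_real (vol x) = wedge_list (pair_rows (re_cov h) (im_cov h) [0..<8]) x"
    if "frame 8 h" for h x
    using kahler_volume[OF that, of x] by (simp add: assms(3,15))
  have i8: "\<i> ^ 4 = 1" "\<i> ^ 8 = 1"
    using power_mult[of \<i> 2 2] power_mult[of \<i> 2 4] by simp_all
  \<comment> \<open>The first summand is treated in the frame g and the others in e;
    \<open>vol\<close> is the wedge of all dx_j \<and> dy_j in either frame.\<close>
  have sd: "self_dual_form 8 vol \<Phi>"
    unfolding \<Phi>
    by (intro self_dual_form_add self_dual_mixed_form[OF g _ _ _ vol[OF g]] self_dual_mixed_form[OF e _ _ _ vol[OF e]])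
      (auto simp: choose_values i8)
  have \<Phi>_alt: "\<Phi> \<in> alt_forms 8" using sd by (simp add: self_dual_form_def)
  have star: "hodge_star vol 8 \<Phi> = \<Phi>"
    using sd frame_DIM[OF e] by (intro hodge_star_self_dual) simp_all
  have square: "wedge 8 8 \<Phi> \<Phi> = (\<lambda>x. 294 * vol x)"
  \<comment> \<open>The phase is the determinant of g against e, by which \<Omega> differs from the
    wedge of the coordinates of e.\<close>
  proof (rule ext, rule square_of_summands[OF e frame_wedge_frame[OF e g] vol[OF e]])
    show "\<Phi> x = Re (wedge_covectors (\<lambda>i. H (g i)) 8 e * ?N e True {..<8} 0 x) + Re (?N e True {} 4 x) +
        (Re (?N e True {..<4} 2 x) + Re (?N e True {4..<8} 2 x))" for x
      unfolding \<Phi> mixed_form_top frame_change[OF e, of g x, symmetric] ..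
  qed
  have alt: "\<Omega> \<in> alt_forms 8" "?N e True {..<4} 2 \<in> alt_forms 8" "?N e True {4..<8} 2 \<in> alt_forms 8"
    using mixed_form_alt_forms[of 8 g True "{..<8}" 0] mixed_form_alt_forms[of 8 e True "{..<4}" 2]
      mixed_form_alt_forms[of 8 e True "{4..<8}" 2] by (simp_all add: \<Omega>_mixed)
  have \<omega>4_alt: "wedge_power 2 \<omega> 4 \<in> alt_forms 8"
  proof -
    have "wedge_power 2 \<omega> 4 = (\<lambda>x. fact 4 * Re (?N e True {} 4 x))"
      using \<omega>4 by (simp add: fun_eq_iff field_simps)
    then show ?thesis
      using alt_forms_mult[OF alt_forms_linear[OF linear_Re mixed_form_alt_forms[of 8 e True "{}" 4]]] by simp
  qed
  have J: "linear (scaleC \<i>)" "scaleC \<i> x \<bullet> y = - (x \<bullet> scaleC \<i> y)" for x y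
  proof -
    show "linear (scaleC \<i>)"
    proof (rule linearI)
      show "scaleC \<i> (b + b') = scaleC \<i> b + scaleC \<i> b'" for b b' by (rule scale_right_distrib)
      show "scaleC \<i> (r *\<^sub>R b) = r *\<^sub>R scaleC \<i> b" for r b
        by (simp flip: scaleC_of_real add: mult.commute)
    qed
    show "scaleC \<i> x \<bullet> y = - (x \<bullet> scaleC \<i> y)"
      by (simp flip: Re_H add: H_scale_left H_scale_right)
  qed
  have bound: "let s = cmod (ceval \<Omega> \<xi>) + 1 / fact 4 * \<bar>\<xi> (wedge_power 2 \<omega> 4)\<bar>
             + cmod (ceval (wedge 4 4 \<Omega>1X (\<lambda>x. of_real (1 / 2 * wedge_power 2 \<omega> 2 x))) \<xi>)
             + cmod (ceval (wedge 4 4 \<Omega>2X (\<lambda>x. of_real (1 / 2 * wedge_power 2 \<omega> 2 x))) \<xi>)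
       in \<bar>\<xi> \<Phi>\<bar> \<le> s \<and> s \<le> 1" if \<xi>: "\<xi> \<in> oriented_planes 8" for \<xi>
  proof -
    have "\<xi> \<in> oriented_planes (2 * 4)" using \<xi> by simp
    then obtain u' D where D: "\<bar>D\<bar> = 1" "\<And>\<alpha>. \<alpha> \<in> alt_forms (2 * 4) \<Longrightarrow> \<xi> \<alpha> = D * \<alpha> u'"
      and u': "\<And>i j. i < 2 * 4 \<Longrightarrow> j < 2 * 4 \<Longrightarrow> u' i \<bullet> u' j = (if i = j then 1 else 0)"
        "\<And>i j. i < 2 * 4 \<Longrightarrow> j < 2 * 4 \<Longrightarrow> i div 2 \<noteq> j div 2 \<Longrightarrow> scaleC \<i> (u' i) \<bullet> u' j = 0"
      using oriented_plane_normal_form[OF J] by metis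
    \<comment> \<open>Entries from 8 on are set to 0, as the index formulation in
      \<open>plane_bound\<close> requires; alternating 8-forms do not see them.\<close>
    define u where "u i = (if i < 8 then u' i else 0)" for i
    have ev: "\<xi> \<alpha> = D * \<alpha> u" if "\<alpha> \<in> alt_forms 8" for \<alpha>
      using D(2)[of \<alpha>] that alt_formsD(1)[OF that, of u u'] by (simp add: u_def)
    have pb: "cmod (wedge_list (map H (map g [0..<8])) u) + 1 / fact 4 * \<bar>wedge_power 2 (kahler_form H) 4 u\<bar> +
      cmod (wedge 4 4 (wedge_list (map H (map e [0..<4]))) (\<lambda>x. complex_of_real (1 / 2 * wedge_power 2 (kahler_form H) 2 x)) u) +
      cmod (wedge 4 4 (wedge_list (map H (map e [4..<8]))) (\<lambda>x. complex_of_real (1 / 2 * wedge_power 2 (kahler_form H) 2 x)) u) \<le> 1"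
      by (rule plane_bound[OF e g]) (use u' in \<open>auto simp: u_def\<close>)
    have l1: "wedge_list (map H (map g [0..<8])) = \<Omega>" "wedge_list (map H (map e [0..<4])) = \<Omega>1X"
      unfolding \<Omega> \<Omega>1X wedge_covectors_eq_list by (simp_all add: o_def)
    have l2: "wedge_list (map H (map e [4..<8])) = \<Omega>2X"
      unfolding \<Omega>2X wedge_covectors_eq_list by (rule ext, rule wedge_list_cong) (simp_all del: upt_rec_numeral)
    have s1: "cmod (\<Omega> u) + 1 / fact 4 * \<bar>wedge_power 2 \<omega> 4 u\<bar> + cmod (?N e True {..<4} 2 u) + cmod (?N e True {4..<8} 2 u) \<le> 1"
      using pb unfolding l1 l2 assms(3)[symmetric] W1 W2 .
    have "\<bar>\<Phi> u\<bar> \<le> \<bar>Re (\<Omega> u)\<bar> + \<bar>1 / fact 4 * wedge_power 2 \<omega> 4 u\<bar> + \<bar>Re (?N e True {..<4} 2 u)\<bar> + \<bar>Re (?N e True {4..<8} 2 u)\<bar>"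
      unfolding \<Phi> \<omega>4 \<Omega>_mixed by linarith
    also have "\<dots> \<le> cmod (\<Omega> u) + 1 / fact 4 * \<bar>wedge_power 2 \<omega> 4 u\<bar> + cmod (?N e True {..<4} 2 u) + cmod (?N e True {4..<8} 2 u)"
      by (intro add_mono abs_Re_le_cmod) (simp add: abs_mult)
    finally have s2: "\<bar>\<Phi> u\<bar> \<le> cmod (\<Omega> u) + 1 / fact 4 * \<bar>wedge_power 2 \<omega> 4 u\<bar> + cmod (?N e True {..<4} 2 u) + cmod (?N e True {4..<8} 2 u)" .
    have "\<bar>\<xi> \<Phi>\<bar> = \<bar>\<Phi> u\<bar>" "\<bar>\<xi> (wedge_power 2 \<omega> 4)\<bar> = \<bar>wedge_power 2 \<omega> 4 u\<bar>"
      using D(1) by (simp_all add: ev \<Phi>_alt \<omega>4_alt abs_mult)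
    then show ?thesis
      unfolding W1 W2 using s1 s2 alt
      by (simp only: Let_def cmod_ceval[OF D(1) ev] simp_thms)
  qed
  have "calibration 8 \<Phi>"
  proof -
    have "oriented_planes 8 \<noteq> ({} :: 'a mvector set)"
    proof (rule oriented_planes_nonempty)
      show "e i \<bullet> e j = (if i = j then 1 else 0)" if "i < 8" "j < 8" for i j
        using frame_orthonormal[OF e that] by (simp flip: Re_H)
    qed
    moreover have "\<xi> \<Phi> \<le> 1" if "\<xi> \<in> oriented_planes 8" for \<xi>
      using bound[OF that] unfolding Let_def by linarith
    ultimately have "comass 8 \<Phi> \<le> 1"
      unfolding comass_def by (rule cSUP_least)
    then show ?thesis using \<Phi>_alt by (simp add: calibration_def)
  qed
  then show ?thesis using star bound square by blast
qed

end
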